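(* Let $\mathcal G$ be a braided stability groupoid with stability category $U\mathcal G$, let $R$ be a commutative ring, let $N\in\mathbb N$ and $k,a\in\mathbb N$, and assume condition H3($N$): $\widetilde H_i(R\mathrm{Hom}_{U\mathcal G}(0,-))_n=0$ for all $-1\le i<N$ and all $n>k\cdot i+a$. Let $V$ be a $U\mathcal G$-module and let $d_0,\dots,d_N\in\mathbb Z$ with $d_{i+1}-d_i\ge\max(k,a)$ for all $i$. Then the following are equivalent: (a) there is an exact sequence of $U\mathcal G$-modules $P_N\to P_{N-1}\to\dots\to P_0\to V\to 0$ in which each $P_i$ is freely generated in ranks $\le d_i$; (b) $\widetilde H_i(V)_n=0$ for all $-1\le i<N$ and all $n>d_{i+1}$.
   Context: A stability groupoid is a monoidal groupoid $(\mathcal G,\oplus,0)$ whose monoid of objects is $(\mathbb N,+,0)$; write $G_n=\mathrm{Aut}_{\mathcal G}(n)$. It is required that (i) $\oplus\colon G_m\times G_n\to G_{m+n}$ is injective; (ii) $G_0$ is trivial; (iii) $(G_{l+m}\times 1)\cap(1\times G_{m+n})=1\times G_m\times 1$ inside $G_{l+m+n}$ for all $l,m,n$. A braiding is a braiding of this monoidal groupoid, i.e. elements $b_{m,n}\in G_{m+n}$ with $(g\oplus f)b_{m,n}=b_{m,n}(f\oplus g)$ for $f\in G_m$, $g\in G_n$, and $b_{l,m+n}=(\mathrm{id}_m\oplus b_{l,n})(b_{l,m}\oplus\mathrm{id}_n)$, $b_{l+m,n}=(b_{l,n}\oplus\mathrm{id}_m)(\mathrm{id}_l\oplus b_{m,n})$.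 The stability category $U\mathcal G$ has objects $\mathbb N$, $\mathrm{Hom}(m,n)=\emptyset$ if $m>n$ and $\mathrm{Hom}(m,n)=G_n/G_{n-m}$ (cosets $fG_{n-m}$, with $G_{n-m}\subset G_n$ via $g\mapsto g\oplus\mathrm{id}_m$) if $m\le n$; composition is $fG_l\circ gG_m=f(\mathrm{id}_l\oplus g)G_{l+m}$ for $gG_m\colon n\to m+n$ and $fG_l\colon m+n\to l+m+n$. It is monoidal via $f_1G_{m_1}\oplus f_2G_{m_2}=(f_1\oplus f_2)(\mathrm{id}_{m_1}\oplus b^{-1}_{n_1,m_2}\oplus\mathrm{id}_{n_2})G_{m_1+m_2}$ for $f_jG_{m_j}\colon n_j\to m_j+n_j$; $0$ is initial and $\iota_n\colon 0\to n$ denotes the unique morphism. A $U\mathcal G$-module is a functor $V\colon U\mathcal G\to R\text{-Mod}$; write $V_n=V(n)$, a $G_n$-representation. $R\mathrm{Hom}(m,-)$ denotes the linearized representable functor; $R\mathrm{Hom}(0,-)$ is the constant functor $R$. A $U\mathcal G$-module $P$ is freely generated in ranks $\le m$ if $P\cong\bigoplus_{j\in J}R\mathrm{Hom}(m_j,-)$ with all $m_j\le m$. Central stability complex: $\widetilde C_p(V)_n=RG_n\otimes_{RG_{n-p-1}}V_{n-p-1}$ for $p\ge-1$, $n\ge p+1$ (and $0$ if $n<p+1$), where $G_{n-p-1}\subset G_n$ via $g\mapsto g\oplus\mathrm{id}_{p+1}$; so $\widetilde C_{-1}(V)_n=V_n$. The differential is $\sum_{i=0}^p(-1)^id_i$ with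 $d_i(g\otimes v)=g(\mathrm{id}_{n-p-1}\oplus b_{1,i}\oplus\mathrm{id}_{p-i})\otimes V(\mathrm{id}_{n-p-1}\oplus\iota_1)(v)$ (for $p=0$: $g\otimes v\mapsto g\cdot V(\mathrm{id}_{n-1}\oplus\iota_1)(v)\in V_n$). Its homology in degree $i\ge -1$ is the central stability homology $\widetilde H_i(V)_n$. *)

theory Defs
  imports "HOL-Algebra.Algebra"
begin

text \<open>A (strict) monoidal groupoid with object monoid (nat,+,0) is encoded by the family of
  automorphism groups G n = Aut(n) (all carried by one element type 'g) together with the
  monoidal product on morphisms  os m n f g = f \<oplus> g  (G m \<times> G n \<rightarrow> G (m+n)).\<close>

definition stability_groupoid ::
  "(nat \<Rightarrow> 'g monoid) \<Rightarrow> (nat \<Rightarrow> nat \<Rightarrow> 'g \<Rightarrow> 'g \<Rightarrow> 'g) \<Rightarrow> bool" where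
  "stability_groupoid G os \<longleftrightarrow>
     (\<forall>n. group (G n)) \<and>
     \<comment> \<open>the monoidal product is a functor G m \<times> G n \<rightarrow> G (m+n)\<close>
     (\<forall>m n f g. f \<in> carrier (G m) \<and> g \<in> carrier (G n) \<longrightarrow> os m n f g \<in> carrier (G (m+n))) \<and>
     (\<forall>m n f f' g g'. f \<in> carrier (G m) \<and> f' \<in> carrier (G m) \<and> g \<in> carrier (G n) \<and> g' \<in> carrier (G n)
        \<longrightarrow> os m n (monoid.mult (G m) f f') (monoid.mult (G n) g g') = monoid.mult (G (m+n)) (os m n f g) (os m n f' g')) \<and>
     (\<forall>m n. os m n (monoid.one (G m)) (monoid.one (G n)) = monoid.one (G (m+n))) \<and>
     \<comment> \<open>strict associativity and unit\<close>
     (\<forall>l m n f g h. f \<in> carrier (G l) \<and> g \<in> carrier (G m) \<and> h \<in> carrier (G n)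
        \<longrightarrow> os (l+m) n (os l m f g) h = os l (m+n) f (os m n g h)) \<and>
     (\<forall>n g. g \<in> carrier (G n) \<longrightarrow> os 0 n (monoid.one (G 0)) g = g \<and> os n 0 g (monoid.one (G 0)) = g) \<and>
     \<comment> \<open>(i) injectivity\<close>
     (\<forall>m n f f' g g'. f \<in> carrier (G m) \<and> f' \<in> carrier (G m) \<and> g \<in> carrier (G n) \<and> g' \<in> carrier (G n)
        \<and> os m n f g = os m n f' g' \<longrightarrow> f = f' \<and> g = g') \<and>
     \<comment> \<open>(ii) G 0 trivial\<close>
     carrier (G 0) = {monoid.one (G 0)} \<and>
     \<comment> \<open>(iii) intersection condition\<close>
     (\<forall>l m n. (\<lambda>x. os (l+m) n x (monoid.one (G n))) ` carrier (G (l+m))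
              \<inter> (\<lambda>y. os l (m+n) (monoid.one (G l)) y) ` carrier (G (m+n))
            = (\<lambda>z. os l (m+n) (monoid.one (G l)) (os m n z (monoid.one (G n)))) ` carrier (G m))"

definition braiding ::
  "(nat \<Rightarrow> 'g monoid) \<Rightarrow> (nat \<Rightarrow> nat \<Rightarrow> 'g \<Rightarrow> 'g \<Rightarrow> 'g) \<Rightarrow> (nat \<Rightarrow> nat \<Rightarrow> 'g) \<Rightarrow> bool" where
  "braiding G os b \<longleftrightarrow>
     (\<forall>m n. b m n \<in> carrier (G (m+n))) \<and>
     (\<forall>m n f g. f \<in> carrier (G m) \<and> g \<in> carrier (G n) \<longrightarrow>
        monoid.mult (G (m+n)) (os n m g f) (b m n) = monoid.mult (G (m+n)) (b m n) (os m n f g)) \<and>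
     (\<forall>l m n. b l (m+n) =
        monoid.mult (G (l+m+n)) (os m (l+n) (monoid.one (G m)) (b l n)) (os (l+m) n (b l m) (monoid.one (G n)))) \<and>
     (\<forall>l m n. b (l+m) n =
        monoid.mult (G (l+m+n)) (os (l+n) m (b l n) (monoid.one (G m))) (os l (m+n) (monoid.one (G l)) (b m n)))"

definition stabsub :: "(nat \<Rightarrow> 'g monoid) \<Rightarrow> (nat \<Rightarrow> nat \<Rightarrow> 'g \<Rightarrow> 'g \<Rightarrow> 'g) \<Rightarrow> nat \<Rightarrow> nat \<Rightarrow> 'g set" where
  "stabsub G os m n = (\<lambda>g. os m n g (monoid.one (G n))) ` carrier (G m)"

definition UHom :: "(nat \<Rightarrow> 'g monoid) \<Rightarrow> (nat \<Rightarrow> nat \<Rightarrow> 'g \<Rightarrow> 'g \<Rightarrow> 'g) \<Rightarrow> nat \<Rightarrow> nat \<Rightarrow> 'g set set" where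
  "UHom G os s t = (if s \<le> t then (\<lambda>f. l_coset (G t) f (stabsub G os (t - s) s)) ` carrier (G t) else {})"

definition crep :: "'a set \<Rightarrow> 'a" where
  "crep A = (SOME x. x \<in> A)"

definition ucomp :: "(nat \<Rightarrow> 'g monoid) \<Rightarrow> (nat \<Rightarrow> nat \<Rightarrow> 'g \<Rightarrow> 'g \<Rightarrow> 'g) \<Rightarrow> nat \<Rightarrow> nat \<Rightarrow> nat \<Rightarrow> 'g set \<Rightarrow> 'g set \<Rightarrow> 'g set" where
  "ucomp G os s t u \<Psi> \<Phi> =
     l_coset (G u) (monoid.mult (G u) (crep \<Psi>) (os (u - t) t (monoid.one (G (u - t))) (crep \<Phi>))) (stabsub G os (u - s) s)"

definition uid :: "(nat \<Rightarrow> 'g monoid) \<Rightarrow> (nat \<Rightarrow> nat \<Rightarrow> 'g \<Rightarrow> 'g \<Rightarrow> 'g) \<Rightarrow> nat \<Rightarrow> 'g set" where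
  "uid G os n = l_coset (G n) (monoid.one (G n)) (stabsub G os 0 n)"

definition iota :: "(nat \<Rightarrow> 'g monoid) \<Rightarrow> (nat \<Rightarrow> nat \<Rightarrow> 'g \<Rightarrow> 'g \<Rightarrow> 'g) \<Rightarrow> nat \<Rightarrow> 'g set" where
  "iota G os n = l_coset (G n) (monoid.one (G n)) (stabsub G os n 0)"

text \<open>Monoidal product of F1 = f1 G_m1 : n1 \<rightarrow> m1+n1 and F2 = f2 G_m2 : n2 \<rightarrow> m2+n2.\<close>
definition uoplus :: "(nat \<Rightarrow> 'g monoid) \<Rightarrow> (nat \<Rightarrow> nat \<Rightarrow> 'g \<Rightarrow> 'g \<Rightarrow> 'g) \<Rightarrow> (nat \<Rightarrow> nat \<Rightarrow> 'g) \<Rightarrow>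
    nat \<Rightarrow> nat \<Rightarrow> 'g set \<Rightarrow> nat \<Rightarrow> nat \<Rightarrow> 'g set \<Rightarrow> 'g set" where
  "uoplus G os b n1 m1 F1 n2 m2 F2 =
     l_coset (G (m1 + n1 + m2 + n2))
       (monoid.mult (G (m1 + n1 + m2 + n2)) (os (m1 + n1) (m2 + n2) (crep F1) (crep F2))
          (os m1 (n1 + m2 + n2) (monoid.one (G m1))
             (os (n1 + m2) n2 (m_inv (G (n1 + m2)) (b n1 m2)) (monoid.one (G n2)))))
       (stabsub G os (m1 + m2) (n1 + n2))"

definition ginc :: "(nat \<Rightarrow> 'g monoid) \<Rightarrow> (nat \<Rightarrow> nat \<Rightarrow> 'g \<Rightarrow> 'g \<Rightarrow> 'g) \<Rightarrow> (nat \<Rightarrow> nat \<Rightarrow> 'g) \<Rightarrow> nat \<Rightarrow> 'g set" where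
  "ginc G os b a = uoplus G os b a 0 (uid G os a) 0 1 (iota G os 1)"

definition linear_map :: "'r ring \<Rightarrow> ('r,'x) module \<Rightarrow> ('r,'y) module \<Rightarrow> ('x \<Rightarrow> 'y) \<Rightarrow> bool" where
  "linear_map R M M' f \<longleftrightarrow>
     (\<forall>x\<in>carrier M. f x \<in> carrier M') \<and>
     (\<forall>x\<in>carrier M. \<forall>y\<in>carrier M. f (ring.add M x y) = ring.add M' (f x) (f y)) \<and>
     (\<forall>r\<in>carrier R. \<forall>x\<in>carrier M. f (module.smult M r x) = module.smult M' r (f x))"

definition ug_module :: "(nat \<Rightarrow> 'g monoid) \<Rightarrow> (nat \<Rightarrow> nat \<Rightarrow> 'g \<Rightarrow> 'g \<Rightarrow> 'g) \<Rightarrow> 'r ring \<Rightarrow>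
    (nat \<Rightarrow> ('r,'x) module) \<Rightarrow> (nat \<Rightarrow> nat \<Rightarrow> 'g set \<Rightarrow> 'x \<Rightarrow> 'x) \<Rightarrow> bool" where
  "ug_module G os R M act \<longleftrightarrow>
     (\<forall>n. module R (M n)) \<and>
     (\<forall>s t \<phi>. \<phi> \<in> UHom G os s t \<longrightarrow> linear_map R (M s) (M t) (act s t \<phi>)) \<and>
     (\<forall>n x. x \<in> carrier (M n) \<longrightarrow> act n n (uid G os n) x = x) \<and>
     (\<forall>s t u \<phi> \<psi> x. \<phi> \<in> UHom G os s t \<and> \<psi> \<in> UHom G os t u \<and> x \<in> carrier (M s) \<longrightarrow>
        act s u (ucomp G os s t u \<psi> \<phi>) x = act t u \<psi> (act s t \<phi> x))"

definition ug_hom :: "(nat \<Rightarrow> 'g monoid) \<Rightarrow> (nat \<Rightarrow> nat \<Rightarrow> 'g \<Rightarrow> 'g \<Rightarrow> 'g) \<Rightarrow> 'r ring \<Rightarrow>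
    (nat \<Rightarrow> ('r,'x) module) \<Rightarrow> (nat \<Rightarrow> nat \<Rightarrow> 'g set \<Rightarrow> 'x \<Rightarrow> 'x) \<Rightarrow>
    (nat \<Rightarrow> ('r,'y) module) \<Rightarrow> (nat \<Rightarrow> nat \<Rightarrow> 'g set \<Rightarrow> 'y \<Rightarrow> 'y) \<Rightarrow> (nat \<Rightarrow> 'x \<Rightarrow> 'y) \<Rightarrow> bool" where
  "ug_hom G os R M act M' act' \<eta> \<longleftrightarrow>
     (\<forall>n. linear_map R (M n) (M' n) (\<eta> n)) \<and>
     (\<forall>s t \<phi> x. \<phi> \<in> UHom G os s t \<and> x \<in> carrier (M s) \<longrightarrow> \<eta> t (act s t \<phi> x) = act' s t \<phi> (\<eta> s x))"

text \<open>The linearized representable functor sum: (\<Oplus>_{j \<in> J} R Hom(rk j, -))(n), as finitely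
  supported R-valued functions on the pairs (j, \<phi>) with j \<in> J, \<phi> \<in> Hom(rk j, n).\<close>
definition free_mod :: "(nat \<Rightarrow> 'g monoid) \<Rightarrow> (nat \<Rightarrow> nat \<Rightarrow> 'g \<Rightarrow> 'g \<Rightarrow> 'g) \<Rightarrow> 'r ring \<Rightarrow>
    'j set \<Rightarrow> ('j \<Rightarrow> nat) \<Rightarrow> nat \<Rightarrow> ('r, ('j \<times> 'g set) \<Rightarrow> 'r) module" where
  "free_mod G os R J rk n =
     \<lparr>partial_object.carrier = {c. (\<forall>x. c x \<in> carrier R) \<and> finite {x. c x \<noteq> ring.zero R} \<and>
                    {x. c x \<noteq> ring.zero R} \<subseteq> {(j, \<phi>). j \<in> J \<and> \<phi> \<in> UHom G os (rk j) n}},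
      monoid.mult = (\<lambda>c d. undefined), monoid.one = undefined,
      ring.zero = (\<lambda>x. ring.zero R), ring.add = (\<lambda>c d x. ring.add R (c x) (d x)),
      module.smult = (\<lambda>r c x. monoid.mult R r (c x))\<rparr>"

definition free_act :: "(nat \<Rightarrow> 'g monoid) \<Rightarrow> (nat \<Rightarrow> nat \<Rightarrow> 'g \<Rightarrow> 'g \<Rightarrow> 'g) \<Rightarrow> 'r ring \<Rightarrow>
    ('j \<Rightarrow> nat) \<Rightarrow> nat \<Rightarrow> nat \<Rightarrow> 'g set \<Rightarrow> (('j \<times> 'g set) \<Rightarrow> 'r) \<Rightarrow> (('j \<times> 'g set) \<Rightarrow> 'r)" where
  "free_act G os R rk s t \<psi> c =
     (\<lambda>(j, \<phi>'). finsum R (\<lambda>\<phi>. c (j, \<phi>))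
        {\<phi>. \<phi> \<in> UHom G os (rk j) s \<and> c (j, \<phi>) \<noteq> ring.zero R \<and> ucomp G os (rk j) s t \<psi> \<phi> = \<phi>'})"

definition free_gen_le :: "(nat \<Rightarrow> 'g monoid) \<Rightarrow> (nat \<Rightarrow> nat \<Rightarrow> 'g \<Rightarrow> 'g \<Rightarrow> 'g) \<Rightarrow> 'r ring \<Rightarrow>
    (nat \<Rightarrow> ('r,'x) module) \<Rightarrow> (nat \<Rightarrow> nat \<Rightarrow> 'g set \<Rightarrow> 'x \<Rightarrow> 'x) \<Rightarrow> int \<Rightarrow> bool" where
  "free_gen_le G os R M act d \<longleftrightarrow>
     (\<exists>(J :: 'x set) rk \<eta>. (\<forall>j\<in>J. int (rk j) \<le> d) \<and>
        ug_hom G os R (free_mod G os R J rk) (free_act G os R rk) M act \<eta> \<and>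
        (\<forall>n. bij_betw (\<eta> n) (carrier (free_mod G os R J rk n)) (carrier (M n))))"

definition free_resolution :: "(nat \<Rightarrow> 'g monoid) \<Rightarrow> (nat \<Rightarrow> nat \<Rightarrow> 'g \<Rightarrow> 'g \<Rightarrow> 'g) \<Rightarrow> 'r ring \<Rightarrow>
    nat \<Rightarrow> (nat \<Rightarrow> int) \<Rightarrow>
    (nat \<Rightarrow> ('r,'v) module) \<Rightarrow> (nat \<Rightarrow> nat \<Rightarrow> 'g set \<Rightarrow> 'v \<Rightarrow> 'v) \<Rightarrow>
    (nat \<Rightarrow> nat \<Rightarrow> ('r,'p) module) \<Rightarrow> (nat \<Rightarrow> nat \<Rightarrow> nat \<Rightarrow> 'g set \<Rightarrow> 'p \<Rightarrow> 'p) \<Rightarrow>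
    (nat \<Rightarrow> nat \<Rightarrow> 'p \<Rightarrow> 'p) \<Rightarrow> (nat \<Rightarrow> 'p \<Rightarrow> 'v) \<Rightarrow> bool" where
  "free_resolution G os R N d V Vact P Pact \<delta> \<epsilon> \<longleftrightarrow>
     (\<forall>i\<le>N. ug_module G os R (P i) (Pact i) \<and> free_gen_le G os R (P i) (Pact i) (d i)) \<and>
     (\<forall>i<N. ug_hom G os R (P (Suc i)) (Pact (Suc i)) (P i) (Pact i) (\<delta> i)) \<and>
     ug_hom G os R (P 0) (Pact 0) V Vact \<epsilon> \<and>
     (\<forall>n. \<epsilon> n ` carrier (P 0 n) = carrier (V n)) \<and>
     (1 \<le> N \<longrightarrow> (\<forall>n. \<delta> 0 n ` carrier (P 1 n) = {x \<in> carrier (P 0 n). \<epsilon> n x = ring.zero (V n)})) \<and>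
     (\<forall>i n. 1 \<le> i \<and> i < N \<longrightarrow>
        \<delta> i n ` carrier (P (Suc i) n) = {x \<in> carrier (P i n). \<delta> (i - 1) n x = ring.zero (P (i - 1) n)})"

text \<open>The constant UG-module R = R Hom(0,-).\<close>
definition ring_mod :: "'r ring \<Rightarrow> ('r,'r) module" where
  "ring_mod R = \<lparr>partial_object.carrier = carrier R, monoid.mult = monoid.mult R, monoid.one = monoid.one R, ring.zero = ring.zero R, ring.add = ring.add R,
                 module.smult = monoid.mult R\<rparr>"

definition const_act :: "nat \<Rightarrow> nat \<Rightarrow> 'g set \<Rightarrow> 'r \<Rightarrow> 'r" where
  "const_act s t \<phi> x = x"

definition gact :: "(nat \<Rightarrow> 'g monoid) \<Rightarrow> (nat \<Rightarrow> nat \<Rightarrow> 'g \<Rightarrow> 'g \<Rightarrow> 'g) \<Rightarrow>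
    (nat \<Rightarrow> nat \<Rightarrow> 'g set \<Rightarrow> 'x \<Rightarrow> 'x) \<Rightarrow> nat \<Rightarrow> 'g \<Rightarrow> 'x \<Rightarrow> 'x" where
  "gact G os act n g x = act n n (l_coset (G n) g (stabsub G os 0 n)) x"

definition minc :: "(nat \<Rightarrow> 'g monoid) \<Rightarrow> (nat \<Rightarrow> nat \<Rightarrow> 'g \<Rightarrow> 'g \<Rightarrow> 'g) \<Rightarrow> (nat \<Rightarrow> nat \<Rightarrow> 'g) \<Rightarrow>
    (nat \<Rightarrow> nat \<Rightarrow> 'g set \<Rightarrow> 'x \<Rightarrow> 'x) \<Rightarrow> nat \<Rightarrow> 'x \<Rightarrow> 'x" where
  "minc G os b act a x = act a (Suc a) (ginc G os b a) x"

text \<open>Formal R-linear combinations (lists of coefficient/generator pairs) and their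
  coefficient functions, i.e. elements of a free R-module.\<close>
definition fs :: "'r ring \<Rightarrow> ('r \<times> 'k) list \<Rightarrow> 'k \<Rightarrow> 'r" where
  "fs R L = (\<lambda>k. foldr (\<lambda>(r, k') acc. if k' = k then ring.add R r acc else acc) L (ring.zero R))"

definition valid :: "'r ring \<Rightarrow> 'k set \<Rightarrow> ('r \<times> 'k) list \<Rightarrow> bool" where
  "valid R S L \<longleftrightarrow> (\<forall>(r, k)\<in>set L. r \<in> carrier R \<and> k \<in> S)"

definition in_span :: "'r ring \<Rightarrow> ('r \<times> 'k) list set \<Rightarrow> ('r \<times> 'k) list \<Rightarrow> bool" where
  "in_span R S L \<longleftrightarrow>
     (\<exists>ts. (\<forall>(r, s)\<in>set ts. r \<in> carrier R \<and> s \<in> S) \<and>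
        fs R L = fs R (concat (map (\<lambda>(r, s). map (\<lambda>(a, k). (monoid.mult R r a, k)) s) ts)))"

text \<open>Generators g \<otimes> x of C_p(M)_n = RG_n \<otimes>_{RG_(n-p-1)} M_(n-p-1)  (p \<ge> 0); none if n < p+1.\<close>
definition cs_gens :: "(nat \<Rightarrow> 'g monoid) \<Rightarrow> (nat \<Rightarrow> ('r,'x) module) \<Rightarrow> nat \<Rightarrow> nat \<Rightarrow> ('g \<times> 'x) set" where
  "cs_gens G M p n = {(g, x). p + 1 \<le> n \<and> g \<in> carrier (G n) \<and> x \<in> carrier (M (n - p - 1))}"

text \<open>Defining relations of the tensor product RG_n \<otimes>_{RG_m} M_m, m = n-p-1, as a quotient of
  the free R-module on G_n \<times> M_m; G_m \<subseteq> G_n via h \<mapsto> h \<oplus> id_(p+1).\<close>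
definition cs_rels :: "(nat \<Rightarrow> 'g monoid) \<Rightarrow> (nat \<Rightarrow> nat \<Rightarrow> 'g \<Rightarrow> 'g \<Rightarrow> 'g) \<Rightarrow> 'r ring \<Rightarrow>
    (nat \<Rightarrow> ('r,'x) module) \<Rightarrow> (nat \<Rightarrow> nat \<Rightarrow> 'g set \<Rightarrow> 'x \<Rightarrow> 'x) \<Rightarrow> nat \<Rightarrow> nat \<Rightarrow>
    ('r \<times> ('g \<times> 'x)) list set" where
  "cs_rels G os R M act p n =
     {[(monoid.one R, (g, ring.add (M (n - p - 1)) x y)), (a_inv R (monoid.one R), (g, x)), (a_inv R (monoid.one R), (g, y))] | g x y.
        (g, x) \<in> cs_gens G M p n \<and> (g, y) \<in> cs_gens G M p n} \<union>
     {[(monoid.one R, (g, module.smult (M (n - p - 1)) r x)), (a_inv R r, (g, x))] | g x r.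
        (g, x) \<in> cs_gens G M p n \<and> r \<in> carrier R} \<union>
     {[(monoid.one R, (monoid.mult (G n) g (os (n - p - 1) (p + 1) h (monoid.one (G (p + 1)))), x)),
       (a_inv R (monoid.one R), (g, gact G os act (n - p - 1) h x))] | g h x.
        (g, x) \<in> cs_gens G M p n \<and> h \<in> carrier (G (n - p - 1))}"

definition cs_eq :: "(nat \<Rightarrow> 'g monoid) \<Rightarrow> (nat \<Rightarrow> nat \<Rightarrow> 'g \<Rightarrow> 'g \<Rightarrow> 'g) \<Rightarrow> 'r ring \<Rightarrow>
    (nat \<Rightarrow> ('r,'x) module) \<Rightarrow> (nat \<Rightarrow> nat \<Rightarrow> 'g set \<Rightarrow> 'x \<Rightarrow> 'x) \<Rightarrow> nat \<Rightarrow> nat \<Rightarrow>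
    ('r \<times> ('g \<times> 'x)) list \<Rightarrow> ('r \<times> ('g \<times> 'x)) list \<Rightarrow> bool" where
  "cs_eq G os R M act p n L L' \<longleftrightarrow>
     in_span R (cs_rels G os R M act p n) (L @ map (\<lambda>(r, k). (a_inv R r, k)) L')"

definition cs_face :: "(nat \<Rightarrow> 'g monoid) \<Rightarrow> (nat \<Rightarrow> nat \<Rightarrow> 'g \<Rightarrow> 'g \<Rightarrow> 'g) \<Rightarrow> (nat \<Rightarrow> nat \<Rightarrow> 'g) \<Rightarrow>
    nat \<Rightarrow> nat \<Rightarrow> nat \<Rightarrow> 'g" where
  "cs_face G os b p n i =
     os (n - p - 1) (p + 1) (monoid.one (G (n - p - 1))) (os (1 + i) (p - i) (b 1 i) (monoid.one (G (p - i))))"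

definition cs_d :: "(nat \<Rightarrow> 'g monoid) \<Rightarrow> (nat \<Rightarrow> nat \<Rightarrow> 'g \<Rightarrow> 'g \<Rightarrow> 'g) \<Rightarrow> (nat \<Rightarrow> nat \<Rightarrow> 'g) \<Rightarrow> 'r ring \<Rightarrow>
    (nat \<Rightarrow> nat \<Rightarrow> 'g set \<Rightarrow> 'x \<Rightarrow> 'x) \<Rightarrow> nat \<Rightarrow> nat \<Rightarrow>
    ('r \<times> ('g \<times> 'x)) list \<Rightarrow> ('r \<times> ('g \<times> 'x)) list" where
  "cs_d G os b R act p n L =
     concat (map (\<lambda>(r, (g, x)). map (\<lambda>i. (if even i then r else a_inv R r,
                   (monoid.mult (G n) g (cs_face G os b p n i), minc G os b act (n - p - 1) x))) [0..<p + 1]) L)"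

definition cs_d0 :: "(nat \<Rightarrow> 'g monoid) \<Rightarrow> (nat \<Rightarrow> nat \<Rightarrow> 'g \<Rightarrow> 'g \<Rightarrow> 'g) \<Rightarrow> (nat \<Rightarrow> nat \<Rightarrow> 'g) \<Rightarrow>
    (nat \<Rightarrow> ('r,'x) module) \<Rightarrow> (nat \<Rightarrow> nat \<Rightarrow> 'g set \<Rightarrow> 'x \<Rightarrow> 'x) \<Rightarrow> nat \<Rightarrow>
    ('r \<times> ('g \<times> 'x)) list \<Rightarrow> 'x" where
  "cs_d0 G os b M act n L =
     foldr (\<lambda>(r, (g, x)) acc. ring.add (M n) (module.smult (M n) r (gact G os act n g (minc G os b act (n - 1) x))) acc)
       L (ring.zero (M n))"

definition cs_homology_vanishes :: "(nat \<Rightarrow> 'g monoid) \<Rightarrow> (nat \<Rightarrow> nat \<Rightarrow> 'g \<Rightarrow> 'g \<Rightarrow> 'g) \<Rightarrow>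
    (nat \<Rightarrow> nat \<Rightarrow> 'g) \<Rightarrow> 'r ring \<Rightarrow>
    (nat \<Rightarrow> ('r,'x) module) \<Rightarrow> (nat \<Rightarrow> nat \<Rightarrow> 'g set \<Rightarrow> 'x \<Rightarrow> 'x) \<Rightarrow> int \<Rightarrow> nat \<Rightarrow> bool" where
  "cs_homology_vanishes G os b R M act i n \<longleftrightarrow>
     (if i = -1 then
        (\<forall>x\<in>carrier (M n). \<exists>L. valid R (cs_gens G M 0 n) L \<and> cs_d0 G os b M act n L = x)
      else if i = 0 then
        (\<forall>L. valid R (cs_gens G M 0 n) L \<and> cs_d0 G os b M act n L = ring.zero (M n) \<longrightarrow>
           (\<exists>L'. valid R (cs_gens G M 1 n) L' \<and> cs_eq G os R M act 0 n (cs_d G os b R act 1 n L') L))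
      else if i \<ge> 1 then
        (\<forall>L. valid R (cs_gens G M (nat i) n) L \<and> cs_eq G os R M act (nat i - 1) n (cs_d G os b R act (nat i) n L) [] \<longrightarrow>
           (\<exists>L'. valid R (cs_gens G M (nat i + 1) n) L' \<and>
                 cs_eq G os R M act (nat i) n (cs_d G os b R act (nat i + 1) n L') L))
      else True)"

end

theory Submission
  imports Defs "HOL-Library.Multiset"
begin

text \<open>
  Since \<open>R[G_n]\<close> is free over \<open>R[G_(n-p-1)]\<close>, a short exact sequence \<open>0 \<rightarrow> K \<rightarrow> P \<rightarrow> V \<rightarrow> 0\<close> of modules induces a
  short exact sequence of central stability complexes. If \<open>P\<close> is free on generators of rank at most \<open>d_0\<close>, the
  braiding identifies the complex of \<open>P\<close> in rank \<open>n\<close> with a sum of complexes induced from those of the constant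
  functor in ranks \<open>n - m\<close>, \<open>m \<le> d_0\<close>; so by H3 the homology of \<open>P\<close> vanishes in degree \<open>i\<close> beyond
  \<open>k i + a + d_0 \<le> d_(i+1)\<close>, and in degree \<open>-1\<close> beyond \<open>d_0\<close>. The long exact sequence then turns the vanishing range
  of \<open>V\<close> into the one of \<open>K\<close> shifted by one degree, and conversely. Vanishing in degree \<open>-1\<close> beyond \<open>d_0\<close> says that
  \<open>V\<close> is generated in ranks at most \<open>d_0\<close>, i.e. covered by such a \<open>P\<close>; the theorem follows by induction on \<open>N\<close>.
\<close>

section \<open>Induced modules as lists modulo relations\<close>

text \<open>Three obstacles shape the development. First, exactness of induction needs a way to read
  off coefficients: a chain can be rewritten so that its group elements lie in distinct cosets, and
  then \<open>ev\<close> recovers every entry; injectivity, exactness in the middle and the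
  splitting of free modules all rest on this. Second, the faces satisfy the simplicial identities
  only up to a crossing \<open>b 1 1\<close> of two added points; stabilising twice is invariant
  under that crossing, so the differential still squares to zero. A similar absorption removes the
  leftover braid when the complex of a free module is compared with that of the constant functor.
  Third, all modules of the resolution must live in one type \<open>'p\<close>, so free covers are
  encoded in \<open>'p\<close> along injections, and kernels keep the type of their ambient module.
  The constant max(k,a) comes from k(q - 1) + a \<le> q max(k,a) for q \<ge> 1: the first step costs
  a, each later one k, and after passing to a kernel any step may be the first.\<close>

text \<open>
  The list \<open>[(g\<^sub>1, x\<^sub>1), \<dots>]\<close> stands for the element \<open>\<Sum> g\<^sub>i \<otimes> x\<^sub>i\<close> of the module induced along \<open>\<iota>\<close>; scalars are absorbed
  into the \<open>x\<^sub>i\<close>. The relation \<open>teq\<close> below presents this module by generators and relations, and \<open>ev\<close> realises it as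
  a module of \<open>H\<close>-equivariant functions on \<open>A\<close>.
\<close>

locale ind_mod = A: group A + H: group H + M: abelian_group M
  for A :: "'a monoid" and H :: "'h monoid" and M :: "('x, 'm) ring_scheme" +
  fixes \<iota> :: "'h \<Rightarrow> 'a" and ac :: "'h \<Rightarrow> 'x \<Rightarrow> 'x"
  assumes emb_closed: "h \<in> carrier H \<Longrightarrow> \<iota> h \<in> carrier A"
    and emb_mult: "\<lbrakk>h \<in> carrier H; h' \<in> carrier H\<rbrakk> \<Longrightarrow> \<iota> (h \<otimes>\<^bsub>H\<^esub> h') = \<iota> h \<otimes>\<^bsub>A\<^esub> \<iota> h'"
    and emb_inj: "inj_on \<iota> (carrier H)"
    and ac_closed: "\<lbrakk>h \<in> carrier H; x \<in> carrier M\<rbrakk> \<Longrightarrow> ac h x \<in> carrier M"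
    and ac_add: "\<lbrakk>h \<in> carrier H; x \<in> carrier M; y \<in> carrier M\<rbrakk> \<Longrightarrow> ac h (x \<oplus>\<^bsub>M\<^esub> y) = ac h x \<oplus>\<^bsub>M\<^esub> ac h y"
    and ac_one: "x \<in> carrier M \<Longrightarrow> ac \<one>\<^bsub>H\<^esub> x = x"
    and ac_mult: "\<lbrakk>h \<in> carrier H; h' \<in> carrier H; x \<in> carrier M\<rbrakk> \<Longrightarrow> ac (h \<otimes>\<^bsub>H\<^esub> h') x = ac h (ac h' x)"
begin

definition chains :: "('a \<times> 'x) list set" where
  "chains = {l. \<forall>(g, x)\<in>set l. g \<in> carrier A \<and> x \<in> carrier M}"

lemma chains_Nil [simp]: "[] \<in> chains"
  by (simp add: chains_def)

lemma chains_Cons [simp]: "(g, x) # l \<in> chains \<longleftrightarrow> g \<in> carrier A \<and> x \<in> carrier M \<and> l \<in> chains"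
  by (auto simp: chains_def)

lemma chains_append [simp]: "l @ k \<in> chains \<longleftrightarrow> l \<in> chains \<and> k \<in> chains"
  by (auto simp: chains_def)

inductive teq :: "('a \<times> 'x) list \<Rightarrow> ('a \<times> 'x) list \<Rightarrow> bool" (infix \<open>\<bowtie>\<close> 50) where
  refl: "l \<in> chains \<Longrightarrow> l \<bowtie> l"
| sym: "l \<bowtie> k \<Longrightarrow> k \<bowtie> l"
| trans: "l \<bowtie> k \<Longrightarrow> k \<bowtie> j \<Longrightarrow> l \<bowtie> j"
| append: "l \<bowtie> l' \<Longrightarrow> k \<bowtie> k' \<Longrightarrow> l @ k \<bowtie> l' @ k'"
| comm: "l \<in> chains \<Longrightarrow> k \<in> chains \<Longrightarrow> l @ k \<bowtie> k @ l"
| zero: "g \<in> carrier A \<Longrightarrow> [(g, \<zero>\<^bsub>M\<^esub>)] \<bowtie> []"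
| add: "\<lbrakk>g \<in> carrier A; x \<in> carrier M; y \<in> carrier M\<rbrakk> \<Longrightarrow> [(g, x \<oplus>\<^bsub>M\<^esub> y)] \<bowtie> [(g, x), (g, y)]"
| act: "\<lbrakk>g \<in> carrier A; h \<in> carrier H; x \<in> carrier M\<rbrakk> \<Longrightarrow> [(g \<otimes>\<^bsub>A\<^esub> \<iota> h, x)] \<bowtie> [(g, ac h x)]"

declare trans [trans]

lemma teq_chains: "l \<bowtie> k \<Longrightarrow> l \<in> chains \<and> k \<in> chains"
  by (induction rule: teq.induct) (auto simp: emb_closed ac_closed)

lemma teq_Cons: "\<lbrakk>l \<bowtie> l'; g \<in> carrier A; x \<in> carrier M\<rbrakk> \<Longrightarrow> (g, x) # l \<bowtie> (g, x) # l'"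
  using append[of "[(g, x)]" "[(g, x)]" l l'] refl[of "[(g, x)]"] by simp

lemma ac_zero: "h \<in> carrier H \<Longrightarrow> ac h \<zero>\<^bsub>M\<^esub> = \<zero>\<^bsub>M\<^esub>"
  by (metis M.add.r_cancel_one' M.zero_closed ac_add ac_closed M.l_zero)

lemma emb_one: "\<iota> \<one>\<^bsub>H\<^esub> = \<one>\<^bsub>A\<^esub>"
  by (metis A.l_cancel_one' H.one_closed H.l_one emb_closed emb_mult)

lemma emb_inv: "h \<in> carrier H \<Longrightarrow> \<iota> (inv\<^bsub>H\<^esub> h) = inv\<^bsub>A\<^esub> (\<iota> h)"
  by (metis A.inv_equality H.inv_closed H.l_inv emb_closed emb_mult emb_one)

text \<open>The rule \<open>comm\<close> only swaps two whole chains; moving the head entry to its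
  place, one entry at a time, generates every permutation.\<close>

lemma teq_mset: "mset l = mset k \<Longrightarrow> l \<in> chains \<Longrightarrow> l \<bowtie> k"
proof (induction l arbitrary: k)
  case Nil
  then show ?case by (simp add: refl)
next
  case (Cons a l)
  then obtain k1 k2 where k: "k = k1 @ a # k2"
    by (metis list.set_intros(1) set_mset_mset split_list)
  with Cons.prems have ms: "mset l = mset (k1 @ k2)" by simp
  obtain g x where a: "a = (g, x)" by (cases a)
  have ch: "g \<in> carrier A" "x \<in> carrier M" "l \<in> chains"
    using Cons.prems a by auto
  from Cons.IH[OF ms ch(3)] have lk: "l \<bowtie> k1 @ k2" .
  then have kk: "k1 \<in> chains" "k2 \<in> chains" using teq_chains by fastforce+
  have "a # l \<bowtie> ([a] @ k1) @ k2" using teq_Cons[OF lk ch(1,2)] a by simp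
  also have "\<dots> \<bowtie> (k1 @ [a]) @ k2"
    by (rule append[OF comm refl]) (use a ch kk in auto)
  finally show ?case using k by simp
qed

text \<open>If g = g' \<iota>(h), then g \<otimes> x = g' \<otimes> hx. So this is the coordinate of
  g \<otimes> x at the coset of \<open>g'\<close>, with \<open>g'\<close> as the chosen
  representative.\<close>

definition ev1 :: "'a \<Rightarrow> 'a \<Rightarrow> 'x \<Rightarrow> 'x" where
  "ev1 g' g x = (if inv\<^bsub>A\<^esub> g' \<otimes>\<^bsub>A\<^esub> g \<in> \<iota> ` carrier H
     then ac (the_inv_into (carrier H) \<iota> (inv\<^bsub>A\<^esub> g' \<otimes>\<^bsub>A\<^esub> g)) x else \<zero>\<^bsub>M\<^esub>)"

lemma ev1_eq': "\<lbrakk>g \<in> carrier A; g' \<in> carrier A; h \<in> carrier H; inv\<^bsub>A\<^esub> g' \<otimes>\<^bsub>A\<^esub> g = \<iota> h\<rbrakk> \<Longrightarrow> ev1 g' g x = ac h x"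
  by (simp add: ev1_def the_inv_into_f_f[OF emb_inj])

lemma ev1_out: "inv\<^bsub>A\<^esub> g' \<otimes>\<^bsub>A\<^esub> g \<notin> \<iota> ` carrier H \<Longrightarrow> ev1 g' g x = \<zero>\<^bsub>M\<^esub>"
  by (simp add: ev1_def)

lemma ev1_cases:
  assumes "g \<in> carrier A" "g' \<in> carrier A"
  obtains h where "h \<in> carrier H" "inv\<^bsub>A\<^esub> g' \<otimes>\<^bsub>A\<^esub> g = \<iota> h" "\<And>x. ev1 g' g x = ac h x"
  | "inv\<^bsub>A\<^esub> g' \<otimes>\<^bsub>A\<^esub> g \<notin> \<iota> ` carrier H" "\<And>x. ev1 g' g x = \<zero>\<^bsub>M\<^esub>"
proof (cases "inv\<^bsub>A\<^esub> g' \<otimes>\<^bsub>A\<^esub> g \<in> \<iota> ` carrier H")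
  case True
  then obtain h where "h \<in> carrier H" "inv\<^bsub>A\<^esub> g' \<otimes>\<^bsub>A\<^esub> g = \<iota> h" by auto
  then show thesis using that(1) ev1_eq'[OF assms] by blast
qed (use that(2) ev1_out in blast)

lemma ev1_closed: "\<lbrakk>g \<in> carrier A; g' \<in> carrier A; x \<in> carrier M\<rbrakk> \<Longrightarrow> ev1 g' g x \<in> carrier M"
  by (rule ev1_cases[of g g']) (auto simp: ac_closed)

lemma ev1_self: "\<lbrakk>g \<in> carrier A; x \<in> carrier M\<rbrakk> \<Longrightarrow> ev1 g g x = x"
  by (simp add: ev1_eq'[of g g "\<one>\<^bsub>H\<^esub>"] emb_one ac_one)

definition ev :: "'a \<Rightarrow> ('a \<times> 'x) list \<Rightarrow> 'x" where
  "ev g' l = foldr (\<lambda>(g, x) s. ev1 g' g x \<oplus>\<^bsub>M\<^esub> s) l \<zero>\<^bsub>M\<^esub>"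

lemma ev_Nil [simp]: "ev g' [] = \<zero>\<^bsub>M\<^esub>"
  and ev_Cons [simp]: "ev g' ((g, x) # l) = ev1 g' g x \<oplus>\<^bsub>M\<^esub> ev g' l"
  by (simp_all add: ev_def)

lemma ev_closed: "l \<in> chains \<Longrightarrow> g' \<in> carrier A \<Longrightarrow> ev g' l \<in> carrier M"
  by (induction l) (auto simp: ev1_closed)

lemma ev_append: "\<lbrakk>l \<in> chains; k \<in> chains; g' \<in> carrier A\<rbrakk> \<Longrightarrow> ev g' (l @ k) = ev g' l \<oplus>\<^bsub>M\<^esub> ev g' k"
  by (induction l) (auto simp: ev1_closed ev_closed M.a_assoc)

text \<open>The only relation that moves positions is \<open>act\<close>, and g \<iota>(h) lies in
  the coset of \<open>g'\<close> exactly when \<open>g\<close> does. Inside that coset the two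
  coordinates agree because \<open>ac\<close> is an action.\<close>

lemma teq_sound:
  assumes "l \<bowtie> k" and g': "g' \<in> carrier A"
  shows "ev g' l = ev g' k"
  using assms(1)
proof induction
  case (append l l' k k')
  then show ?case using g' teq_chains by (simp add: ev_append)
next
  case (comm l k)
  then show ?case using g' by (simp add: ev_append ev_closed M.a_comm)
next
  case (zero g)
  show ?case by (rule ev1_cases[OF zero(1) g']) (simp_all add: ac_zero)
next
  case (add g x y)
  show ?case by (rule ev1_cases[OF add(1) g']) (use add in \<open>simp_all add: ac_add ac_closed\<close>)
next
  case (act g h x)
  show ?case
  proof (cases rule: ev1_cases[OF act(1) g'])
    case (1 h')
    have "inv\<^bsub>A\<^esub> g' \<otimes>\<^bsub>A\<^esub> (g \<otimes>\<^bsub>A\<^esub> \<iota> h) = \<iota> (h' \<otimes>\<^bsub>H\<^esub> h)"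
      using act 1 g' by (simp add: emb_mult A.m_assoc[symmetric] emb_closed)
    then have "ev1 g' (g \<otimes>\<^bsub>A\<^esub> \<iota> h) x = ac (h' \<otimes>\<^bsub>H\<^esub> h) x"
      using act 1 g' by (intro ev1_eq') (auto simp: emb_closed)
    then show ?thesis using act 1 by (simp add: ac_mult)
  next
    case 2
    have "inv\<^bsub>A\<^esub> g' \<otimes>\<^bsub>A\<^esub> (g \<otimes>\<^bsub>A\<^esub> \<iota> h) \<notin> \<iota> ` carrier H"
    proof
      assume "inv\<^bsub>A\<^esub> g' \<otimes>\<^bsub>A\<^esub> (g \<otimes>\<^bsub>A\<^esub> \<iota> h) \<in> \<iota> ` carrier H"
      then obtain k where k: "k \<in> carrier H" "inv\<^bsub>A\<^esub> g' \<otimes>\<^bsub>A\<^esub> (g \<otimes>\<^bsub>A\<^esub> \<iota> h) = \<iota> k" by auto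
      then have "inv\<^bsub>A\<^esub> g' \<otimes>\<^bsub>A\<^esub> g = \<iota> k \<otimes>\<^bsub>A\<^esub> inv\<^bsub>A\<^esub> (\<iota> h)"
        using act g' by (metis A.inv_closed A.inv_solve_right A.m_assoc A.m_closed emb_closed)
      then have "inv\<^bsub>A\<^esub> g' \<otimes>\<^bsub>A\<^esub> g = \<iota> (k \<otimes>\<^bsub>H\<^esub> inv\<^bsub>H\<^esub> h)"
        using act k by (simp add: emb_mult emb_inv)
      then show False using 2 act k by blast
    qed
    then show ?thesis using 2 by (simp add: ev1_out)
  qed
qed simp_all

text \<open>Pairwise distinct left cosets of the image of \<open>H\<close>. Both orders are recorded
  because \<open>sorted_wrt\<close> looks at each pair only once.\<close>

definition separated :: "'a list \<Rightarrow> bool" where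
  "separated = sorted_wrt (\<lambda>g g'. inv\<^bsub>A\<^esub> g' \<otimes>\<^bsub>A\<^esub> g \<notin> \<iota> ` carrier H \<and> inv\<^bsub>A\<^esub> g \<otimes>\<^bsub>A\<^esub> g' \<notin> \<iota> ` carrier H)"

text \<open>All other entries lie in different cosets and contribute zero at
  \<open>g\<close>.\<close>

lemma separated_ev:
  "\<lbrakk>separated (map fst l); l \<in> chains; (g, x) \<in> set l\<rbrakk> \<Longrightarrow> ev g l = x"
proof (induction l)
  case (Cons a l)
  obtain g0 x0 where a: "a = (g0, x0)" by (cases a)
  have sep: "separated (map fst l)" and l: "l \<in> chains" "g0 \<in> carrier A" "x0 \<in> carrier M"
    using Cons.prems a by (auto simp: separated_def)
  have out: "inv\<^bsub>A\<^esub> g1 \<otimes>\<^bsub>A\<^esub> g0 \<notin> \<iota> ` carrier H" "inv\<^bsub>A\<^esub> g0 \<otimes>\<^bsub>A\<^esub> g1 \<notin> \<iota> ` carrier H"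
    if "(g1, x1) \<in> set l" for g1 x1
    using that Cons.prems(1) a by (force simp: separated_def)+
  show ?case
  proof (cases "(g, x) \<in> set l")
    case True
    have gx: "g \<in> carrier A" "x \<in> carrier M" using True l by (auto simp: chains_def)
    show ?thesis using a Cons.IH[OF sep l(1) True] out(1)[OF True] gx by (simp add: ev1_out)
  next
    case False
    then have [simp]: "g = g0" "x = x0" using Cons.prems(3) a by auto
    have "ev g0 l = \<zero>\<^bsub>M\<^esub>" using out(2) l(1)
    proof (induction l)
      case (Cons c l)
      obtain g1 x1 where c: "c = (g1, x1)" by (cases c)
      have "ev1 g0 g1 x1 = \<zero>\<^bsub>M\<^esub>" using Cons.prems(1)[of g1 x1] c by (simp add: ev1_out)
      moreover have "ev g0 l = \<zero>\<^bsub>M\<^esub>" using Cons by (auto simp: c)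
      ultimately show ?case using c by simp
    qed simp
    then show ?thesis using l a by (simp add: ev1_self)
  qed
qed simp

text \<open>This is freeness of the group ring of \<open>A\<close> over that of \<open>H\<close>:
  entries in a common coset are moved to one representative by \<open>act\<close> and added
  up.\<close>

lemma normal_form:
  "l \<in> chains \<Longrightarrow> \<exists>l'. l \<bowtie> l' \<and> separated (map fst l')"
proof (induction l)
  case Nil
  show ?case by (intro exI[of _ "[]"]) (simp add: refl separated_def)
next
  case (Cons a l)
  obtain g x where a: "a = (g, x)" by (cases a)
  with Cons.prems have gx: "g \<in> carrier A" "x \<in> carrier M" "l \<in> chains" by auto
  from Cons.IH[OF gx(3)] obtain l' where l': "l \<bowtie> l'" "separated (map fst l')" by blast
  have ch: "l' \<in> chains" using l' teq_chains by blast
  have al: "a # l \<bowtie> a # l'" using teq_Cons l' gx a by blast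
  show ?case
  proof (cases "\<exists>(g1, x1)\<in>set l'. inv\<^bsub>A\<^esub> g1 \<otimes>\<^bsub>A\<^esub> g \<in> \<iota> ` carrier H")
    case True
    then obtain g1 x1 h where g1: "(g1, x1) \<in> set l'" "h \<in> carrier H" "inv\<^bsub>A\<^esub> g1 \<otimes>\<^bsub>A\<^esub> g = \<iota> h" by auto
    then obtain k1 k2 where k: "l' = k1 @ (g1, x1) # k2" by (meson split_list)
    have c: "g1 \<in> carrier A" "x1 \<in> carrier M" "k1 \<in> chains" "k2 \<in> chains" using ch k by auto
    have g: "g = g1 \<otimes>\<^bsub>A\<^esub> \<iota> h" using g1 gx c by (metis A.inv_solve_left' emb_closed A.inv_closed)
    have "a # l' \<bowtie> k1 @ [(g, x), (g1, x1)] @ k2"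
      by (rule teq_mset) (use a k gx c in auto)
    also have "\<dots> \<bowtie> k1 @ [(g1, ac h x), (g1, x1)] @ k2"
      using append[OF act[OF c(1) g1(2) gx(2)] refl[of "[(g1, x1)]"]] c g
      by (intro append refl) auto
    also have "\<dots> \<bowtie> k1 @ [(g1, ac h x \<oplus>\<^bsub>M\<^esub> x1)] @ k2"
      by (intro append refl sym[OF add]) (use c g1 gx in \<open>auto simp: ac_closed\<close>)
    finally have "a # l' \<bowtie> k1 @ [(g1, ac h x \<oplus>\<^bsub>M\<^esub> x1)] @ k2" .
    then have "a # l \<bowtie> k1 @ [(g1, ac h x \<oplus>\<^bsub>M\<^esub> x1)] @ k2" by (rule trans[OF al])
    then show ?thesis using l'(2) k by (intro exI conjI) auto
  next
    case False
    have "inv\<^bsub>A\<^esub> g \<otimes>\<^bsub>A\<^esub> g1 \<notin> \<iota> ` carrier H" if "(g1, x1) \<in> set l'" for g1 x1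
    proof
      assume "inv\<^bsub>A\<^esub> g \<otimes>\<^bsub>A\<^esub> g1 \<in> \<iota> ` carrier H"
      then obtain h where h: "h \<in> carrier H" "inv\<^bsub>A\<^esub> g \<otimes>\<^bsub>A\<^esub> g1 = \<iota> h" by auto
      have g1: "g1 \<in> carrier A" using that ch by (auto simp: chains_def)
      have "inv\<^bsub>A\<^esub> g1 \<otimes>\<^bsub>A\<^esub> g = inv\<^bsub>A\<^esub> (inv\<^bsub>A\<^esub> g \<otimes>\<^bsub>A\<^esub> g1)" using gx g1 by (simp add: A.inv_mult_group)
      also have "\<dots> = \<iota> (inv\<^bsub>H\<^esub> h)" using h by (simp add: emb_inv)
      finally have "inv\<^bsub>A\<^esub> g1 \<otimes>\<^bsub>A\<^esub> g \<in> \<iota> ` carrier H" using h by simp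
      then show False using that False by auto
    qed
    then have "separated (map fst (a # l'))" using False l'(2) a by (fastforce simp: separated_def)
    then show ?thesis using al by blast
  qed
qed

lemma teq_zeros: "\<forall>(g, x)\<in>set l. g \<in> carrier A \<and> x = \<zero>\<^bsub>M\<^esub> \<Longrightarrow> l \<bowtie> []"
proof (induction l)
  case (Cons a l)
  then show ?case using append[OF zero[of "fst a"], of l "[]"] by (cases a) auto
qed (simp add: refl)

text \<open>In normal form the entries are values of \<open>ev\<close>; if all of these vanish, the
  normal form is a list of zeros.\<close>

lemma ev_zero_imp_teq:
  assumes "l \<in> chains" "\<And>g. g \<in> carrier A \<Longrightarrow> ev g l = \<zero>\<^bsub>M\<^esub>"
  shows "l \<bowtie> []"
proof -
  obtain l' where l': "l \<bowtie> l'" "separated (map fst l')" using normal_form assms(1) by blast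
  have ch: "l' \<in> chains" using l' teq_chains by blast
  have "g \<in> carrier A \<and> x = \<zero>\<^bsub>M\<^esub>" if "(g, x) \<in> set l'" for g x
  proof -
    have g: "g \<in> carrier A" using that ch by (auto simp: chains_def)
    then show ?thesis using separated_ev[OF l'(2) ch that] teq_sound[OF l'(1) g] assms(2)[OF g] by simp
  qed
  then have "l' \<bowtie> []" by (intro teq_zeros) auto
  then show ?thesis using l'(1) trans by blast
qed

definition neg :: "('a \<times> 'x) list \<Rightarrow> ('a \<times> 'x) list" where
  "neg = map (\<lambda>(g, x). (g, \<ominus>\<^bsub>M\<^esub> x))"

lemma neg_chains: "l \<in> chains \<Longrightarrow> neg l \<in> chains"
  by (auto simp: neg_def chains_def)

text \<open>No rule mentions negatives; the cancellation is \<open>add\<close> read backwards,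
  followed by \<open>zero\<close>.\<close>

lemma teq_neg_pair: "\<lbrakk>g \<in> carrier A; x \<in> carrier M\<rbrakk> \<Longrightarrow> [(g, x), (g, \<ominus>\<^bsub>M\<^esub> x)] \<bowtie> []"
  by (rule trans[OF sym[OF add]]) (auto simp: M.r_neg zero)

lemma teq_neg: "l \<in> chains \<Longrightarrow> l @ neg l \<bowtie> []"
proof (induction l)
  case (Cons a l)
  obtain g x where a: "a = (g, x)" by (cases a)
  with Cons.prems have gx: "g \<in> carrier A" "x \<in> carrier M" "l \<in> chains" by auto
  have "(a # l) @ neg (a # l) \<bowtie> [(g, x), (g, \<ominus>\<^bsub>M\<^esub> x)] @ (l @ neg l)"
    by (rule teq_mset) (use gx a in \<open>auto simp: neg_def chains_def\<close>)
  also have "\<dots> \<bowtie> [] @ []"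
    by (intro append teq_neg_pair gx Cons.IH)
  finally show ?case by simp
qed (simp add: refl neg_def)

lemma teq_diff:
  assumes "l \<in> chains" "k \<in> chains"
  shows "l \<bowtie> k \<longleftrightarrow> l @ neg k \<bowtie> []"
proof
  assume "l \<bowtie> k"
  then have "l @ neg k \<bowtie> k @ neg k" by (intro append refl neg_chains assms)
  also have "\<dots> \<bowtie> []" by (intro teq_neg assms)
  finally show "l @ neg k \<bowtie> []" .
next
  assume d: "l @ neg k \<bowtie> []"
  have "l \<bowtie> l @ (k @ neg k)"
    using append[OF refl[OF assms(1)] sym[OF teq_neg[OF assms(2)]]] by simp
  also have "\<dots> \<bowtie> k @ (l @ neg k)" by (rule teq_mset) (use assms neg_chains in auto)
  also have "\<dots> \<bowtie> k @ []" by (intro append refl assms d)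
  finally show "l \<bowtie> k" by simp
qed

lemma ev_neg:
  assumes "l \<in> chains" "g \<in> carrier A"
  shows "ev g (neg l) = \<ominus>\<^bsub>M\<^esub> ev g l"
proof -
  have "ev g l \<oplus>\<^bsub>M\<^esub> ev g (neg l) = \<zero>\<^bsub>M\<^esub>"
    using teq_sound[OF teq_neg[OF assms(1)] assms(2)] assms neg_chains by (simp add: ev_append)
  then show ?thesis using assms neg_chains ev_closed
    by (metis M.add.inv_equality M.a_comm)
qed

text \<open>Completeness of the invariant. It lets another presentation of the same module be
  compared with this one by checking that the values of \<open>ev\<close> agree.\<close>

theorem teq_iff_ev:
  assumes "l \<in> chains" "k \<in> chains"
  shows "l \<bowtie> k \<longleftrightarrow> (\<forall>g\<in>carrier A. ev g l = ev g k)"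
proof
  assume "\<forall>g\<in>carrier A. ev g l = ev g k"
  then have "l @ neg k \<bowtie> []"
    using assms by (intro ev_zero_imp_teq) (auto simp: ev_append ev_neg ev_closed neg_chains M.r_neg)
  then show "l \<bowtie> k" using teq_diff assms by blast
qed (use teq_sound in blast)

lemma teq_append_cancel:
  assumes "l @ k \<bowtie> []" "k \<bowtie> []"
  shows "l \<bowtie> []"
proof -
  have c: "l \<in> chains" "k \<in> chains" using teq_chains[OF assms(1)] teq_chains[OF assms(2)] by auto
  have "l \<bowtie> l @ k" using append[OF refl[OF c(1)] sym[OF assms(2)]] by simp
  then show ?thesis using assms(1) trans by blast
qed

lemma teq_concat:
  "(\<And>i. i \<in> set is \<Longrightarrow> f i \<bowtie> f' i) \<Longrightarrow> concat (map f is) \<bowtie> concat (map f' is)"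
  by (induction "is") (simp_all add: refl append)

end

section \<open>Maps between induced modules\<close>

definition multi_map :: "'i list \<Rightarrow> ('i \<Rightarrow> 'a \<Rightarrow> 'c) \<Rightarrow> ('i \<Rightarrow> 'x \<Rightarrow> 'y) \<Rightarrow> ('a \<times> 'x) list \<Rightarrow> ('c \<times> 'y) list" where
  "multi_map is \<theta> f l = concat (map (\<lambda>(g, x). map (\<lambda>i. (\<theta> i g, f i x)) is) l)"

lemma multi_map_append: "multi_map is \<theta> f (l @ k) = multi_map is \<theta> f l @ multi_map is \<theta> f k"
  and multi_map_Nil [simp]: "multi_map is \<theta> f [] = []"
  by (simp_all add: multi_map_def)

text \<open>One notion serves the differential (one index per face), the maps induced by module
  homomorphisms and the comparison \<open>Phi\<close> (a single index each).
  \<open>\<kappa> i\<close> says how \<open>H\<close> is carried into \<open>H'\<close>;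
  \<open>\<theta>_emb\<close> and \<open>f_ac\<close> together turn an instance of
  \<open>act\<close> in the source into one in the target.\<close>

locale ind_map = X: ind_mod A H M \<iota> ac + Y: ind_mod A' H' M' \<iota>' ac'
  for A :: "'a monoid" and H :: "'h monoid" and M :: "('x, 'm) ring_scheme" and \<iota> ac
    and A' :: "'c monoid" and H' :: "'k monoid" and M' :: "('y, 'n) ring_scheme" and \<iota>' ac' +
  fixes "is" :: "'i list" and \<theta> :: "'i \<Rightarrow> 'a \<Rightarrow> 'c" and \<kappa> :: "'i \<Rightarrow> 'h \<Rightarrow> 'k" and f :: "'i \<Rightarrow> 'x \<Rightarrow> 'y"
  assumes \<theta>_closed: "\<lbrakk>i \<in> set is; g \<in> carrier A\<rbrakk> \<Longrightarrow> \<theta> i g \<in> carrier A'"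
    and \<kappa>_closed: "\<lbrakk>i \<in> set is; h \<in> carrier H\<rbrakk> \<Longrightarrow> \<kappa> i h \<in> carrier H'"
    and \<theta>_emb: "\<lbrakk>i \<in> set is; g \<in> carrier A; h \<in> carrier H\<rbrakk> \<Longrightarrow> \<theta> i (g \<otimes>\<^bsub>A\<^esub> \<iota> h) = \<theta> i g \<otimes>\<^bsub>A'\<^esub> \<iota>' (\<kappa> i h)"
    and f_closed: "\<lbrakk>i \<in> set is; x \<in> carrier M\<rbrakk> \<Longrightarrow> f i x \<in> carrier M'"
    and f_add: "\<lbrakk>i \<in> set is; x \<in> carrier M; y \<in> carrier M\<rbrakk> \<Longrightarrow> f i (x \<oplus>\<^bsub>M\<^esub> y) = f i x \<oplus>\<^bsub>M'\<^esub> f i y"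
    and f_ac: "\<lbrakk>i \<in> set is; x \<in> carrier M; h \<in> carrier H\<rbrakk> \<Longrightarrow> f i (ac h x) = ac' (\<kappa> i h) (f i x)"
begin

lemma f_zero: "i \<in> set is \<Longrightarrow> f i \<zero>\<^bsub>M\<^esub> = \<zero>\<^bsub>M'\<^esub>"
  by (metis X.M.l_zero X.M.zero_closed Y.M.add.r_cancel_one' f_add f_closed)

lemma multi_map_chains: "l \<in> X.chains \<Longrightarrow> multi_map is \<theta> f l \<in> Y.chains"
  by (fastforce simp: multi_map_def X.chains_def Y.chains_def \<theta>_closed f_closed)

lemma multi_map_teq: "X.teq l k \<Longrightarrow> Y.teq (multi_map is \<theta> f l) (multi_map is \<theta> f k)"
proof (induction rule: X.teq.induct)
  case (zero g)
  then show ?case by (auto simp: multi_map_def f_zero \<theta>_closed intro!: Y.teq_zeros)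
next
  case (add g x y)
  have "Y.teq (map (\<lambda>i. (\<theta> i g, f i (x \<oplus>\<^bsub>M\<^esub> y))) js)
      (map (\<lambda>i. (\<theta> i g, f i x)) js @ map (\<lambda>i. (\<theta> i g, f i y)) js)" if "set js \<subseteq> set is" for js
    using that
  proof (induction js)
    case (Cons j js)
    let ?l = "\<lambda>z. map (\<lambda>i. (\<theta> i g, f i z)) js"
    have j: "j \<in> set is" using Cons by auto
    have ch: "?l x \<in> Y.chains" "?l y \<in> Y.chains"
      using Cons.prems add by (auto simp: Y.chains_def \<theta>_closed f_closed subset_iff)
    have "Y.teq ([(\<theta> j g, f j (x \<oplus>\<^bsub>M\<^esub> y))] @ ?l (x \<oplus>\<^bsub>M\<^esub> y)) ([(\<theta> j g, f j x), (\<theta> j g, f j y)] @ (?l x @ ?l y))"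
      using Cons add j by (intro Y.append) (auto simp: f_add \<theta>_closed f_closed intro!: Y.add)
    \<comment> \<open>Splitting the sums index by index interleaves the entries for \<open>x\<close>
      with those for \<open>y\<close>; here they are sorted apart again.\<close>
    also have "Y.teq \<dots> (([(\<theta> j g, f j x)] @ ?l x) @ [(\<theta> j g, f j y)] @ ?l y)"
      by (rule Y.teq_mset) (use j add ch in \<open>auto simp: \<theta>_closed f_closed\<close>)
    finally show ?case by simp
  qed (simp add: Y.refl)
  from this[of "is"] show ?case by (simp add: multi_map_def)
next
  case (act g h x)
  have "Y.teq (map (\<lambda>i. (\<theta> i (g \<otimes>\<^bsub>A\<^esub> \<iota> h), f i x)) js) (map (\<lambda>i. (\<theta> i g, f i (ac h x))) js)"
    if "set js \<subseteq> set is" for js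
    using that
  proof (induction js)
    case (Cons j js)
    then have j: "j \<in> set is" by auto
    have "Y.teq [(\<theta> j (g \<otimes>\<^bsub>A\<^esub> \<iota> h), f j x)] [(\<theta> j g, f j (ac h x))]"
      using act j by (auto simp: \<theta>_emb f_ac \<theta>_closed \<kappa>_closed f_closed intro!: Y.act)
    from Y.append[OF this Cons.IH] Cons.prems show ?case by simp
  qed (simp add: Y.refl)
  from this[of "is"] show ?case by (simp add: multi_map_def)
next
  case (sym l k)
  show ?case by (rule Y.sym) fact
next
  case (trans l k j)
  show ?case by (rule Y.trans) fact+
qed (simp_all add: multi_map_append Y.refl Y.append Y.comm multi_map_chains)

end

section \<open>Braided stability groupoids and their modules\<close>

locale braided_stab =
  fixes G :: "nat \<Rightarrow> 'g monoid" and os :: "nat \<Rightarrow> nat \<Rightarrow> 'g \<Rightarrow> 'g \<Rightarrow> 'g" and b :: "nat \<Rightarrow> nat \<Rightarrow> 'g"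
  assumes stab: "stability_groupoid G os" and braid: "braiding G os b"
begin

abbreviation e :: "nat \<Rightarrow> 'g" where "e n \<equiv> \<one>\<^bsub>G n\<^esub>"

lemma grp [simp]: "group (G n)"
  using stab by (simp add: stability_groupoid_def)

lemma mon [simp]: "monoid (G n)"
  by (simp add: group.is_monoid)

lemmas grp_simps = monoid.m_closed[OF mon] monoid.l_one[OF mon] monoid.r_one[OF mon] monoid.one_closed[OF mon]
  group.inv_closed[OF grp] group.l_inv[OF grp] group.r_inv[OF grp] monoid.inv_one[OF mon]
declare grp_simps [simp]
lemmas m_assoc = monoid.m_assoc[OF mon]

lemma inv_mult [simp]:
  "\<lbrakk>x \<in> carrier (G n); y \<in> carrier (G n)\<rbrakk> \<Longrightarrow> inv\<^bsub>G n\<^esub> x \<otimes>\<^bsub>G n\<^esub> (x \<otimes>\<^bsub>G n\<^esub> y) = y"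
  "\<lbrakk>x \<in> carrier (G n); y \<in> carrier (G n)\<rbrakk> \<Longrightarrow> x \<otimes>\<^bsub>G n\<^esub> (inv\<^bsub>G n\<^esub> x \<otimes>\<^bsub>G n\<^esub> y) = y"
  by (simp_all add: m_assoc[symmetric])

lemma os_closed [simp]:
  "\<lbrakk>f \<in> carrier (G m); g \<in> carrier (G n); N = m + n\<rbrakk> \<Longrightarrow> os m n f g \<in> carrier (G N)"
  using stab by (simp add: stability_groupoid_def)

lemma os_mult:
  "\<lbrakk>f \<in> carrier (G m); g \<in> carrier (G n); f' \<in> carrier (G m); g' \<in> carrier (G n); N = m + n\<rbrakk>
    \<Longrightarrow> os m n f g \<otimes>\<^bsub>G N\<^esub> os m n f' g' = os m n (f \<otimes>\<^bsub>G m\<^esub> f') (g \<otimes>\<^bsub>G n\<^esub> g')"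
  using stab by (simp add: stability_groupoid_def)

lemma os_one [simp]: "os m n (e m) (e n) = e (m + n)"
  using stab by (simp add: stability_groupoid_def)

lemma os_assoc:
  "\<lbrakk>f \<in> carrier (G l); g \<in> carrier (G m); h \<in> carrier (G n); p = l + m\<rbrakk>
    \<Longrightarrow> os p n (os l m f g) h = os l (m + n) f (os m n g h)"
  using stab by (simp add: stability_groupoid_def)

lemma os_unit [simp]:
  "g \<in> carrier (G n) \<Longrightarrow> os 0 n (e 0) g = g"
  "g \<in> carrier (G n) \<Longrightarrow> os n 0 g (e 0) = g"
  using stab by (simp_all add: stability_groupoid_def)

lemma os_inj:
  "\<lbrakk>f \<in> carrier (G m); g \<in> carrier (G n); f' \<in> carrier (G m); g' \<in> carrier (G n); os m n f g = os m n f' g'\<rbrakk>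
    \<Longrightarrow> f = f' \<and> g = g'"
  using stab[unfolded stability_groupoid_def] by (elim conjE) metis

lemma G0: "x \<in> carrier (G 0) \<longleftrightarrow> x = e 0"
proof -
  have "carrier (G 0) = {e 0}"
    using stab unfolding stability_groupoid_def by (elim conjE) assumption
  then show ?thesis by simp
qed

lemma os_inv:
  assumes "f \<in> carrier (G m)" "g \<in> carrier (G n)" "N = m + n"
  shows "inv\<^bsub>G N\<^esub> (os m n f g) = os m n (inv\<^bsub>G m\<^esub> f) (inv\<^bsub>G n\<^esub> g)"
  by (rule group.inv_equality[OF grp]) (use assms in \<open>simp_all add: os_mult\<close>)

lemma b_closed [simp]: "N = m + n \<Longrightarrow> b m n \<in> carrier (G N)"
  using braid by (simp add: braiding_def)

lemma b_nat:
  "\<lbrakk>f \<in> carrier (G m); g \<in> carrier (G n); N = m + n\<rbrakk>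
    \<Longrightarrow> os n m g f \<otimes>\<^bsub>G N\<^esub> b m n = b m n \<otimes>\<^bsub>G N\<^esub> os m n f g"
  using braid by (simp add: braiding_def)

lemma b_add_right:
  "b l (m + n) = os m (l + n) (e m) (b l n) \<otimes>\<^bsub>G (l + m + n)\<^esub> os (l + m) n (b l m) (e n)"
  using braid unfolding braiding_def by metis

lemma b_add_left:
  "b (l + m) n = os (l + n) m (b l n) (e m) \<otimes>\<^bsub>G (l + m + n)\<^esub> os l (m + n) (e l) (b m n)"
  using braid unfolding braiding_def by metis

text \<open>The hexagon with m = n = 0 makes the element idempotent, and an idempotent of a group is
  the identity.\<close>

lemma b_zero_right: "b n 0 = e n"
proof -
  have "b n 0 = b n 0 \<otimes>\<^bsub>G n\<^esub> b n 0"
    using b_add_right[of n 0 0] by simp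
  then show ?thesis
    by (metis add.right_neutral b_closed group.l_cancel_one grp)
qed

lemma inv_b_nat:
  assumes "f \<in> carrier (G m)" "g \<in> carrier (G n)" "N = m + n"
  shows "inv\<^bsub>G N\<^esub> (b m n) \<otimes>\<^bsub>G N\<^esub> os n m g f = os m n f g \<otimes>\<^bsub>G N\<^esub> inv\<^bsub>G N\<^esub> (b m n)"
proof -
  have "inv\<^bsub>G N\<^esub> (b m n) \<otimes>\<^bsub>G N\<^esub> os n m g f = inv\<^bsub>G N\<^esub> (b m n) \<otimes>\<^bsub>G N\<^esub> (os n m g f \<otimes>\<^bsub>G N\<^esub> b m n) \<otimes>\<^bsub>G N\<^esub> inv\<^bsub>G N\<^esub> (b m n)"
    using assms by (simp add: m_assoc)
  also have "\<dots> = os m n f g \<otimes>\<^bsub>G N\<^esub> inv\<^bsub>G N\<^esub> (b m n)"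
    using assms by (simp add: b_nat)
  finally show ?thesis .
qed

section \<open>Morphisms of the stability category as cosets\<close>

definition cos :: "nat \<Rightarrow> nat \<Rightarrow> 'g \<Rightarrow> 'g set" where
  "cos s t f = f <#\<^bsub>G t\<^esub> stabsub G os (t - s) s"

lemma stabsub_subgroup: "s \<le> t \<Longrightarrow> subgroup (stabsub G os (t - s) s) (G t)"
  unfolding stabsub_def
proof (rule group.subgroupI[OF grp])
  assume st: "s \<le> t"
  show "(\<lambda>g. os (t - s) s g (e s)) ` carrier (G (t - s)) \<subseteq> carrier (G t)" using st by auto
  show "(\<lambda>g. os (t - s) s g (e s)) ` carrier (G (t - s)) \<noteq> {}"
    using monoid.one_closed[OF mon] by blast
  fix x assume "x \<in> (\<lambda>g. os (t - s) s g (e s)) ` carrier (G (t - s))"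
  then obtain f where f: "f \<in> carrier (G (t - s))" "x = os (t - s) s f (e s)" by auto
  have "inv\<^bsub>G t\<^esub> x = os (t - s) s (inv\<^bsub>G (t - s)\<^esub> f) (e s)" using f st by (simp add: os_inv)
  then show "inv\<^bsub>G t\<^esub> x \<in> (\<lambda>g. os (t - s) s g (e s)) ` carrier (G (t - s))" using f by auto
  fix y assume "y \<in> (\<lambda>g. os (t - s) s g (e s)) ` carrier (G (t - s))"
  then obtain g where g: "g \<in> carrier (G (t - s))" "y = os (t - s) s g (e s)" by auto
  have "x \<otimes>\<^bsub>G t\<^esub> y = os (t - s) s (f \<otimes>\<^bsub>G (t - s)\<^esub> g) (e s)" using f g st by (simp add: os_mult)
  then show "x \<otimes>\<^bsub>G t\<^esub> y \<in> (\<lambda>g. os (t - s) s g (e s)) ` carrier (G (t - s))" using f g by auto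
qed

lemma mem_cos: "x \<in> cos s t f \<longleftrightarrow> (\<exists>h\<in>carrier (G (t - s)). x = f \<otimes>\<^bsub>G t\<^esub> os (t - s) s h (e s))"
  by (auto simp: cos_def l_coset_def stabsub_def)

lemma cos_self: "\<lbrakk>s \<le> t; f \<in> carrier (G t)\<rbrakk> \<Longrightarrow> f \<in> cos s t f"
  by (auto simp: mem_cos intro!: bexI[of _ "e (t - s)"])

lemma cos_absorb:
  "\<lbrakk>s \<le> t; f \<in> carrier (G t); h \<in> carrier (G (t - s))\<rbrakk> \<Longrightarrow> cos s t (f \<otimes>\<^bsub>G t\<^esub> os (t - s) s h (e s)) = cos s t f"
  using group.l_repr_independence[OF grp _ _ stabsub_subgroup, of "f \<otimes>\<^bsub>G t\<^esub> os (t - s) s h (e s)" t f s]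
  by (simp add: mem_cos[symmetric] cos_def[symmetric]) (auto simp: mem_cos)

lemma cos_eqD:
  assumes "s \<le> t" "f \<in> carrier (G t)" "cos s t f = cos s t f'"
  obtains h where "h \<in> carrier (G (t - s))" "f = f' \<otimes>\<^bsub>G t\<^esub> os (t - s) s h (e s)"
  using cos_self[OF assms(1,2)] assms(3) by (auto simp: mem_cos)

lemma crep_cos:
  assumes "s \<le> t" "f \<in> carrier (G t)"
  obtains h where "h \<in> carrier (G (t - s))" "crep (cos s t f) = f \<otimes>\<^bsub>G t\<^esub> os (t - s) s h (e s)"
proof -
  have "crep (cos s t f) \<in> cos s t f" unfolding crep_def using cos_self[OF assms] by (rule someI)
  then show thesis using that by (auto simp: mem_cos)
qed

lemma UHom_iff: "\<phi> \<in> UHom G os s t \<longleftrightarrow> s \<le> t \<and> (\<exists>f\<in>carrier (G t). \<phi> = cos s t f)"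
  by (auto simp: UHom_def cos_def)

lemma cos_UHom [simp]: "\<lbrakk>s \<le> t; f \<in> carrier (G t)\<rbrakk> \<Longrightarrow> cos s t f \<in> UHom G os s t"
  by (auto simp: UHom_iff)

lemma UHomE:
  assumes "\<phi> \<in> UHom G os s t"
  obtains f where "s \<le> t" "f \<in> carrier (G t)" "\<phi> = cos s t f"
  using assms UHom_iff by auto

text \<open>\<open>ucomp\<close> uses arbitrary representatives from \<open>crep\<close>. They
  differ from \<open>g\<close> and \<open>f\<close> by elements of G_(u-t) and G_(t-s); the first
  acts on the initial block and commutes past \<open>f\<close>, so both combine to an element of
  G_(u-s) at the right end, which the coset absorbs.\<close>

lemma ucomp_cos:
  assumes st: "s \<le> t" "t \<le> u" and g: "g \<in> carrier (G u)" and f: "f \<in> carrier (G t)"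
  shows "ucomp G os s t u (cos t u g) (cos s t f) = cos s u (g \<otimes>\<^bsub>G u\<^esub> os (u - t) t (e (u - t)) f)"
proof -
  obtain k where k: "k \<in> carrier (G (u - t))" "crep (cos t u g) = g \<otimes>\<^bsub>G u\<^esub> os (u - t) t k (e t)"
    using crep_cos st g by blast
  obtain h where h: "h \<in> carrier (G (t - s))" "crep (cos s t f) = f \<otimes>\<^bsub>G t\<^esub> os (t - s) s h (e s)"
    using crep_cos st f by blast
  have kh: "os (u - t) t k (os (t - s) s h (e s)) = os (u - s) s (os (u - t) (t - s) k h) (e s)"
    using os_assoc[OF k(1) h(1), of "e s" s "u - s"] st by simp
  have "crep (cos t u g) \<otimes>\<^bsub>G u\<^esub> os (u - t) t (e (u - t)) (crep (cos s t f))
      = g \<otimes>\<^bsub>G u\<^esub> (os (u - t) t k (e t) \<otimes>\<^bsub>G u\<^esub> os (u - t) t (e (u - t)) (f \<otimes>\<^bsub>G t\<^esub> os (t - s) s h (e s)))"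
    using k h st g f by (simp add: m_assoc)
  also have "os (u - t) t k (e t) \<otimes>\<^bsub>G u\<^esub> os (u - t) t (e (u - t)) (f \<otimes>\<^bsub>G t\<^esub> os (t - s) s h (e s))
      = os (u - t) t (e (u - t)) f \<otimes>\<^bsub>G u\<^esub> os (u - t) t k (os (t - s) s h (e s))"
    using k h st f by (simp add: os_mult)
  finally have "crep (cos t u g) \<otimes>\<^bsub>G u\<^esub> os (u - t) t (e (u - t)) (crep (cos s t f))
      = g \<otimes>\<^bsub>G u\<^esub> os (u - t) t (e (u - t)) f \<otimes>\<^bsub>G u\<^esub> os (u - s) s (os (u - t) (t - s) k h) (e s)"
    using k h st g f by (simp add: m_assoc kh)
  then show ?thesis unfolding ucomp_def cos_def[symmetric]
    using k h st g f by (simp add: cos_absorb)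
qed

lemma ucomp_UHom: "\<lbrakk>\<phi> \<in> UHom G os s t; \<psi> \<in> UHom G os t u\<rbrakk> \<Longrightarrow> ucomp G os s t u \<psi> \<phi> \<in> UHom G os s u"
  by (auto simp: UHom_iff ucomp_cos intro!: bexI)

lemma ucomp_assoc:
  assumes "\<phi> \<in> UHom G os s t" "\<psi> \<in> UHom G os t u" "\<chi> \<in> UHom G os u v"
  shows "ucomp G os s u v \<chi> (ucomp G os s t u \<psi> \<phi>) = ucomp G os s t v (ucomp G os t u v \<chi> \<psi>) \<phi>"
proof -
  from assms obtain f g h where a: "s \<le> t" "t \<le> u" "u \<le> v" "f \<in> carrier (G t)" "g \<in> carrier (G u)" "h \<in> carrier (G v)"
    "\<phi> = cos s t f" "\<psi> = cos t u g" "\<chi> = cos u v h" by (auto simp: UHom_iff)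
  have "os (v - u) u (e (v - u)) (os (u - t) t (e (u - t)) f) = os (v - t) t (e (v - t)) f"
    using os_assoc[of "e (v - u)" "v - u" "e (u - t)" "u - t" f t "v - t"] a by simp
  moreover have "os (v - u) u (e (v - u)) (g \<otimes>\<^bsub>G u\<^esub> os (u - t) t (e (u - t)) f)
     = os (v - u) u (e (v - u)) g \<otimes>\<^bsub>G v\<^esub> os (v - u) u (e (v - u)) (os (u - t) t (e (u - t)) f)"
    using a by (simp add: os_mult)
  ultimately show ?thesis using a by (simp add: ucomp_cos m_assoc)
qed

lemma uid_cos: "uid G os n = cos n n (e n)"
  by (simp add: uid_def cos_def)

lemma uid_UHom: "uid G os n \<in> UHom G os n n"
  by (simp add: uid_cos)

lemma ucomp_uid: "\<phi> \<in> UHom G os s t \<Longrightarrow> ucomp G os s t t (uid G os t) \<phi> = \<phi>"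
  by (auto simp: UHom_iff uid_cos ucomp_cos)

lemma iota_cos: "iota G os n = cos 0 n (e n)"
  by (simp add: iota_def cos_def)

text \<open>In id_a \<oplus> iota_1 the only braid is the inverse of \<open>b a 1\<close>. The
  arbitrary representative \<open>u\<close> of iota_1 is moved across it by naturality and ends in
  the subgroup G_1 of the coset.\<close>

lemma ginc_cos: "ginc G os b a = cos a (Suc a) (inv\<^bsub>G (Suc a)\<^esub> (b a 1))"
proof -
  obtain u where u: "u \<in> carrier (G 1)" "crep (cos 0 1 (e 1)) = u"
    using crep_cos[of 0 1 "e 1"] by fastforce
  have i: "crep (uid G os a) = e a"
    unfolding uid_cos by (rule crep_cos[of a a "e a"]) (auto simp: G0)
  have "os a 1 (e a) u \<otimes>\<^bsub>G (Suc a)\<^esub> inv\<^bsub>G (Suc a)\<^esub> (b a 1) = inv\<^bsub>G (Suc a)\<^esub> (b a 1) \<otimes>\<^bsub>G (Suc a)\<^esub> os 1 a u (e a)"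
    using inv_b_nat[of "e a" a u 1 "Suc a"] u by simp
  then have "ginc G os b a = cos a (Suc a) (inv\<^bsub>G (Suc a)\<^esub> (b a 1) \<otimes>\<^bsub>G (Suc a)\<^esub> os 1 a u (e a))"
    unfolding ginc_def uoplus_def i iota_cos u(2) unfolding cos_def by simp
  then show ?thesis using cos_absorb[of a "Suc a" "inv\<^bsub>G (Suc a)\<^esub> (b a 1)" u] u by simp
qed

text \<open>Naturality of the braiding slides \<open>h\<close> past the inverse of
  \<open>b a 1\<close>.\<close>

lemma sigma_equivariant:
  assumes "h \<in> carrier (G a)"
  shows "ucomp G os a a (Suc a) (ginc G os b a) (cos a a h)
    = ucomp G os a (Suc a) (Suc a) (cos (Suc a) (Suc a) (os a 1 h (e 1))) (ginc G os b a)"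
  using assms inv_b_nat[of h a "e 1" 1 "Suc a"]
  by (simp add: ginc_cos ucomp_cos)

text \<open>The two hexagons expand the braids of \<open>a\<close> points with one and with two new
  ones. After naturality the expansions differ by the crossing \<open>b 1 1\<close> of the new
  points, which lies in the subgroup G_2 that the coset forgets.\<close>

lemma sigma_sigma:
  "ucomp G os a (Suc a) (Suc (Suc a)) (ginc G os b (Suc a)) (ginc G os b a)
    = cos a (Suc (Suc a)) (inv\<^bsub>G (Suc (Suc a))\<^esub> (b a 2))"
proof -
  let ?A = "Suc (Suc a)"
  let ?x = "os 1 (Suc a) (e 1) (b a 1)"
  have "?x \<otimes>\<^bsub>G ?A\<^esub> b (Suc a) 1 = b a 2 \<otimes>\<^bsub>G ?A\<^esub> os a 2 (e a) (b 1 1)"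
    using b_add_left[of a 1 1] b_add_right[of a 1 1] by (simp add: m_assoc numeral_2_eq_2)
  also have "\<dots> = os 2 a (b 1 1) (e a) \<otimes>\<^bsub>G ?A\<^esub> b a 2"
    by (rule b_nat[symmetric]) simp_all
  finally have 1: "?x \<otimes>\<^bsub>G ?A\<^esub> b (Suc a) 1 = os 2 a (b 1 1) (e a) \<otimes>\<^bsub>G ?A\<^esub> b a 2" .
  have "inv\<^bsub>G ?A\<^esub> (b (Suc a) 1) \<otimes>\<^bsub>G ?A\<^esub> os 1 (Suc a) (e 1) (inv\<^bsub>G (Suc a)\<^esub> (b a 1))
    = inv\<^bsub>G ?A\<^esub> (?x \<otimes>\<^bsub>G ?A\<^esub> b (Suc a) 1)"
    by (simp add: os_inv group.inv_mult_group)
  also have "\<dots> = inv\<^bsub>G ?A\<^esub> (b a 2) \<otimes>\<^bsub>G ?A\<^esub> os 2 a (inv\<^bsub>G 2\<^esub> (b 1 1)) (e a)"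
    unfolding 1 by (simp add: os_inv group.inv_mult_group)
  finally have 2: "inv\<^bsub>G ?A\<^esub> (b (Suc a) 1) \<otimes>\<^bsub>G ?A\<^esub> os 1 (Suc a) (e 1) (inv\<^bsub>G (Suc a)\<^esub> (b a 1))
    = inv\<^bsub>G ?A\<^esub> (b a 2) \<otimes>\<^bsub>G ?A\<^esub> os 2 a (inv\<^bsub>G 2\<^esub> (b 1 1)) (e a)" .
  have "?A - a = 2" by simp
  then show ?thesis
    using cos_absorb[of a ?A "inv\<^bsub>G ?A\<^esub> (b a 2)" "inv\<^bsub>G 2\<^esub> (b 1 1)"]
    by (simp add: ginc_cos ucomp_cos 2[simplified])
qed

text \<open>By naturality \<open>g\<close> passes through the braid to the right end, where the
  coset absorbs it. This invariance is what repairs the simplicial identities below.\<close>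

lemma sigma_sigma_invariant:
  assumes "g \<in> carrier (G 2)"
  shows "ucomp G os a (Suc (Suc a)) (Suc (Suc a)) (cos (Suc (Suc a)) (Suc (Suc a)) (os a 2 (e a) g))
     (cos a (Suc (Suc a)) (inv\<^bsub>G (Suc (Suc a))\<^esub> (b a 2))) = cos a (Suc (Suc a)) (inv\<^bsub>G (Suc (Suc a))\<^esub> (b a 2))"
proof -
  let ?A = "Suc (Suc a)"
  have "os a 2 (e a) g \<otimes>\<^bsub>G ?A\<^esub> inv\<^bsub>G ?A\<^esub> (b a 2) = inv\<^bsub>G ?A\<^esub> (b a 2) \<otimes>\<^bsub>G ?A\<^esub> os 2 a g (e a)"
    by (rule inv_b_nat[symmetric]) (use assms in simp_all)
  moreover have "?A - a = 2" by simp
  ultimately show ?thesis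
    using cos_absorb[of a ?A "inv\<^bsub>G ?A\<^esub> (b a 2)" g] assms by (simp add: ucomp_cos)
qed

section \<open>Face elements and their relations\<close>

lemma face_closed [simp]:
  "\<lbrakk>Suc q \<le> n; i \<le> q\<rbrakk> \<Longrightarrow> cs_face G os b q n i \<in> carrier (G n)"
  unfolding cs_face_def by (intro os_closed) auto

text \<open>A face braids only the last q + 1 points, so it commutes with \<open>h\<close> on the
  first n - q - 1; regrouping h \<oplus> id_(q+1) as (h \<oplus> id_1) \<oplus> id_q exhibits an
  element of G_(n-q).\<close>

lemma face_emb:
  assumes "Suc q \<le> n" "i \<le> q" "h \<in> carrier (G (n - Suc q))"
  shows "os (n - Suc q) (Suc q) h (e (Suc q)) \<otimes>\<^bsub>G n\<^esub> cs_face G os b q n i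
    = cs_face G os b q n i \<otimes>\<^bsub>G n\<^esub> os (n - q) q (os (n - Suc q) 1 h (e 1)) (e q)"
proof -
  have "os (n - q) q (os (n - Suc q) 1 h (e 1)) (e q) = os (n - Suc q) (Suc q) h (e (Suc q))"
    using assms os_assoc[of h "n - Suc q" "e 1" 1 "e q" q "n - q"] Suc_diff_Suc[of q n] by simp
  then show ?thesis using assms by (simp add: cs_face_def os_mult)
qed

text \<open>The last factor is the crossing of the two strands that are deleted by the composite face.\<close>

lemma face_face:
  assumes "Suc (Suc q) \<le> n" "i < j" "j \<le> Suc q"
  shows "cs_face G os b (Suc q) n j \<otimes>\<^bsub>G n\<^esub> cs_face G os b q n i
    = cs_face G os b (Suc q) n i \<otimes>\<^bsub>G n\<^esub> cs_face G os b q n (j - 1)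
      \<otimes>\<^bsub>G n\<^esub> os (n - q) q (os (n - Suc (Suc q)) 2 (e (n - Suc (Suc q))) (b 1 1)) (e q)"
proof -
  define m where "m = n - Suc (Suc q)"
  define r where "r = Suc (Suc q)"
  have n: "n = m + r" using assms by (simp add: m_def r_def)
  \<comment> \<open>\<open>l\<close> counts the strands strictly between i and j, and
    \<open>c\<close> below those after j; in these variables the truncated differences become
    sums.\<close>
  obtain l where l: "j = Suc i + l" using assms(2) by (metis Suc_leI le_Suc_ex)
  obtain c where c: "Suc q = j + c" using assms(3) le_Suc_ex by blast
  let ?B = "os (Suc i) (Suc l + c) (b 1 i) (e (Suc l + c))"
  have up: "cs_face G os b (Suc q) n k = os m r (e m) (os (Suc k) (Suc q - k) (b 1 k) (e (Suc q - k)))" for k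
    by (simp add: cs_face_def m_def r_def)
  have down: "cs_face G os b q n k = os m r (e m) (os 1 (Suc q) (e 1) (os (Suc k) (q - k) (b 1 k) (e (q - k))))"
    if "k \<le> q" for k
  proof -
    have "os (Suc m) (Suc q) (e (Suc m)) (os (Suc k) (q - k) (b 1 k) (e (q - k)))
        = os m (1 + Suc q) (e m) (os 1 (Suc q) (e 1) (os (Suc k) (q - k) (b 1 k) (e (q - k))))"
      using that os_assoc[of "e m" m "e 1" 1 "os (Suc k) (q - k) (b 1 k) (e (q - k))" "Suc q" "Suc m"] by simp
    then show ?thesis using assms by (simp add: cs_face_def m_def r_def Suc_diff_Suc)
  qed
  have x: "os 1 (Suc q) (e 1) (os (Suc i) (q - i) (b 1 i) (e (q - i)))
      = os (Suc j) c (os 1 j (e 1) (os (Suc i) l (b 1 i) (e l))) (e c)"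
  proof -
    have 1: "os (Suc i) (l + c) (b 1 i) (e (l + c)) = os j c (os (Suc i) l (b 1 i) (e l)) (e c)"
      using os_assoc[of "b 1 i" "Suc i" "e l" l "e c" c j] l by simp
    have 2: "q - i = l + c" "Suc q = j + c" using l c by auto
    show ?thesis unfolding 2 1
      by (subst os_assoc) (use l in simp_all)
  qed
  \<comment> \<open>The braid of face i sits inside the block that face j carries across, so
    naturality pushes it through \<open>b 1 j\<close>.\<close>
  have bj: "b 1 j \<otimes>\<^bsub>G (Suc j)\<^esub> os 1 j (e 1) (os (Suc i) l (b 1 i) (e l))
      = os j 1 (os (Suc i) l (b 1 i) (e l)) (e 1) \<otimes>\<^bsub>G (Suc j)\<^esub> b 1 j"
    by (rule b_nat[symmetric]) (use l in simp_all)
  have y: "os (Suc j) c (os j 1 (os (Suc i) l (b 1 i) (e l)) (e 1)) (e c) = ?B"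
    using os_assoc[of "b 1 i" "Suc i" "e l" l "e 1" 1 j] l
      os_assoc[of "b 1 i" "Suc i" "e (Suc l)" "Suc l" "e c" c "Suc j"] by simp
  \<comment> \<open>The hexagon shortens \<open>b 1 j\<close> to the braid of face j - 1 one level
    down, at the price of a crossing.\<close>
  have z: "os (Suc j) c (b 1 j) (e c) = os 1 (Suc q) (e 1) (os j c (b 1 (j - 1)) (e c)) \<otimes>\<^bsub>G r\<^esub> os 2 q (b 1 1) (e q)"
  proof -
    obtain k where k: "j = Suc k" using l by simp
    have "b 1 j = os 1 (Suc k) (e 1) (b 1 k) \<otimes>\<^bsub>G (Suc j)\<^esub> os 2 k (b 1 1) (e k)"
      using b_add_right[of 1 1 k] k by (simp add: numeral_2_eq_2)
    then have "os (Suc j) c (b 1 j) (e c) = os (Suc j) c (os 1 (Suc k) (e 1) (b 1 k)) (e c)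
        \<otimes>\<^bsub>G r\<^esub> os (Suc j) c (os 2 k (b 1 1) (e k)) (e c)"
      using k c by (simp add: os_mult r_def)
    also have "os (Suc j) c (os 1 (Suc k) (e 1) (b 1 k)) (e c) = os 1 (Suc q) (e 1) (os j c (b 1 k) (e c))"
      using os_assoc[of "e 1" 1 "b 1 k" "Suc k" "e c" c "Suc j"] k c by simp
    also have "os (Suc j) c (os 2 k (b 1 1) (e k)) (e c) = os 2 q (b 1 1) (e q)"
      using os_assoc[of "b 1 1" 2 "e k" k "e c" c "Suc j"] k c by simp
    finally show ?thesis using k by simp
  qed
  have w: "os (n - q) q (os (n - Suc (Suc q)) 2 (e (n - Suc (Suc q))) (b 1 1)) (e q) = os m r (e m) (os 2 q (b 1 1) (e q))"
    using os_assoc[of "e m" m "b 1 1" 2 "e q" q "n - q"] n by (simp add: r_def)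
  have ii: "Suc q - i = Suc l + c" "q - (j - 1) = c" "Suc q - j = c" "Suc (j - 1) = j" "i \<le> q" "j - 1 \<le> q" using l c by auto
  have ci: "os j c (b 1 (j - 1)) (e c) \<in> carrier (G (Suc q))" using c ii by (intro os_closed b_closed) auto
  have Bc: "?B \<in> carrier (G r)" using l c by (intro os_closed) (auto simp: r_def)
  have xc: "os 1 (Suc q) (e 1) (os (Suc i) (q - i) (b 1 i) (e (q - i))) \<in> carrier (G r)"
    using l c by (intro os_closed) (auto simp: r_def)
  have Jc: "os (Suc j) c (b 1 j) (e c) \<in> carrier (G r)" using c by (intro os_closed) (auto simp: r_def)
  have main: "os (Suc j) c (b 1 j) (e c) \<otimes>\<^bsub>G r\<^esub> os 1 (Suc q) (e 1) (os (Suc i) (q - i) (b 1 i) (e (q - i)))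
     = ?B \<otimes>\<^bsub>G r\<^esub> os (Suc j) c (b 1 j) (e c)"
    unfolding x y[symmetric] using bj l c by (simp add: os_mult r_def)
  have "cs_face G os b (Suc q) n j \<otimes>\<^bsub>G n\<^esub> cs_face G os b q n i
     = os m r (e m) (os (Suc j) c (b 1 j) (e c) \<otimes>\<^bsub>G r\<^esub> os 1 (Suc q) (e 1) (os (Suc i) (q - i) (b 1 i) (e (q - i))))"
    unfolding up down[OF ii(5)] ii using Jc xc n by (simp add: os_mult)
  also have "\<dots> = os m r (e m) (?B \<otimes>\<^bsub>G r\<^esub> (os 1 (Suc q) (e 1) (os j c (b 1 (j - 1)) (e c)) \<otimes>\<^bsub>G r\<^esub> os 2 q (b 1 1) (e q)))"
    unfolding main by (subst z) (rule refl)
  also have "\<dots> = os m r (e m) ?B \<otimes>\<^bsub>G n\<^esub> os m r (e m) (os 1 (Suc q) (e 1) (os j c (b 1 (j - 1)) (e c)))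
      \<otimes>\<^bsub>G n\<^esub> os m r (e m) (os 2 q (b 1 1) (e q))"
    using Bc ci n by (simp add: os_mult m_assoc r_def)
  finally show ?thesis unfolding w up down[OF ii(6)] ii .
qed

end

section \<open>Modules over the stability category\<close>

locale ugm = braided_stab G os b for G :: "nat \<Rightarrow> 'g monoid" and os b +
  fixes R :: "'r ring" and M :: "nat \<Rightarrow> ('r, 'x) module" and act :: "nat \<Rightarrow> nat \<Rightarrow> 'g set \<Rightarrow> 'x \<Rightarrow> 'x"
  assumes ugm: "ug_module G os R M act"
begin

lemma mod: "module R (M n)"
  using ugm by (simp add: ug_module_def)

lemma abg [simp]: "abelian_group (M n)"
  using mod by (simp add: module_def)

lemma act_linear: "\<phi> \<in> UHom G os s t \<Longrightarrow> linear_map R (M s) (M t) (act s t \<phi>)"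
  using ugm by (simp add: ug_module_def)

lemma act_closed: "\<lbrakk>\<phi> \<in> UHom G os s t; x \<in> carrier (M s)\<rbrakk> \<Longrightarrow> act s t \<phi> x \<in> carrier (M t)"
  using act_linear by (auto simp: linear_map_def)

lemma act_add: "\<lbrakk>\<phi> \<in> UHom G os s t; x \<in> carrier (M s); y \<in> carrier (M s)\<rbrakk>
    \<Longrightarrow> act s t \<phi> (x \<oplus>\<^bsub>M s\<^esub> y) = act s t \<phi> x \<oplus>\<^bsub>M t\<^esub> act s t \<phi> y"
  using act_linear by (auto simp: linear_map_def)

lemma act_smult: "\<lbrakk>\<phi> \<in> UHom G os s t; x \<in> carrier (M s); r \<in> carrier R\<rbrakk>
    \<Longrightarrow> act s t \<phi> (r \<odot>\<^bsub>M s\<^esub> x) = r \<odot>\<^bsub>M t\<^esub> act s t \<phi> x"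
  using act_linear by (auto simp: linear_map_def)

lemma act_uid: "x \<in> carrier (M n) \<Longrightarrow> act n n (uid G os n) x = x"
  using ugm by (simp add: ug_module_def)

lemma act_ucomp: "\<lbrakk>\<phi> \<in> UHom G os s t; \<psi> \<in> UHom G os t u; x \<in> carrier (M s)\<rbrakk>
    \<Longrightarrow> act s u (ucomp G os s t u \<psi> \<phi>) x = act t u \<psi> (act s t \<phi> x)"
  using ugm by (simp add: ug_module_def)

abbreviation ga where "ga \<equiv> gact G os act"
abbreviation sig where "sig \<equiv> minc G os b act"

lemma ga_cos: "ga n g x = act n n (cos n n g) x"
  by (simp add: gact_def cos_def)

lemma ga_mult: "\<lbrakk>g \<in> carrier (G n); h \<in> carrier (G n); x \<in> carrier (M n)\<rbrakk> \<Longrightarrow> ga n (g \<otimes>\<^bsub>G n\<^esub> h) x = ga n g (ga n h x)"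
  using act_ucomp[of "cos n n h" n n "cos n n g" n x] by (simp add: ga_cos ucomp_cos)

text \<open>Injectivity of \<oplus> makes G_(n-q) a subgroup of G_n, so each term of the complex is
  an induced module in the sense above.\<close>

lemma level_ind_mod:
  assumes "q \<le> n"
  shows "ind_mod (G n) (G (n - q)) (M (n - q)) (\<lambda>h. os (n - q) q h (e q)) (ga (n - q))"
proof (intro ind_mod.intro ind_mod_axioms.intro grp abg)
  show "inj_on (\<lambda>h. os (n - q) q h (e q)) (carrier (G (n - q)))"
    using os_inj[OF _ monoid.one_closed[OF mon] _ monoid.one_closed[OF mon]] by (intro inj_onI) blast
qed (use assms in \<open>simp_all add: os_mult ga_mult act_uid[unfolded uid_cos] ga_cos act_closed act_add\<close>,
     simp add: ga_cos[symmetric] ga_mult)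

lemma ginc_UHom: "ginc G os b a \<in> UHom G os a (Suc a)"
  by (simp add: ginc_cos)

lemma sig_closed: "x \<in> carrier (M a) \<Longrightarrow> sig a x \<in> carrier (M (Suc a))"
  by (simp add: minc_def act_closed ginc_UHom)

lemma sig_add: "\<lbrakk>x \<in> carrier (M a); y \<in> carrier (M a)\<rbrakk> \<Longrightarrow> sig a (x \<oplus>\<^bsub>M a\<^esub> y) = sig a x \<oplus>\<^bsub>M (Suc a)\<^esub> sig a y"
  by (simp add: minc_def act_add ginc_UHom)

lemma sig_smult: "\<lbrakk>x \<in> carrier (M a); r \<in> carrier R\<rbrakk> \<Longrightarrow> sig a (r \<odot>\<^bsub>M a\<^esub> x) = r \<odot>\<^bsub>M (Suc a)\<^esub> sig a x"
  by (simp add: minc_def act_smult ginc_UHom)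

lemma sig_ga:
  assumes "h \<in> carrier (G a)" "x \<in> carrier (M a)"
  shows "sig a (ga a h x) = ga (Suc a) (os a 1 h (e 1)) (sig a x)"
  using act_ucomp[of "cos a a h" a a "ginc G os b a" "Suc a" x]
    act_ucomp[of "ginc G os b a" a "Suc a" "cos (Suc a) (Suc a) (os a 1 h (e 1))" "Suc a" x]
    sigma_equivariant[OF assms(1)] assms
  by (simp add: minc_def ga_cos ginc_UHom)

lemma sig_sig_invariant:
  assumes "g \<in> carrier (G 2)" "x \<in> carrier (M a)"
  shows "ga (Suc (Suc a)) (os a 2 (e a) g) (sig (Suc a) (sig a x)) = sig (Suc a) (sig a x)"
proof -
  have "sig (Suc a) (sig a x) = act a (Suc (Suc a)) (cos a (Suc (Suc a)) (inv\<^bsub>G (Suc (Suc a))\<^esub> (b a 2))) x"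
    using act_ucomp[of "ginc G os b a" a "Suc a" "ginc G os b (Suc a)" "Suc (Suc a)" x] assms
    by (simp add: minc_def ginc_UHom sigma_sigma)
  then show ?thesis
    using assms sigma_sigma_invariant[OF assms(1), of a]
      act_ucomp[of "cos a (Suc (Suc a)) (inv\<^bsub>G (Suc (Suc a))\<^esub> (b a 2))" a "Suc (Suc a)"
        "cos (Suc (Suc a)) (Suc (Suc a)) (os a 2 (e a) g)" "Suc (Suc a)" x]
    by (simp add: ga_cos)
qed

end

section \<open>The central stability complex and short exact sequences\<close>

text \<open>Chains carry no coefficients, so the sign of the i-th face is moved into the module
  entry.\<close>

definition sg :: "('x, 'm) ring_scheme \<Rightarrow> nat \<Rightarrow> 'x \<Rightarrow> 'x" where
  "sg M i x = (if even i then x else \<ominus>\<^bsub>M\<^esub> x)"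

context ugm
begin

text \<open>In contrast to the degree \<open>p \<ge> -1\<close> of the complex, \<open>q = p + 1\<close> counts the added points.\<close>

definition Ch :: "nat \<Rightarrow> nat \<Rightarrow> ('g \<times> 'x) list set" where
  "Ch n q = {l. \<forall>(g, x)\<in>set l. q \<le> n \<and> g \<in> carrier (G n) \<and> x \<in> carrier (M (n - q))}"

abbreviation tq :: "nat \<Rightarrow> nat \<Rightarrow> ('g \<times> 'x) list \<Rightarrow> ('g \<times> 'x) list \<Rightarrow> bool" where
  "tq n q \<equiv> ind_mod.teq (G n) (G (n - q)) (M (n - q)) (\<lambda>h. os (n - q) q h (e q)) (ga (n - q))"

text \<open>Indexed by its target: it maps \<open>Ch n (Suc q)\<close> to \<open>Ch n q\<close> and
  is the differential of the complex in degree p = q.\<close>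

definition bd :: "nat \<Rightarrow> nat \<Rightarrow> ('g \<times> 'x) list \<Rightarrow> ('g \<times> 'x) list" where
  "bd n q = multi_map [0..<Suc q] (\<lambda>i g. g \<otimes>\<^bsub>G n\<^esub> cs_face G os b q n i)
     (\<lambda>i x. sg (M (n - q)) i (sig (n - Suc q) x))"

text \<open>This is vanishing of the homology in degree q - 1. For q = 0 the cycle condition is
  void, as nothing lies below V_n; the guard q \<le> n sets aside the range where n - q would be
  truncated and the complex is zero.\<close>

definition exact_at :: "nat \<Rightarrow> nat \<Rightarrow> bool" where
  "exact_at n q \<longleftrightarrow> (q \<le> n \<longrightarrow>
     (\<forall>l\<in>Ch n q. (\<forall>p. q = Suc p \<longrightarrow> tq n p (bd n p l) []) \<longrightarrow> (\<exists>l'\<in>Ch n (Suc q). tq n q (bd n q l') l)))"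

lemma chains_eq: "q \<le> n \<Longrightarrow> ind_mod.chains (G n) (M (n - q)) = Ch n q"
  by (auto simp: Ch_def ind_mod.chains_def[OF level_ind_mod])

lemma Ch_Nil [simp]: "[] \<in> Ch n q"
  by (simp add: Ch_def)

lemma Ch_Cons [simp]:
  "(g, x) # l \<in> Ch n q \<longleftrightarrow> q \<le> n \<and> g \<in> carrier (G n) \<and> x \<in> carrier (M (n - q)) \<and> l \<in> Ch n q"
  by (auto simp: Ch_def)

lemma Ch_append [simp]: "l @ k \<in> Ch n q \<longleftrightarrow> l \<in> Ch n q \<and> k \<in> Ch n q"
  by (auto simp: Ch_def)

lemma Ch_empty: "\<lbrakk>l \<in> Ch n q; n < q\<rbrakk> \<Longrightarrow> l = []"
  by (cases l) (auto simp: Ch_def)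

lemma tq_refl: "\<lbrakk>q \<le> n; l \<in> Ch n q\<rbrakk> \<Longrightarrow> tq n q l l"
  using ind_mod.refl[OF level_ind_mod] by (simp add: chains_eq)

lemmas tq_sym = ind_mod.sym[OF level_ind_mod]
  and tq_trans = ind_mod.trans[OF level_ind_mod]
  and tq_append = ind_mod.append[OF level_ind_mod]
  and tq_zeros = ind_mod.teq_zeros[OF level_ind_mod]
  and tq_append_cancel = ind_mod.teq_append_cancel[OF level_ind_mod]

lemma tq_Ch: "\<lbrakk>tq n q l k; q \<le> n\<rbrakk> \<Longrightarrow> l \<in> Ch n q \<and> k \<in> Ch n q"
  using ind_mod.teq_chains[OF level_ind_mod] by (simp add: chains_eq)

lemma tq_mset: "\<lbrakk>q \<le> n; mset l = mset k; l \<in> Ch n q\<rbrakk> \<Longrightarrow> tq n q l k"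
  using ind_mod.teq_mset[OF level_ind_mod] by (simp add: chains_eq)

definition ng :: "nat \<Rightarrow> nat \<Rightarrow> ('g \<times> 'x) list \<Rightarrow> ('g \<times> 'x) list" where
  "ng n q = map (\<lambda>(g, x). (g, \<ominus>\<^bsub>M (n - q)\<^esub> x))"

lemma ng_eq: "q \<le> n \<Longrightarrow> ind_mod.neg (M (n - q)) = ng n q"
  by (simp add: ng_def ind_mod.neg_def[OF level_ind_mod])

lemma a_inv_closed [simp]: "x \<in> carrier (M m) \<Longrightarrow> \<ominus>\<^bsub>M m\<^esub> x \<in> carrier (M m)"
  using abelian_group.a_inv_closed[OF abg] .

lemma ng_Ch: "l \<in> Ch n q \<Longrightarrow> ng n q l \<in> Ch n q"
  by (auto simp: ng_def Ch_def)

lemma tq_diff: "\<lbrakk>q \<le> n; l \<in> Ch n q; k \<in> Ch n q\<rbrakk> \<Longrightarrow> tq n q l k \<longleftrightarrow> tq n q (l @ ng n q k) []"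
  using ind_mod.teq_diff[OF level_ind_mod] by (simp add: chains_eq ng_eq)

lemma sig_zero: "sig a \<zero>\<^bsub>M a\<^esub> = \<zero>\<^bsub>M (Suc a)\<^esub>"
proof -
  interpret X: abelian_group "M a" by (rule abg)
  interpret Y: abelian_group "M (Suc a)" by (rule abg)
  show ?thesis using sig_add[of "\<zero>\<^bsub>M a\<^esub>" a "\<zero>\<^bsub>M a\<^esub>"] sig_closed[of "\<zero>\<^bsub>M a\<^esub>" a] by simp
qed

lemma sig_neg:
  assumes "x \<in> carrier (M a)"
  shows "sig a (\<ominus>\<^bsub>M a\<^esub> x) = \<ominus>\<^bsub>M (Suc a)\<^esub> sig a x"
proof -
  have "sig a (\<ominus>\<^bsub>M a\<^esub> x) \<oplus>\<^bsub>M (Suc a)\<^esub> sig a x = \<zero>\<^bsub>M (Suc a)\<^esub>"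
    using sig_add[of "\<ominus>\<^bsub>M a\<^esub> x" a x] assms sig_zero by (simp add: abelian_group.l_neg)
  then show ?thesis using abelian_group.minus_equality[OF abg] assms sig_closed by (metis a_inv_closed)
qed

lemma sg_closed [simp]: "x \<in> carrier (M m) \<Longrightarrow> sg (M m) i x \<in> carrier (M m)"
  by (simp add: sg_def)

lemma sg_sig: "x \<in> carrier (M a) \<Longrightarrow> sig a (sg (M a) i x) = sg (M (Suc a)) i (sig a x)"
  by (simp add: sg_def sig_neg)

lemma sg_add: "\<lbrakk>x \<in> carrier (M m); y \<in> carrier (M m)\<rbrakk>
    \<Longrightarrow> sg (M m) i (x \<oplus>\<^bsub>M m\<^esub> y) = sg (M m) i x \<oplus>\<^bsub>M m\<^esub> sg (M m) i y"
  by (simp add: sg_def abelian_group.minus_add[OF abg])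

lemma ga_neg:
  assumes "x \<in> carrier (M m)" "h \<in> carrier (G m)"
  shows "ga m h (\<ominus>\<^bsub>M m\<^esub> x) = \<ominus>\<^bsub>M m\<^esub> ga m h x"
proof -
  interpret I: ind_mod "G m" "G (m - 0)" "M (m - 0)" "\<lambda>h. os (m - 0) 0 h (e 0)" "ga (m - 0)"
    by (rule level_ind_mod) simp
  have "ga m h (\<ominus>\<^bsub>M m\<^esub> x) \<oplus>\<^bsub>M m\<^esub> ga m h x = \<zero>\<^bsub>M m\<^esub>"
    using I.ac_add[of h "\<ominus>\<^bsub>M m\<^esub> x" x] I.ac_zero[of h] assms by (simp add: abelian_group.l_neg)
  then show ?thesis using abelian_group.minus_equality[OF abg] assms I.ac_closed[of h] by simp
qed

lemma ga_sg: "\<lbrakk>x \<in> carrier (M m); h \<in> carrier (G m)\<rbrakk> \<Longrightarrow> ga m h (sg (M m) i x) = sg (M m) i (ga m h x)"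
  by (simp add: sg_def ga_neg)

lemma ga_closed [simp]: "\<lbrakk>h \<in> carrier (G m); x \<in> carrier (M m)\<rbrakk> \<Longrightarrow> ga m h x \<in> carrier (M m)"
  by (simp add: ga_cos act_closed)

text \<open>Every face carries \<open>h\<close> in G_(n-q-1) to h \<oplus> id_1, on the group side
  by \<open>face_emb\<close> and on the module side by \<open>sig_ga\<close>; hence the differential
  is well defined on tensors.\<close>

lemma bd_ind_map:
  assumes "Suc q \<le> n"
  shows "ind_map (G n) (G (n - Suc q)) (M (n - Suc q)) (\<lambda>h. os (n - Suc q) (Suc q) h (e (Suc q))) (ga (n - Suc q))
    (G n) (G (n - q)) (M (n - q)) (\<lambda>h. os (n - q) q h (e q)) (ga (n - q))
    [0..<Suc q] (\<lambda>i g. g \<otimes>\<^bsub>G n\<^esub> cs_face G os b q n i) (\<lambda>i h. os (n - Suc q) 1 h (e 1))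
    (\<lambda>i x. sg (M (n - q)) i (sig (n - Suc q) x))"
proof (intro ind_map.intro ind_map_axioms.intro level_ind_mod assms)
  show "q \<le> n" using assms by simp
  have nq: "n - q = Suc (n - Suc q)" using assms by simp
  fix i assume "i \<in> set [0..<Suc q]"
  then have i: "i \<le> q" by auto
  show "g \<otimes>\<^bsub>G n\<^esub> cs_face G os b q n i \<in> carrier (G n)" if "g \<in> carrier (G n)" for g
    using that assms i by simp
  show "os (n - Suc q) 1 h (e 1) \<in> carrier (G (n - q))" if "h \<in> carrier (G (n - Suc q))" for h
    using that nq by simp
  show "g \<otimes>\<^bsub>G n\<^esub> os (n - Suc q) (Suc q) h (e (Suc q)) \<otimes>\<^bsub>G n\<^esub> cs_face G os b q n i =
       g \<otimes>\<^bsub>G n\<^esub> cs_face G os b q n i \<otimes>\<^bsub>G n\<^esub> os (n - q) q (os (n - Suc q) 1 h (e 1)) (e q)"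
    if g: "g \<in> carrier (G n)" "h \<in> carrier (G (n - Suc q))" for g h
  proof -
    have "os (n - Suc q) (Suc q) h (e (Suc q)) \<in> carrier (G n)" using g assms by simp
    moreover have "os (n - q) q (os (n - Suc q) 1 h (e 1)) (e q) \<in> carrier (G n)"
      using g assms nq by (intro os_closed) auto
    ultimately show ?thesis using g assms i face_emb[OF assms i g(2)] by (simp add: m_assoc)
  qed
  show "sg (M (n - q)) i (sig (n - Suc q) x) \<in> carrier (M (n - q))" if "x \<in> carrier (M (n - Suc q))" for x
    using that sig_closed by (simp add: nq)
  show "sg (M (n - q)) i (sig (n - Suc q) (x \<oplus>\<^bsub>M (n - Suc q)\<^esub> y)) =
       sg (M (n - q)) i (sig (n - Suc q) x) \<oplus>\<^bsub>M (n - q)\<^esub> sg (M (n - q)) i (sig (n - Suc q) y)"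
    if "x \<in> carrier (M (n - Suc q))" "y \<in> carrier (M (n - Suc q))" for x y
    using that sig_closed by (simp add: nq sig_add sg_add)
  show "sg (M (n - q)) i (sig (n - Suc q) (ga (n - Suc q) h x)) =
       ga (n - q) (os (n - Suc q) 1 h (e 1)) (sg (M (n - q)) i (sig (n - Suc q) x))"
    if "x \<in> carrier (M (n - Suc q))" "h \<in> carrier (G (n - Suc q))" for x h
    using that sig_closed by (simp add: nq sig_ga ga_sg)
qed

lemma bd_Nil [simp]: "bd n q [] = []"
  and bd_append: "bd n q (l @ k) = bd n q l @ bd n q k"
  by (simp_all add: bd_def multi_map_append)

lemma bd_tq: "\<lbrakk>tq n (Suc q) l k; Suc q \<le> n\<rbrakk> \<Longrightarrow> tq n q (bd n q l) (bd n q k)"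
  unfolding bd_def by (rule ind_map.multi_map_teq[OF bd_ind_map])

lemma bd_Ch:
  assumes "l \<in> Ch n (Suc q)"
  shows "bd n q l \<in> Ch n q"
proof (cases "Suc q \<le> n")
  case True
  then show ?thesis using ind_map.multi_map_chains[OF bd_ind_map[OF True], of l] assms
      chains_eq[of q n] chains_eq[of "Suc q" n] by (simp add: bd_def)
next
  case False
  then have "l = []" using Ch_empty assms by simp
  then show ?thesis by simp
qed

lemma bd_ng:
  assumes "l \<in> Ch n (Suc q)"
  shows "bd n q (ng n (Suc q) l) = ng n q (bd n q l)"
proof -
  have "\<forall>(g, x)\<in>set l. Suc q \<le> n \<and> x \<in> carrier (M (n - Suc q))" using assms by (auto simp: Ch_def)
  then show ?thesis
  proof (induction l)
    case (Cons a l)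
    obtain g x where a: "a = (g, x)" by (cases a)
    have x: "x \<in> carrier (M (n - Suc q))" and q: "n - q = Suc (n - Suc q)" using Cons.prems a by auto
    have "bd n q (ng n (Suc q) [(g, x)]) = ng n q (bd n q [(g, x)])"
      using x sig_closed[OF x] by (simp add: ng_def bd_def multi_map_def sg_def sig_neg q)
    moreover have "bd n q (ng n (Suc q) l) = ng n q (bd n q l)" using Cons by auto
    ultimately show ?case using a bd_append[of n q "[(g, x)]" l] bd_append[of n q "ng n (Suc q) [(g, x)]" "ng n (Suc q) l"]
      by (simp add: ng_def)
  qed (simp add: ng_def)
qed

text \<open>The usual cancellation of pairs of faces, except that \<open>face_face\<close> leaves a
  crossing behind. Being an element of G_(n-q), it moves to the module entry by \<open>act\<close>,
  and the doubly stabilised element there is fixed by it.\<close>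

lemma bd_bd_single:
  assumes n: "Suc (Suc q) \<le> n" and g: "g \<in> carrier (G n)" and x: "x \<in> carrier (M (n - Suc (Suc q)))"
  shows "tq n q (bd n q (bd n (Suc q) [(g, x)])) []"
proof -
  have qn: "q \<le> n" using n by simp
  interpret I: ind_mod "G n" "G (n - q)" "M (n - q)" "\<lambda>h. os (n - q) q h (e q)" "ga (n - q)"
    by (rule level_ind_mod[OF qn])
  define m where "m = n - Suc (Suc q)"
  have nq: "n - q = Suc (Suc m)" "n - Suc q = Suc m" "n - Suc (Suc q) = m" using n by (auto simp: m_def)
  define z where "z = sig (Suc m) (sig m x)"
  have xm: "x \<in> carrier (M m)" using x nq by simp
  have z: "z \<in> carrier (M (n - q))" using xm by (simp add: z_def nq sig_closed)
  define T where "T = (\<lambda>(j, i). (g \<otimes>\<^bsub>G n\<^esub> cs_face G os b (Suc q) n j \<otimes>\<^bsub>G n\<^esub> cs_face G os b q n i,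
      sg (M (n - q)) i (sg (M (n - q)) j z)))"
  \<comment> \<open>For i < j this is the partner of (j, i) in the simplicial identity. It maps
    these pairs bijectively onto the remaining ones and reverses the sign.\<close>
  define s :: "nat \<times> nat \<Rightarrow> nat \<times> nat" where "s = (\<lambda>(j, i). (i, j - 1))"
  let ?PL = "List.product [0..<Suc (Suc q)] [0..<Suc q]"
  let ?ps = "filter (\<lambda>(j, i). i < j) ?PL"
  have "bd n q (bd n (Suc q) [(g, x)]) = map T ?PL"
    using xm by (simp add: bd_def multi_map_def T_def product_concat_map map_concat z_def nq comp_def
        sg_sig sig_closed del: upt_Suc)
  have mem: "(j, i) \<in> set ?ps \<longleftrightarrow> j \<le> Suc q \<and> i \<le> q \<and> i < j" for i j by auto
  have inj: "inj_on s (set ?ps)" by (rule inj_onI) (auto simp: s_def)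
  have "set (filter (\<lambda>(j, i). \<not> i < j) ?PL) = set (map s ?ps)"
  proof (intro equalityI subsetI)
    fix y assume "y \<in> set (filter (\<lambda>(j, i). \<not> i < j) ?PL)"
    moreover obtain j i where "y = (j, i)" by (cases y)
    ultimately have "y = (j, i)" "j \<le> i" "i \<le> q" by auto
    then have "y = s (Suc i, j)" "(Suc i, j) \<in> set ?ps" unfolding mem by (auto simp: s_def)
    then show "y \<in> set (map s ?ps)" unfolding set_map by blast
  next
    fix y assume "y \<in> set (map s ?ps)"
    then obtain j i where y: "y = s (j, i)" "(j, i) \<in> set ?ps" unfolding set_map by auto
    then show "y \<in> set (filter (\<lambda>(j, i). \<not> i < j) ?PL)" unfolding mem by (auto simp: s_def)
  qed
  moreover have "distinct (filter (\<lambda>(j, i). \<not> i < j) ?PL)" "distinct (map s ?ps)"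
    using inj by (auto simp: distinct_map distinct_product simp del: upt_Suc intro!: distinct_filter)
  ultimately have "mset (filter (\<lambda>(j, i). \<not> i < j) ?PL) = mset (map s ?ps)"
    using set_eq_iff_mset_eq_distinct by blast
  moreover have "mset ?PL = mset ?ps + mset (filter (\<lambda>(j, i). \<not> i < j) ?PL)"
    using multiset_partition[of "mset ?PL" "\<lambda>(j, i). i < j"]
    by (simp add: case_prod_unfold del: upt_Suc)
  ultimately have PL: "mset ?PL = mset ?ps + mset (map s ?ps)" by simp
  have pair: "mset (concat (map (\<lambda>p. [T p, T (s p)]) js)) = mset (map T js) + mset (map T (map s js))" for js
    by (induction js) auto
  have ms: "mset (map T ?PL) = mset (concat (map (\<lambda>p. [T p, T (s p)]) ?ps))"
    unfolding pair mset_map PL by (simp del: upt_Suc)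
  have t': "tq n q (concat (map (\<lambda>p. [T p, T (s p)]) ?ps)) (concat (map (\<lambda>p. []) ?ps))"
  proof (rule I.teq_concat)
    fix p assume p: "p \<in> set ?ps"
    obtain j i where ji: "p = (j, i)" by (cases p)
    then have c: "j \<le> Suc q" "i \<le> q" "i < j" using p mem by auto
    define y where "y = sg (M (n - q)) i (sg (M (n - q)) j z)"
    define g' where "g' = g \<otimes>\<^bsub>G n\<^esub> cs_face G os b (Suc q) n i \<otimes>\<^bsub>G n\<^esub> cs_face G os b q n (j - 1)"
    define u where "u = os m 2 (e m) (b 1 1)"
    have u: "u \<in> carrier (G (n - q))" by (simp add: u_def nq)
    have g': "g' \<in> carrier (G n)" using g n c by (simp add: g'_def)
    have y: "y \<in> carrier (M (n - q))" using z by (simp add: y_def)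
    have "ga (n - q) u z = z" using xm by (simp add: u_def nq z_def sig_sig_invariant)
    then have uy: "ga (n - q) u y = y" using u z by (simp add: y_def ga_sg)
    have up: "os (n - q) q u (e q) \<in> carrier (G n)" using u qn by (intro os_closed) auto
    have "g \<otimes>\<^bsub>G n\<^esub> cs_face G os b (Suc q) n j \<otimes>\<^bsub>G n\<^esub> cs_face G os b q n i
       = g \<otimes>\<^bsub>G n\<^esub> (cs_face G os b (Suc q) n j \<otimes>\<^bsub>G n\<^esub> cs_face G os b q n i)"
      using g n c by (simp add: m_assoc)
    also have "\<dots> = g' \<otimes>\<^bsub>G n\<^esub> os (n - q) q u (e q)"
      unfolding face_face[OF n c(3,1)] nq g'_def u_def[symmetric] using up[unfolded nq] g n c by (simp add: m_assoc)
    finally have "T p = (g' \<otimes>\<^bsub>G n\<^esub> os (n - q) q u (e q), y)" by (simp add: T_def y_def ji)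
    then have t1: "tq n q [T p] [(g', y)]" using I.act[OF g' u y] uy by simp
    have "\<ominus>\<^bsub>M (n - q)\<^esub> (\<ominus>\<^bsub>M (n - q)\<^esub> z) = z" by (rule abelian_group.minus_minus[OF abg z])
    then have "T (s p) = (g', \<ominus>\<^bsub>M (n - q)\<^esub> y)"
      using c z by (cases "even i"; cases "even j") (auto simp: T_def y_def ji s_def g'_def sg_def)
    then have t2: "tq n q [T (s p)] [(g', \<ominus>\<^bsub>M (n - q)\<^esub> y)]" using g' y I.refl by simp
    show "tq n q [T p, T (s p)] []"
      using I.trans[OF I.append[OF t1 t2, simplified] I.teq_neg_pair[OF g' y]] by simp
  qed
  have nil: "concat (map (\<lambda>p. []) js) = []" for js :: "(nat \<times> nat) list" by simp
  note t = t'[unfolded nil]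
  have "map T ?PL \<in> Ch n q" using n g z qn by (auto simp: Ch_def T_def)
  then have "tq n q (map T ?PL) []" by (rule tq_trans[OF qn tq_mset[OF qn ms] t])
  then show ?thesis using \<open>bd n q (bd n (Suc q) [(g, x)]) = map T ?PL\<close> by simp
qed

lemma bd_bd: "\<lbrakk>q \<le> n; l \<in> Ch n (Suc (Suc q))\<rbrakk> \<Longrightarrow> tq n q (bd n q (bd n (Suc q) l)) []"
proof (induction l)
  case (Cons a l)
  obtain g x where a: "a = (g, x)" by (cases a)
  have "tq n q (bd n q (bd n (Suc q) [a]) @ bd n q (bd n (Suc q) l)) ([] @ [])"
    using Cons a bd_bd_single by (intro tq_append) auto
  then show ?case by (simp flip: bd_append)
qed (simp add: tq_refl)

end

section \<open>Functoriality of the complex in the module\<close>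

definition mp :: "('x \<Rightarrow> 'y) \<Rightarrow> ('g \<times> 'x) list \<Rightarrow> ('g \<times> 'y) list" where
  "mp f = map (\<lambda>(g, x). (g, f x))"

lemma mp_simps [simp]: "mp f [] = []" "mp f ((g, x) # l) = (g, f x) # mp f l" "mp f (l @ k) = mp f l @ mp f k"
  by (simp_all add: mp_def)

lemma mp_multi_map: "mp f l = multi_map [()] (\<lambda>_ g. g) (\<lambda>_. f) l"
  by (induction l) (auto simp: mp_def multi_map_def)

locale ugm_hom = A: ugm G os b R M act + B: ugm G os b R M' act'
  for G :: "nat \<Rightarrow> 'g monoid" and os b and R :: "'r ring" and M :: "nat \<Rightarrow> ('r, 'x) module" and act
    and M' :: "nat \<Rightarrow> ('r, 'y) module" and act' +
  fixes \<eta> :: "nat \<Rightarrow> 'x \<Rightarrow> 'y"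
  assumes hom: "ug_hom G os R M act M' act' \<eta>"
begin

lemma hom_closed: "x \<in> carrier (M n) \<Longrightarrow> \<eta> n x \<in> carrier (M' n)"
  and hom_add: "\<lbrakk>x \<in> carrier (M n); y \<in> carrier (M n)\<rbrakk> \<Longrightarrow> \<eta> n (x \<oplus>\<^bsub>M n\<^esub> y) = \<eta> n x \<oplus>\<^bsub>M' n\<^esub> \<eta> n y"
  and hom_smult: "\<lbrakk>r \<in> carrier R; x \<in> carrier (M n)\<rbrakk> \<Longrightarrow> \<eta> n (r \<odot>\<^bsub>M n\<^esub> x) = r \<odot>\<^bsub>M' n\<^esub> \<eta> n x"
  and hom_act: "\<lbrakk>\<phi> \<in> UHom G os s t; x \<in> carrier (M s)\<rbrakk> \<Longrightarrow> \<eta> t (act s t \<phi> x) = act' s t \<phi> (\<eta> s x)"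
  using hom by (auto simp: ug_hom_def linear_map_def)

lemma hom_ga: "\<lbrakk>h \<in> carrier (G n); x \<in> carrier (M n)\<rbrakk> \<Longrightarrow> \<eta> n (A.ga n h x) = B.ga n h (\<eta> n x)"
  by (simp add: A.ga_cos B.ga_cos hom_act)

lemma hom_sig: "x \<in> carrier (M n) \<Longrightarrow> \<eta> (Suc n) (A.sig n x) = B.sig n (\<eta> n x)"
  by (simp add: minc_def hom_act A.ginc_UHom)

lemma hom_zero: "\<eta> n \<zero>\<^bsub>M n\<^esub> = \<zero>\<^bsub>M' n\<^esub>"
proof -
  interpret X: abelian_group "M n" by (rule A.abg)
  interpret Y: abelian_group "M' n" by (rule B.abg)
  show ?thesis using hom_add[of "\<zero>\<^bsub>M n\<^esub>" n "\<zero>\<^bsub>M n\<^esub>"] hom_closed[of "\<zero>\<^bsub>M n\<^esub>" n] by simp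
qed

lemma hom_neg:
  assumes "x \<in> carrier (M n)"
  shows "\<eta> n (\<ominus>\<^bsub>M n\<^esub> x) = \<ominus>\<^bsub>M' n\<^esub> \<eta> n x"
proof -
  have "\<eta> n (\<ominus>\<^bsub>M n\<^esub> x) \<oplus>\<^bsub>M' n\<^esub> \<eta> n x = \<zero>\<^bsub>M' n\<^esub>"
    using hom_add[of "\<ominus>\<^bsub>M n\<^esub> x" n x] assms hom_zero by (simp add: abelian_group.l_neg)
  then show ?thesis using abelian_group.minus_equality[OF B.abg] assms hom_closed by (metis A.a_inv_closed)
qed

lemma mp_Ch: "l \<in> A.Ch n q \<Longrightarrow> mp (\<eta> (n - q)) l \<in> B.Ch n q"
  by (auto simp: A.Ch_def B.Ch_def mp_def hom_closed)

lemma mp_ind_map: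
  assumes "q \<le> n"
  shows "ind_map (G n) (G (n - q)) (M (n - q)) (\<lambda>h. os (n - q) q h (A.e q)) (A.ga (n - q))
    (G n) (G (n - q)) (M' (n - q)) (\<lambda>h. os (n - q) q h (A.e q)) (B.ga (n - q))
    [()] (\<lambda>_ g. g) (\<lambda>_ h. h) (\<lambda>_. \<eta> (n - q))"
  by (intro ind_map.intro ind_map_axioms.intro A.level_ind_mod B.level_ind_mod assms)
    (simp_all add: hom_closed hom_add hom_ga)

lemma mp_tq: "\<lbrakk>q \<le> n; A.tq n q l k\<rbrakk> \<Longrightarrow> B.tq n q (mp (\<eta> (n - q)) l) (mp (\<eta> (n - q)) k)"
  unfolding mp_multi_map by (rule ind_map.multi_map_teq[OF mp_ind_map])

lemma mp_bd:
  assumes "l \<in> A.Ch n (Suc q)"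
  shows "mp (\<eta> (n - q)) (A.bd n q l) = B.bd n q (mp (\<eta> (n - Suc q)) l)"
  using assms
proof (induction l)
  case (Cons a l)
  obtain g x where a: "a = (g, x)" by (cases a)
  have x: "x \<in> carrier (M (n - Suc q))" and q: "n - q = Suc (n - Suc q)" using Cons.prems a by auto
  have "mp (\<eta> (n - q)) (A.bd n q [(g, x)]) = B.bd n q (mp (\<eta> (n - Suc q)) [(g, x)])"
    using x A.sig_closed[OF x] by (simp add: mp_def A.bd_def B.bd_def multi_map_def sg_def q hom_neg hom_sig)
  moreover have "mp (\<eta> (n - q)) (A.bd n q l) = B.bd n q (mp (\<eta> (n - Suc q)) l)" using Cons a by simp
  ultimately show ?case using a A.bd_append[of n q "[(g, x)]" l]
      B.bd_append[of n q "mp (\<eta> (n - Suc q)) [(g, x)]" "mp (\<eta> (n - Suc q)) l"]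
    by simp
qed simp

lemma mp_ng:
  assumes "l \<in> A.Ch n q"
  shows "mp (\<eta> (n - q)) (A.ng n q l) = B.ng n q (mp (\<eta> (n - q)) l)"
  using assms by (induction l) (auto simp: A.ng_def B.ng_def hom_neg)

text \<open>Induction preserves injectivity: \<open>ev\<close> commutes with \<open>\<eta>\<close>,
  so every coordinate of \<open>l\<close> is sent to zero by an injective map, and the coordinates
  determine the chain.\<close>

lemma mp_inj:
  assumes "q \<le> n" "l \<in> A.Ch n q" "inj_on (\<eta> (n - q)) (carrier (M (n - q)))" "B.tq n q (mp (\<eta> (n - q)) l) []"
  shows "A.tq n q l []"
proof -
  interpret X: ind_mod "G n" "G (n - q)" "M (n - q)" "\<lambda>h. os (n - q) q h (A.e q)" "A.ga (n - q)"
    by (rule A.level_ind_mod[OF assms(1)])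
  interpret Y: ind_mod "G n" "G (n - q)" "M' (n - q)" "\<lambda>h. os (n - q) q h (A.e q)" "B.ga (n - q)"
    by (rule B.level_ind_mod[OF assms(1)])
  have l: "l \<in> X.chains" using assms A.chains_eq by simp
  have ev: "Y.ev g (mp (\<eta> (n - q)) l) = \<eta> (n - q) (X.ev g l)" if g: "g \<in> carrier (G n)" for g
    using l
  proof (induction l)
    case (Cons a l)
    obtain g1 x where a: "a = (g1, x)" by (cases a)
    have "Y.ev1 g g1 (\<eta> (n - q) x) = \<eta> (n - q) (X.ev1 g g1 x)"
      using Cons.prems a X.M.zero_closed hom_zero inv_into_into
      by (auto simp: X.ev1_def Y.ev1_def hom_ga the_inv_into_f_f[OF X.emb_inj])
    then show ?case using Cons a g by (simp add: hom_add X.ev1_closed X.ev_closed)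
  qed (simp add: hom_zero)
  show ?thesis
  proof (rule X.ev_zero_imp_teq[OF l])
    fix g assume g: "g \<in> carrier (G n)"
    have "\<eta> (n - q) (X.ev g l) = \<eta> (n - q) \<zero>\<^bsub>M (n - q)\<^esub>"
      using ev[OF g] Y.teq_sound[OF assms(4) g] hom_zero by simp
    then show "X.ev g l = \<zero>\<^bsub>M (n - q)\<^esub>"
      using inj_onD[OF assms(3)] X.ev_closed[OF l g] by blast
  qed
qed

lemma mp_inj_eq:
  assumes "q \<le> n" "l \<in> A.Ch n q" "k \<in> A.Ch n q" "inj_on (\<eta> (n - q)) (carrier (M (n - q)))"
    "B.tq n q (mp (\<eta> (n - q)) l) (mp (\<eta> (n - q)) k)"
  shows "A.tq n q l k"
proof -
  have "B.tq n q (mp (\<eta> (n - q)) (l @ A.ng n q k)) []"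
    using assms mp_Ch by (simp add: mp_ng B.tq_diff)
  then have "A.tq n q (l @ A.ng n q k) []" using assms by (intro mp_inj) (auto simp: A.ng_Ch)
  then show ?thesis using assms by (simp add: A.tq_diff)
qed

text \<open>Entries are lifted one at a time, so the lift maps to \<open>z\<close> as a list and not
  only up to relations.\<close>

lemma mp_lift:
  assumes "\<And>m. \<eta> m ` carrier (M m) = carrier (M' m)" "z \<in> B.Ch n q"
  shows "\<exists>y\<in>A.Ch n q. mp (\<eta> (n - q)) y = z"
  using assms(2)
proof (induction z)
  case Nil
  show ?case by (intro bexI[of _ "[]"]) simp_all
next
  case (Cons a z)
  obtain g x where a: "a = (g, x)" by (cases a)
  have "x \<in> \<eta> (n - q) ` carrier (M (n - q))" using assms(1) Cons.prems a by simp
  then obtain x' where x': "x' \<in> carrier (M (n - q))" "\<eta> (n - q) x' = x" by auto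
  obtain y where "y \<in> A.Ch n q" "mp (\<eta> (n - q)) y = z" using Cons a by auto
  then show ?case using Cons.prems a x' by (intro bexI[of _ "(g, x') # y"]) auto
qed

lemma exact_at_iso:
  assumes "\<And>m. bij_betw (\<eta> m) (carrier (M m)) (carrier (M' m))" "A.exact_at n q"
  shows "B.exact_at n q"
  unfolding B.exact_at_def
proof (intro impI ballI)
  have inj: "inj_on (\<eta> m) (carrier (M m))" and surj: "\<eta> m ` carrier (M m) = carrier (M' m)" for m
    using assms(1) by (auto simp: bij_betw_def)
  assume q: "q \<le> n"
  fix l assume l: "l \<in> B.Ch n q" "\<forall>p. q = Suc p \<longrightarrow> B.tq n p (B.bd n p l) []"
  obtain k where k: "k \<in> A.Ch n q" "mp (\<eta> (n - q)) k = l" using mp_lift surj l(1) by blast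
  have "\<forall>p. q = Suc p \<longrightarrow> A.tq n p (A.bd n p k) []"
  proof (intro allI impI)
    fix p assume p: "q = Suc p"
    have "mp (\<eta> (n - p)) (A.bd n p k) = B.bd n p l" using mp_bd k p by simp
    then show "A.tq n p (A.bd n p k) []" using p q k l A.bd_Ch inj by (intro mp_inj) auto
  qed
  then obtain k' where k': "k' \<in> A.Ch n (Suc q)" "A.tq n q (A.bd n q k') k"
    using assms(2) q k by (auto simp: A.exact_at_def)
  then show "\<exists>l'\<in>B.Ch n (Suc q). B.tq n q (B.bd n q l') l"
    using mp_tq[OF q k'(2)] mp_bd[OF k'(1)] mp_Ch[OF k'(1)] k by auto
qed

text \<open>At q = 0 there are no cycles to check, so right exactness alone passes vanishing on to a
  quotient.\<close>

lemma exact_at_0_surj: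
  assumes "\<And>m. \<eta> m ` carrier (M m) = carrier (M' m)" "A.exact_at n 0"
  shows "B.exact_at n 0"
  unfolding B.exact_at_def
proof (intro impI ballI)
  fix l assume l: "l \<in> B.Ch n 0"
  obtain k where k: "k \<in> A.Ch n 0" "mp (\<eta> n) k = l" using mp_lift[OF assms(1) l] by auto
  then obtain k' where k': "k' \<in> A.Ch n (Suc 0)" "A.tq n 0 (A.bd n 0 k') k"
    using assms(2) by (auto simp: A.exact_at_def)
  then show "\<exists>l'\<in>B.Ch n (Suc 0). B.tq n 0 (B.bd n 0 l') l"
    using mp_tq[OF _ k'(2)] mp_bd[OF k'(1)] mp_Ch[OF k'(1)] k by auto
qed

end

section \<open>Short exact sequences of modules\<close>

locale ugm_ses = KP: ugm_hom G os b R K Kact P Pact \<kappa> + PV: ugm_hom G os b R P Pact V Vact \<epsilon>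
  for G :: "nat \<Rightarrow> 'g monoid" and os b and R :: "'r ring" and K :: "nat \<Rightarrow> ('r, 'x) module" and Kact
    and P :: "nat \<Rightarrow> ('r, 'y) module" and Pact and V :: "nat \<Rightarrow> ('r, 'z) module" and Vact \<kappa> \<epsilon> +
  assumes inj: "inj_on (\<kappa> n) (carrier (K n))"
    and surj: "\<epsilon> n ` carrier (P n) = carrier (V n)"
    and ker: "\<kappa> n ` carrier (K n) = {x \<in> carrier (P n). \<epsilon> n x = \<zero>\<^bsub>V n\<^esub>}"
begin

text \<open>The image of \<open>y\<close> may vanish through cancellation between entries in one
  coset. In normal form no such cancellation is left: \<open>ev\<close> shows that each entry goes
  to zero separately, hence comes from \<open>K\<close>.\<close>

lemma middle:
  assumes "q \<le> n" "y \<in> KP.B.Ch n q" "PV.B.tq n q (mp (\<epsilon> (n - q)) y) []"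
  shows "\<exists>w\<in>KP.A.Ch n q. KP.B.tq n q (mp (\<kappa> (n - q)) w) y"
proof -
  interpret X: ind_mod "G n" "G (n - q)" "P (n - q)" "\<lambda>h. os (n - q) q h (KP.A.e q)" "KP.B.ga (n - q)"
    by (rule KP.B.level_ind_mod[OF assms(1)])
  interpret Y: ind_mod "G n" "G (n - q)" "V (n - q)" "\<lambda>h. os (n - q) q h (KP.A.e q)" "PV.B.ga (n - q)"
    by (rule PV.B.level_ind_mod[OF assms(1)])
  obtain y' where y': "X.teq y y'" "X.separated (map fst y')"
    using X.normal_form[unfolded KP.B.chains_eq[OF assms(1)], OF assms(2)] by blast
  have y'C: "y' \<in> KP.B.Ch n q" using KP.B.tq_Ch y' assms(1) by blast
  let ?z = "mp (\<epsilon> (n - q)) y'"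
  have "Y.teq ?z []" using PV.mp_tq[OF assms(1) y'(1)] assms(3) Y.sym Y.trans by blast
  have zC: "?z \<in> Y.chains" using PV.mp_Ch[OF y'C] PV.B.chains_eq assms(1) by simp
  have "map fst ?z = map fst y'" by (induction y') (auto simp: mp_def)
  then have sep: "Y.separated (map fst ?z)" using y'(2) by (simp add: X.separated_def Y.separated_def)
  have "\<forall>(g, x)\<in>set y'. x \<in> carrier (P (n - q)) \<and> \<epsilon> (n - q) x = \<zero>\<^bsub>V (n - q)\<^esub>"
  proof (safe)
    fix g x assume gx: "(g, x) \<in> set y'"
    then show "x \<in> carrier (P (n - q))" using y'C by (auto simp: KP.B.Ch_def)
    have g: "g \<in> carrier (G n)" using gx y'C by (auto simp: KP.B.Ch_def)
    have "(g, \<epsilon> (n - q) x) \<in> set ?z" using gx by (force simp: mp_def)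
    from Y.separated_ev[OF sep zC this] Y.teq_sound[OF \<open>Y.teq ?z []\<close> g]
    show "\<epsilon> (n - q) x = \<zero>\<^bsub>V (n - q)\<^esub>" by simp
  qed
  then have "\<exists>w\<in>KP.A.Ch n q. mp (\<kappa> (n - q)) w = y'" using y'C
  proof (induction y')
    case Nil
    show ?case by (intro bexI[of _ "[]"]) simp_all
  next
    case (Cons a l)
    obtain g x where a: "a = (g, x)" by (cases a)
    have "x \<in> \<kappa> (n - q) ` carrier (K (n - q))" using ker Cons.prems a by simp
    then obtain x' where x': "x' \<in> carrier (K (n - q))" "\<kappa> (n - q) x' = x" by auto
    obtain w where "w \<in> KP.A.Ch n q" "mp (\<kappa> (n - q)) w = l" using Cons a by auto
    then show ?case using Cons.prems a x' by (intro bexI[of _ "(g, x') # w"]) auto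
  qed
  then show ?thesis using y'(1) X.sym by blast
qed

lemma mp_zero:
  assumes "q \<le> n" "w \<in> KP.A.Ch n q"
  shows "PV.B.tq n q (mp (\<epsilon> (n - q)) (mp (\<kappa> (n - q)) w)) []"
proof -
  have "\<epsilon> (n - q) (\<kappa> (n - q) x) = \<zero>\<^bsub>V (n - q)\<^esub>" if "x \<in> carrier (K (n - q))" for x
    using ker[of "n - q"] that by auto
  then show ?thesis using assms by (intro PV.B.tq_zeros) (auto simp: mp_def KP.A.Ch_def)
qed

text \<open>In the long exact sequence the homology of \<open>V\<close> lies between that of
  \<open>P\<close> in the same degree and that of \<open>K\<close> one degree lower. The chase is
  carried out on chains.\<close>

lemma exact_at_quotient:
  assumes K: "KP.A.exact_at n q" and P: "KP.B.exact_at n (Suc q)"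
  shows "PV.B.exact_at n (Suc q)"
  unfolding PV.B.exact_at_def
proof (intro impI ballI)
  assume q1: "Suc q \<le> n"
  then have q: "q \<le> n" by simp
  note tr = KP.B.tq_trans[OF q]
  fix z assume z: "z \<in> PV.B.Ch n (Suc q)" "\<forall>p. Suc q = Suc p \<longrightarrow> PV.B.tq n p (PV.B.bd n p z) []"
  obtain y where y: "y \<in> KP.B.Ch n (Suc q)" "mp (\<epsilon> (n - Suc q)) y = z"
    using PV.mp_lift[OF surj z(1)] by blast
  have dy: "KP.B.bd n q y \<in> KP.B.Ch n q" using y KP.B.bd_Ch by blast
  have "PV.B.tq n q (mp (\<epsilon> (n - q)) (KP.B.bd n q y)) []" using PV.mp_bd[OF y(1)] y z by simp
  \<comment> \<open>\<open>w\<close> represents the value of the connecting homomorphism on the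
    class of \<open>z\<close>.\<close>
  then obtain w where w: "w \<in> KP.A.Ch n q" "KP.B.tq n q (mp (\<kappa> (n - q)) w) (KP.B.bd n q y)"
    using middle[OF q dy] by blast
  have "\<forall>p. q = Suc p \<longrightarrow> KP.A.tq n p (KP.A.bd n p w) []"
  proof (intro allI impI)
    fix p assume p: "q = Suc p"
    have pn: "p \<le> n" using p q by simp
    have "KP.B.tq n p (KP.B.bd n p (mp (\<kappa> (n - q)) w)) (KP.B.bd n p (KP.B.bd n q y))"
      using KP.B.bd_tq w(2) p q by simp
    moreover have "KP.B.tq n p (KP.B.bd n p (KP.B.bd n q y)) []"
      using KP.B.bd_bd[OF pn] y p by simp
    ultimately have "KP.B.tq n p (KP.B.bd n p (mp (\<kappa> (n - q)) w)) []" by (rule KP.B.tq_trans[OF pn])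
    then have "KP.B.tq n p (mp (\<kappa> (n - p)) (KP.A.bd n p w)) []" using KP.mp_bd w p by simp
    then show "KP.A.tq n p (KP.A.bd n p w) []"
      using w p KP.A.bd_Ch by (intro KP.mp_inj[OF pn]) (auto simp: inj)
  qed
  then obtain w' where w': "w' \<in> KP.A.Ch n (Suc q)" "KP.A.tq n q (KP.A.bd n q w') w"
    using K q w by (auto simp: KP.A.exact_at_def)
  let ?v = "mp (\<kappa> (n - Suc q)) w'"
  \<comment> \<open>Subtracting the image of \<open>w'\<close> does not change the class that the
    lift has in \<open>V\<close>, and it turns \<open>y\<close> into a cycle of
    \<open>P\<close>.\<close>
  let ?y = "y @ KP.B.ng n (Suc q) ?v"
  have v: "?v \<in> KP.B.Ch n (Suc q)" using KP.mp_Ch w' by simp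
  have "KP.B.tq n q (KP.B.bd n q ?v) (mp (\<kappa> (n - q)) w)"
    using KP.mp_tq[OF q w'(2)] KP.mp_bd[OF w'(1)] by simp
  then have "KP.B.tq n q (KP.B.bd n q ?v) (KP.B.bd n q y)" using w(2) tr by blast
  then have "KP.B.tq n q (KP.B.bd n q y) (KP.B.bd n q ?v)" by (rule KP.B.tq_sym[OF q])
  then have "KP.B.tq n q (KP.B.bd n q y @ KP.B.ng n q (KP.B.bd n q ?v)) []"
    using KP.B.tq_diff[OF q dy] KP.B.bd_Ch v by blast
  then have "KP.B.tq n q (KP.B.bd n q ?y) []" using KP.B.bd_ng[OF v] by (simp add: KP.B.bd_append)
  moreover have "?y \<in> KP.B.Ch n (Suc q)" using y v KP.B.ng_Ch by simp
  ultimately obtain u where u: "u \<in> KP.B.Ch n (Suc (Suc q))" "KP.B.tq n (Suc q) (KP.B.bd n (Suc q) u) ?y"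
    using P q1 by (fastforce simp: KP.B.exact_at_def)
  have "PV.B.tq n (Suc q) (PV.B.bd n (Suc q) (mp (\<epsilon> (n - Suc (Suc q))) u)) (mp (\<epsilon> (n - Suc q)) ?y)"
    using PV.mp_tq[OF q1 u(2)] PV.mp_bd[OF u(1)] by simp
  moreover have "PV.B.tq n (Suc q) (mp (\<epsilon> (n - Suc q)) ?y) (z @ [])"
  proof -
    have "mp (\<epsilon> (n - Suc q)) ?y = z @ mp (\<epsilon> (n - Suc q)) (mp (\<kappa> (n - Suc q)) (KP.A.ng n (Suc q) w'))"
      using y KP.mp_ng[OF w'(1)] by simp
    then show ?thesis
      using PV.B.tq_append[OF q1 PV.B.tq_refl[OF q1 z(1)] mp_zero[OF q1 KP.A.ng_Ch[OF w'(1)]]] by simp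
  qed
  ultimately have "PV.B.tq n (Suc q) (PV.B.bd n (Suc q) (mp (\<epsilon> (n - Suc (Suc q))) u)) z"
    using PV.B.tq_trans[OF q1] by force
  then show "\<exists>l'\<in>PV.B.Ch n (Suc (Suc q)). PV.B.tq n (Suc q) (PV.B.bd n (Suc q) l') z"
    using PV.mp_Ch[OF u(1)] by blast
qed

text \<open>The homology of \<open>K\<close> lies between that of \<open>V\<close> one degree higher
  and that of \<open>P\<close> in the same degree.\<close>

lemma exact_at_sub:
  assumes P: "KP.B.exact_at n q" and V: "PV.B.exact_at n (Suc q)"
  shows "KP.A.exact_at n q"
  unfolding KP.A.exact_at_def
proof (intro impI ballI)
  assume q: "q \<le> n"
  fix w assume w: "w \<in> KP.A.Ch n q" "\<forall>p. q = Suc p \<longrightarrow> KP.A.tq n p (KP.A.bd n p w) []"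
  let ?w = "mp (\<kappa> (n - q)) w"
  have wC: "?w \<in> KP.B.Ch n q" using KP.mp_Ch w by blast
  have "\<forall>p. q = Suc p \<longrightarrow> KP.B.tq n p (KP.B.bd n p ?w) []"
  proof (intro allI impI)
    fix p assume p: "q = Suc p"
    have "KP.B.tq n p (mp (\<kappa> (n - p)) (KP.A.bd n p w)) (mp (\<kappa> (n - p)) [])"
      using p q w by (intro KP.mp_tq) auto
    then show "KP.B.tq n p (KP.B.bd n p ?w) []" using KP.mp_bd w p by simp
  qed
  then obtain y where y: "y \<in> KP.B.Ch n (Suc q)" "KP.B.tq n q (KP.B.bd n q y) ?w"
    using P q wC by (auto simp: KP.B.exact_at_def)
  show "\<exists>w'\<in>KP.A.Ch n (Suc q). KP.A.tq n q (KP.A.bd n q w') w"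
  proof (cases "Suc q \<le> n")
    \<comment> \<open>Here q = n: there are no chains with q + 1 added points, so \<open>y\<close>
      is empty and the image of \<open>w\<close> in \<open>P\<close> is already zero.\<close>
    case False
    then have "y = []" using y KP.B.Ch_empty by simp
    then have "KP.B.tq n q ?w []" using y KP.B.tq_sym[OF q] by simp
    then have "KP.A.tq n q w []" by (rule KP.mp_inj[OF q w(1) inj])
    then show ?thesis using KP.A.tq_sym[OF q] by (intro bexI[of _ "[]"]) auto
  next
    case q1: True
    let ?y = "mp (\<epsilon> (n - Suc q)) y"
    have yC: "?y \<in> PV.B.Ch n (Suc q)" using PV.mp_Ch y by blast
    have "PV.B.tq n q (PV.B.bd n q ?y) (mp (\<epsilon> (n - q)) ?w)"
      using PV.mp_tq[OF q y(2)] PV.mp_bd[OF y(1)] by simp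
    then have "PV.B.tq n q (PV.B.bd n q ?y) []" using mp_zero[OF q w(1)] PV.B.tq_trans[OF q] by blast
    then obtain z where z: "z \<in> PV.B.Ch n (Suc (Suc q))" "PV.B.tq n (Suc q) (PV.B.bd n (Suc q) z) ?y"
      using V q1 yC by (auto simp: PV.B.exact_at_def)
    obtain u where u: "u \<in> KP.B.Ch n (Suc (Suc q))" "mp (\<epsilon> (n - Suc (Suc q))) u = z"
      using PV.mp_lift[OF surj z(1)] by blast
    let ?du = "KP.B.bd n (Suc q) u"
    have duC: "?du \<in> KP.B.Ch n (Suc q)" using u KP.B.bd_Ch by blast
    have "PV.B.tq n (Suc q) ?y (mp (\<epsilon> (n - Suc q)) ?du)"
      using z(2) PV.mp_bd[OF u(1)] u(2) PV.B.tq_sym[OF q1] by simp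
    \<comment> \<open>Correcting \<open>y\<close> by the boundary of \<open>u\<close> keeps its own
      boundary, up to relations, and brings it into the image of \<open>K\<close>.\<close>
    then have "PV.B.tq n (Suc q) (mp (\<epsilon> (n - Suc q)) (y @ KP.B.ng n (Suc q) ?du)) []"
      using PV.B.tq_diff[OF q1 yC] PV.mp_ng[OF duC] PV.mp_Ch[OF duC] by simp
    then obtain w' where w': "w' \<in> KP.A.Ch n (Suc q)"
        "KP.B.tq n (Suc q) (mp (\<kappa> (n - Suc q)) w') (y @ KP.B.ng n (Suc q) ?du)"
      using middle[OF q1, of "y @ KP.B.ng n (Suc q) ?du"] y KP.B.ng_Ch[OF duC] by auto
    have dd: "KP.B.tq n q (KP.B.bd n q ?du) []" using KP.B.bd_bd[OF q u(1)] .
    have "KP.B.tq n q (KP.B.ng n q (KP.B.bd n q ?du)) []"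
    proof -
      have "KP.B.tq n q [] (KP.B.bd n q ?du)" using dd KP.B.tq_sym[OF q] by blast
      then show ?thesis using KP.B.tq_diff[OF q, of "[]" "KP.B.bd n q ?du"] KP.B.bd_Ch[OF duC] by simp
    qed
    then have "KP.B.tq n q (KP.B.bd n q (y @ KP.B.ng n (Suc q) ?du)) (?w @ [])"
      unfolding KP.B.bd_append KP.B.bd_ng[OF duC] by (intro KP.B.tq_append q y)
    then have "KP.B.tq n q (KP.B.bd n q (mp (\<kappa> (n - Suc q)) w')) ?w"
      using KP.B.bd_tq[OF w'(2) q1] KP.B.tq_trans[OF q] by (metis append_Nil2)
    then have "KP.B.tq n q (mp (\<kappa> (n - q)) (KP.A.bd n q w')) ?w" using KP.mp_bd[OF w'(1)] by simp
    then have "KP.A.tq n q (KP.A.bd n q w') w"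
      using KP.A.bd_Ch[OF w'(1)] w(1) by (intro KP.mp_inj_eq q inj) auto
    then show ?thesis using w'(1) by blast
  qed
qed

end

section \<open>Formal combinations with coefficients\<close>

definition scale :: "'r ring \<Rightarrow> 'r \<Rightarrow> ('r \<times> 'k) list \<Rightarrow> ('r \<times> 'k) list" where
  "scale R c = map (\<lambda>(a, k). (c \<otimes>\<^bsub>R\<^esub> a, k))"

definition coneg :: "'r ring \<Rightarrow> ('r \<times> 'k) list \<Rightarrow> ('r \<times> 'k) list" where
  "coneg R = map (\<lambda>(r, k). (\<ominus>\<^bsub>R\<^esub> r, k))"

lemma valid_simps [simp]:
  "valid R S []" "valid R S ((r, k) # L) \<longleftrightarrow> r \<in> carrier R \<and> k \<in> S \<and> valid R S L"
  "valid R S (L @ L') \<longleftrightarrow> valid R S L \<and> valid R S L'"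
  by (auto simp: valid_def)

definition coefs :: "'r ring \<Rightarrow> ('r \<times> 'k) list \<Rightarrow> bool" where
  "coefs R L \<longleftrightarrow> fst ` set L \<subseteq> carrier R"

lemma coefs_simps [simp]:
  "coefs R []" "coefs R ((r, k) # L) \<longleftrightarrow> r \<in> carrier R \<and> coefs R L"
  "coefs R (L @ L') \<longleftrightarrow> coefs R L \<and> coefs R L'"
  by (auto simp: coefs_def)

lemma valid_coefs: "valid R S L \<Longrightarrow> coefs R L"
  by (auto simp: valid_def coefs_def)

locale coeff_ring = cring R for R :: "'r ring" (structure)
begin

lemma fs_Nil [simp]: "fs R [] k = \<zero>"
  and fs_Cons: "fs R ((r, k') # L) k = (if k' = k then r \<oplus> fs R L k else fs R L k)"
  by (simp_all add: fs_def)

lemma fs_closed [simp]: "coefs R L \<Longrightarrow> fs R L k \<in> carrier R"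
  by (induction L) (auto simp: fs_Cons)

lemma fs_append [simp]: "\<lbrakk>coefs R L; coefs R L'\<rbrakk> \<Longrightarrow> fs R (L @ L') k = fs R L k \<oplus> fs R L' k"
  by (induction L) (auto simp: fs_Cons a_assoc)

lemma fs_scale [simp]: "\<lbrakk>coefs R L; c \<in> carrier R\<rbrakk> \<Longrightarrow> fs R (scale R c L) k = c \<otimes> fs R L k"
  by (induction L) (auto simp: fs_Cons scale_def r_distr)

lemma fs_coneg [simp]: "coefs R L \<Longrightarrow> fs R (coneg R L) k = \<ominus> fs R L k"
  by (induction L) (auto simp: fs_Cons coneg_def minus_add)

lemma coefs_scale [simp]: "\<lbrakk>coefs R L; c \<in> carrier R\<rbrakk> \<Longrightarrow> coefs R (scale R c L)"
  by (auto simp: coefs_def scale_def)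

lemma coefs_coneg [simp]: "coefs R L \<Longrightarrow> coefs R (coneg R L)"
  by (auto simp: coefs_def coneg_def)

lemma valid_scale [simp]: "\<lbrakk>valid R S L; c \<in> carrier R\<rbrakk> \<Longrightarrow> valid R S (scale R c L)"
  by (auto simp: valid_def scale_def)

lemma valid_coneg [simp]: "valid R S L \<Longrightarrow> valid R S (coneg R L)"
  by (auto simp: valid_def coneg_def)

definition span_list :: "('r \<times> ('r \<times> 'k) list) list \<Rightarrow> ('r \<times> 'k) list" where
  "span_list ts = concat (map (\<lambda>(r, s). scale R r s) ts)"

lemma in_span_iff: "in_span R T L \<longleftrightarrow> (\<exists>ts. valid R T ts \<and> fs R L = fs R (span_list ts))"
  by (simp add: in_span_def valid_def span_list_def scale_def)

lemma valid_span_list: "\<lbrakk>valid R T ts; \<And>s. s \<in> T \<Longrightarrow> valid R S s\<rbrakk> \<Longrightarrow> valid R S (span_list ts)"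
  by (induction ts) (auto simp: span_list_def)

lemma span_list_append: "span_list (ts @ us) = span_list ts @ span_list us"
  by (simp add: span_list_def)

lemma in_span_Nil: "in_span R T []"
  unfolding in_span_iff by (intro exI[of _ "[]"]) (simp add: span_list_def)

lemma in_span_cong: "fs R L = fs R L' \<Longrightarrow> in_span R T L \<Longrightarrow> in_span R T L'"
  by (simp add: in_span_iff)

context
  fixes T :: "('r \<times> 'k) list set"
  assumes T: "\<And>s. s \<in> T \<Longrightarrow> coefs R s"
begin

lemma coefs_span_list: "valid R T ts \<Longrightarrow> coefs R (span_list ts)"
  using T by (induction ts) (auto simp: span_list_def)

lemma in_span_gen:
  assumes "s \<in> T"
  shows "in_span R T s"
  unfolding in_span_iff
proof (intro exI conjI)
  show "valid R T [(\<one>, s)]" using assms by simp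
  show "fs R s = fs R (span_list [(\<one>, s)])" using T[OF assms] by (auto simp: span_list_def)
qed

lemma in_span_append:
  assumes "in_span R T L" "in_span R T L'" "coefs R L" "coefs R L'"
  shows "in_span R T (L @ L')"
proof -
  obtain ts us where t: "valid R T ts" "fs R L = fs R (span_list ts)" "valid R T us" "fs R L' = fs R (span_list us)"
    using assms by (auto simp: in_span_iff)
  have "fs R (L @ L') = fs R (span_list (ts @ us))"
    using t assms coefs_span_list by (auto simp: span_list_append)
  then show ?thesis using t unfolding in_span_iff by (intro exI[of _ "ts @ us"]) simp
qed

lemma in_span_coneg:
  assumes "in_span R T L" "coefs R L"
  shows "in_span R T (coneg R L)"
proof -
  obtain ts where t: "valid R T ts" "fs R L = fs R (span_list ts)"
    using assms by (auto simp: in_span_iff)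
  have "fs R (span_list (coneg R us)) k = \<ominus> fs R (span_list us) k" if "valid R T us" for us k
    using that
  proof (induction us)
    case (Cons a us)
    obtain r s where a: "a = (r, s)" by (cases a)
    have r: "r \<in> carrier R" "coefs R s" "valid R T us" using Cons.prems a T by auto
    have "coefs R (span_list us)" "coefs R (span_list (coneg R us))"
      using r coefs_span_list by auto
    moreover have "span_list (a # us) = scale R r s @ span_list us"
      "span_list (coneg R (a # us)) = scale R (\<ominus> r) s @ span_list (coneg R us)"
      by (simp_all add: span_list_def coneg_def a)
    ultimately show ?case using r Cons.IH
      by (simp add: l_minus minus_add)
  qed (simp add: span_list_def coneg_def)
  then have "fs R (coneg R L) = fs R (span_list (coneg R ts))"
    using t assms by auto
  then show ?thesis using t unfolding in_span_iff by (intro exI[of _ "coneg R ts"]) simp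
qed

end

end

text \<open>A formal combination is evaluated by summing over its finite set of generators, so the value depends
  only on the coefficient function.\<close>

definition lin :: "('r, 'y) module \<Rightarrow> ('k \<Rightarrow> 'y) \<Rightarrow> ('r \<times> 'k) list \<Rightarrow> 'y" where
  "lin N f L = foldr (\<lambda>(r, k) s. r \<odot>\<^bsub>N\<^esub> f k \<oplus>\<^bsub>N\<^esub> s) L \<zero>\<^bsub>N\<^esub>"

lemma lin_simps [simp]: "lin N f [] = \<zero>\<^bsub>N\<^esub>" "lin N f ((r, k) # L) = r \<odot>\<^bsub>N\<^esub> f k \<oplus>\<^bsub>N\<^esub> lin N f L"
  by (simp_all add: lin_def)

locale coeff_module = coeff_ring R + module R M for R :: "'r ring" (structure) and M :: "('r, 'y) module"
begin

lemma minus_zero_M: "\<ominus>\<^bsub>M\<^esub> \<zero>\<^bsub>M\<^esub> = \<zero>\<^bsub>M\<^esub>"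
  using M.minus_equality[of "\<zero>\<^bsub>M\<^esub>" "\<zero>\<^bsub>M\<^esub>"] by simp

lemma lin_closed: "\<lbrakk>valid R S L; \<And>k. k \<in> S \<Longrightarrow> f k \<in> carrier M\<rbrakk> \<Longrightarrow> lin M f L \<in> carrier M"
  by (induction L) auto

lemma lin_append:
  "\<lbrakk>valid R S L; valid R S L'; \<And>k. k \<in> S \<Longrightarrow> f k \<in> carrier M\<rbrakk> \<Longrightarrow> lin M f (L @ L') = lin M f L \<oplus>\<^bsub>M\<^esub> lin M f L'"
  by (induction L) (auto simp: lin_closed M.a_assoc)

lemma lin_scale:
  "\<lbrakk>valid R S L; c \<in> carrier R; \<And>k. k \<in> S \<Longrightarrow> f k \<in> carrier M\<rbrakk> \<Longrightarrow> lin M f (scale R c L) = c \<odot>\<^bsub>M\<^esub> lin M f L"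
  by (induction L) (auto simp: lin_closed scale_def smult_r_distr smult_assoc1)

lemma lin_coneg:
  "\<lbrakk>valid R S L; \<And>k. k \<in> S \<Longrightarrow> f k \<in> carrier M\<rbrakk> \<Longrightarrow> lin M f (coneg R L) = \<ominus>\<^bsub>M\<^esub> lin M f L"
  by (induction L) (auto simp: lin_closed coneg_def smult_l_minus M.minus_add minus_zero_M)

lemma lin_finsum:
  assumes "finite T" "\<And>k. k \<in> T \<Longrightarrow> f k \<in> carrier M" "valid R T L"
  shows "lin M f L = (\<Oplus>\<^bsub>M\<^esub>k\<in>T. fs R L k \<odot>\<^bsub>M\<^esub> f k)"
  using assms(3)
proof (induction L)
  case Nil
  have "(\<Oplus>\<^bsub>M\<^esub>k\<in>T. fs R [] k \<odot>\<^bsub>M\<^esub> f k) = (\<Oplus>\<^bsub>M\<^esub>k\<in>T. \<zero>\<^bsub>M\<^esub>)"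
    by (rule M.finsum_cong') (use assms in auto)
  then show ?case by simp
next
  case (Cons a L)
  obtain r k0 where a: "a = (r, k0)" by (cases a)
  have v: "r \<in> carrier R" "k0 \<in> T" "valid R T L" using Cons.prems a by auto
  have "(\<Oplus>\<^bsub>M\<^esub>k\<in>T. fs R (a # L) k \<odot>\<^bsub>M\<^esub> f k)
      = (\<Oplus>\<^bsub>M\<^esub>k\<in>T. (if k0 = k then r \<odot>\<^bsub>M\<^esub> f k else \<zero>\<^bsub>M\<^esub>) \<oplus>\<^bsub>M\<^esub> fs R L k \<odot>\<^bsub>M\<^esub> f k)"
    by (rule M.finsum_cong') (use assms v valid_coefs[OF v(3)] in \<open>auto simp: a fs_Cons smult_l_distr\<close>)
  also have "\<dots> = (\<Oplus>\<^bsub>M\<^esub>k\<in>T. if k0 = k then r \<odot>\<^bsub>M\<^esub> f k else \<zero>\<^bsub>M\<^esub>) \<oplus>\<^bsub>M\<^esub> (\<Oplus>\<^bsub>M\<^esub>k\<in>T. fs R L k \<odot>\<^bsub>M\<^esub> f k)"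
    by (rule M.finsum_addf) (use assms v valid_coefs[OF v(3)] in auto)
  also have "(\<Oplus>\<^bsub>M\<^esub>k\<in>T. if k0 = k then r \<odot>\<^bsub>M\<^esub> f k else \<zero>\<^bsub>M\<^esub>) = r \<odot>\<^bsub>M\<^esub> f k0"
    by (rule M.finsum_singleton) (use assms v in auto)
  finally show ?case using Cons.IH v a by simp
qed

lemma lin_cong:
  assumes "valid R S L" "valid R S L'" "fs R L = fs R L'" "\<And>k. k \<in> S \<Longrightarrow> f k \<in> carrier M"
  shows "lin M f L = lin M f L'"
proof -
  define T where "T = snd ` set L \<union> snd ` set L'"
  have T: "finite T" "T \<subseteq> S" "valid R T L" "valid R T L'"
    using assms(1,2) by (auto simp: T_def valid_def rev_image_eqI)
  moreover have "f k \<in> carrier M" if "k \<in> T" for k using that T(2) assms(4) by blast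
  ultimately show ?thesis using assms(3) lin_finsum[of T f L] lin_finsum[of T f L'] by simp
qed

text \<open>A linear map that kills every relation kills their span; \<open>cs_eq_iff_tq\<close>
  applies this to the coordinates \<open>ev\<close>.\<close>

lemma lin_in_span:
  assumes "in_span R T L" "valid R S L" "\<And>s. s \<in> T \<Longrightarrow> valid R S s" "\<And>k. k \<in> S \<Longrightarrow> f k \<in> carrier M"
    "\<And>s. s \<in> T \<Longrightarrow> lin M f s = \<zero>\<^bsub>M\<^esub>"
  shows "lin M f L = \<zero>\<^bsub>M\<^esub>"
proof -
  obtain ts where ts: "valid R T ts" "fs R L = fs R (span_list ts)"
    using assms(1) by (auto simp: in_span_iff)
  have v: "valid R S (span_list us)" if "valid R T us" for us using valid_span_list[OF that] assms(3) by blast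
  have "lin M f L = lin M f (span_list ts)" using lin_cong[OF assms(2) v ts(2)] ts(1) assms(4) by blast
  also have "\<dots> = \<zero>\<^bsub>M\<^esub>" using ts(1)
  proof (induction ts)
    case (Cons a ts)
    obtain r s where a: "a = (r, s)" by (cases a)
    have r: "r \<in> carrier R" "s \<in> T" "valid R T ts" using Cons.prems a by auto
    have "span_list (a # ts) = scale R r s @ span_list ts" by (simp add: span_list_def a)
    moreover have "lin M f (scale R r s @ span_list ts) = lin M f (scale R r s) \<oplus>\<^bsub>M\<^esub> lin M f (span_list ts)"
      by (rule lin_append) (use r assms v in auto)
    moreover have "lin M f (scale R r s) = r \<odot>\<^bsub>M\<^esub> lin M f s"
      by (rule lin_scale) (use r assms in auto)
    ultimately show ?case using r Cons.IH assms by simp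
  qed (simp add: span_list_def)
  finally show ?thesis .
qed

end

section \<open>Comparing the two presentations of the tensor product\<close>

context ugm
begin

lemma ring [simp]: "cring R"
  using mod[of 0] by (simp add: module_def)

lemma smult_closed [simp]: "\<lbrakk>r \<in> carrier R; x \<in> carrier (M m)\<rbrakk> \<Longrightarrow> r \<odot>\<^bsub>M m\<^esub> x \<in> carrier (M m)"
  using module.smult_closed[OF mod] .

text \<open>The rule r (g \<otimes> x) = g \<otimes> rx removes the coefficients;
  \<open>lift\<close> below goes back with coefficient one. Up to the defining relations the two are
  mutually inverse.\<close>

definition strip :: "nat \<Rightarrow> ('r \<times> 'g \<times> 'x) list \<Rightarrow> ('g \<times> 'x) list" where
  "strip m = map (\<lambda>(r, g, x). (g, r \<odot>\<^bsub>M m\<^esub> x))"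

definition lift :: "('g \<times> 'x) list \<Rightarrow> ('r \<times> 'g \<times> 'x) list" where
  "lift = map (\<lambda>(g, x). (\<one>\<^bsub>R\<^esub>, g, x))"

lemma cs_gens_iff: "(g, x) \<in> cs_gens G M p n \<longleftrightarrow> Suc p \<le> n \<and> g \<in> carrier (G n) \<and> x \<in> carrier (M (n - Suc p))"
  by (simp add: cs_gens_def)

lemma strip_Ch: "valid R (cs_gens G M p n) L \<Longrightarrow> strip (n - Suc p) L \<in> Ch n (Suc p)"
  by (induction L) (auto simp: strip_def cs_gens_iff)

lemma valid_lift: "l \<in> Ch n (Suc p) \<Longrightarrow> valid R (cs_gens G M p n) (lift l)"
  using cring.cring_simprules(6)[OF ring] by (induction l) (auto simp: lift_def cs_gens_iff)

lemma strip_lift: "l \<in> Ch n (Suc p) \<Longrightarrow> strip (n - Suc p) (lift l) = l"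
  by (induction l) (auto simp: lift_def strip_def module.smult_one[OF mod])

lemma strip_cs_d:
  assumes "valid R (cs_gens G M p n) L"
  shows "strip (n - p) (cs_d G os b R act p n L) = bd n p (strip (n - Suc p) L)"
  using assms
proof (induction L)
  case (Cons c L)
  obtain r g x where c: "c = (r, g, x)" by (cases c)
  have q: "n - p = Suc (n - Suc p)" and x: "r \<in> carrier R" "x \<in> carrier (M (n - Suc p))"
    using Cons.prems c by (auto simp: cs_gens_iff)
  have "strip (n - p) (cs_d G os b R act p n [c]) = bd n p (strip (n - Suc p) [c])"
    using x sig_closed[OF x(2)]
    by (auto simp: c strip_def cs_d_def bd_def multi_map_def sg_def sig_smult q module.smult_l_minus[OF mod])
  moreover have "strip (n - p) (cs_d G os b R act p n (c # L))
      = strip (n - p) (cs_d G os b R act p n [c]) @ strip (n - p) (cs_d G os b R act p n L)"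
    by (simp add: cs_d_def strip_def)
  moreover have "strip (n - Suc p) (c # L) = strip (n - Suc p) [c] @ strip (n - Suc p) L"
    by (simp add: strip_def)
  ultimately show ?case using Cons c by (simp add: bd_append)
qed (simp add: strip_def cs_d_def)

lemma cs_d_valid:
  assumes "valid R (cs_gens G M (Suc p) n) L"
  shows "valid R (cs_gens G M p n) (cs_d G os b R act (Suc p) n L)"
  using assms
proof (induction L)
  case (Cons c L)
  interpret coeff_ring R by (rule coeff_ring.intro[OF ring])
  obtain r g x where c: "c = (r, g, x)" by (cases c)
  have q: "n - Suc p = Suc (n - Suc (Suc p))" and x: "r \<in> carrier R" "x \<in> carrier (M (n - Suc (Suc p)))"
    "g \<in> carrier (G n)" "Suc (Suc p) \<le> n"
    using Cons.prems c by (auto simp: cs_gens_iff)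
  have "valid R (cs_gens G M p n) (cs_d G os b R act (Suc p) n [c])"
    using x sig_closed[OF x(2)]
    by (auto simp: c cs_d_def valid_def cs_gens_iff q)
  moreover have "cs_d G os b R act (Suc p) n (c # L) = cs_d G os b R act (Suc p) n [c] @ cs_d G os b R act (Suc p) n L"
    by (simp add: cs_d_def)
  ultimately show ?case using Cons c by simp
qed (simp add: cs_d_def)

lemma cs_rels_valid:
  assumes "s \<in> cs_rels G os R M act p n"
  shows "valid R (cs_gens G M p n) s"
proof -
  interpret coeff_ring R by (rule coeff_ring.intro[OF ring])
  have m: "x \<oplus>\<^bsub>M (n - Suc p)\<^esub> y \<in> carrier (M (n - Suc p))"
    if "x \<in> carrier (M (n - Suc p))" "y \<in> carrier (M (n - Suc p))" for x y
    using abelian_groupE(1)[OF abg that] .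
  show ?thesis using assms m by (auto simp: cs_rels_def cs_gens_iff)
qed

lemmas cs_rels_coefs = valid_coefs[OF cs_rels_valid]

lemma coefs_lift [simp]: "coefs R (lift l)"
  using cring.cring_simprules(6)[OF ring] by (auto simp: lift_def coefs_def)

lemma in_span_rel: "s \<in> cs_rels G os R M act p n \<Longrightarrow> in_span R (cs_rels G os R M act p n) s"
  by (rule coeff_ring.in_span_gen[OF coeff_ring.intro[OF ring] cs_rels_coefs])

text \<open>Each rule of \<open>teq\<close> is matched either with a relation in
  \<open>cs_rels\<close> or with an identity between coefficient functions.\<close>

lemma teq_imp_cs_eq:
  assumes p: "Suc p \<le> n" and "tq n (Suc p) l k"
  shows "cs_eq G os R M act p n (lift l) (lift k)"
proof -
  interpret coeff_ring R by (rule coeff_ring.intro[OF ring])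
  interpret I: ind_mod "G n" "G (n - Suc p)" "M (n - Suc p)" "\<lambda>h. os (n - Suc p) (Suc p) h (e (Suc p))" "ga (n - Suc p)"
    by (rule level_ind_mod[OF p])
  let ?T = "cs_rels G os R M act p n"
  let ?S = "cs_gens G M p n"
  note sp = in_span_append[OF cs_rels_coefs] in_span_coneg[OF cs_rels_coefs]
  have cs: "cs_eq G os R M act p n L L' \<longleftrightarrow> in_span R ?T (L @ coneg R L')" for L L'
    by (simp add: cs_eq_def coneg_def)
  show ?thesis using assms(2) unfolding cs
  proof (induction rule: I.teq.induct)
    case (refl l)
    have "fs R [] = fs R (lift l @ coneg R (lift l))" by (auto simp: r_neg)
    then show ?case by (metis in_span_cong in_span_Nil)
  next
    case (sym l k)
    have "fs R (lift k @ coneg R (lift l)) = fs R (coneg R (lift l @ coneg R (lift k)))"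
      by (auto simp: minus_add a_comm)
    moreover have "in_span R ?T (coneg R (lift l @ coneg R (lift k)))"
      by (rule sp(2)) (use sym.IH in auto)
    ultimately show ?case by (metis in_span_cong)
  next
    case (trans l k j)
    have "fs R (lift l @ coneg R (lift j)) = fs R ((lift l @ coneg R (lift k)) @ (lift k @ coneg R (lift j)))"
    proof
      fix x
      define a where "a = fs R (lift l) x"
      define c0 where "c0 = fs R (lift k) x"
      define c where "c = fs R (lift j) x"
      have "a \<in> carrier R" "c0 \<in> carrier R" "c \<in> carrier R" by (auto simp: a_def c0_def c_def)
      moreover from this have "a \<oplus>\<^bsub>R\<^esub> \<ominus>\<^bsub>R\<^esub> c = (a \<oplus>\<^bsub>R\<^esub> \<ominus>\<^bsub>R\<^esub> c0) \<oplus>\<^bsub>R\<^esub> (c0 \<oplus>\<^bsub>R\<^esub> \<ominus>\<^bsub>R\<^esub> c)" by algebra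
      ultimately show "fs R (lift l @ coneg R (lift j)) x = fs R ((lift l @ coneg R (lift k)) @ (lift k @ coneg R (lift j))) x"
        by (simp add: a_def c0_def c_def a_assoc)
    qed
    moreover have "in_span R ?T ((lift l @ coneg R (lift k)) @ (lift k @ coneg R (lift j)))"
      by (rule sp(1)) (use trans.IH in auto)
    ultimately show ?case by (metis in_span_cong)
  next
    case (append l l' k k')
    have li: "lift (x @ y) = lift x @ lift y" for x y by (simp add: lift_def)
    have "fs R (lift (l @ k) @ coneg R (lift (l' @ k'))) = fs R ((lift l @ coneg R (lift l')) @ (lift k @ coneg R (lift k')))"
    proof
      fix x
      define a where "a = fs R (lift l) x"
      define a' where "a' = fs R (lift l') x"
      define c where "c = fs R (lift k) x"
      define c' where "c' = fs R (lift k') x"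
      have "a \<in> carrier R" "a' \<in> carrier R" "c \<in> carrier R" "c' \<in> carrier R"
        by (auto simp: a_def a'_def c_def c'_def)
      moreover from this have "(a \<oplus>\<^bsub>R\<^esub> c) \<oplus>\<^bsub>R\<^esub> \<ominus>\<^bsub>R\<^esub> (a' \<oplus>\<^bsub>R\<^esub> c') = (a \<oplus>\<^bsub>R\<^esub> \<ominus>\<^bsub>R\<^esub> a') \<oplus>\<^bsub>R\<^esub> (c \<oplus>\<^bsub>R\<^esub> \<ominus>\<^bsub>R\<^esub> c')" by algebra
      ultimately show "fs R (lift (l @ k) @ coneg R (lift (l' @ k'))) x = fs R ((lift l @ coneg R (lift l')) @ (lift k @ coneg R (lift k'))) x"
        by (simp only: li fs_append fs_coneg coefs_simps(3) coefs_coneg coefs_lift a_def a'_def c_def c'_def simp_thms)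
    qed
    moreover have "in_span R ?T ((lift l @ coneg R (lift l')) @ (lift k @ coneg R (lift k')))"
      by (rule sp(1)) (use append.IH in auto)
    ultimately show ?case by (metis in_span_cong)
  next
    case (comm l k)
    have li: "lift (x @ y) = lift x @ lift y" for x y by (simp add: lift_def)
    have "fs R (lift (l @ k) @ coneg R (lift (k @ l))) = fs R []"
    proof
      fix x
      have c: "fs R (lift l) x \<in> carrier R" "fs R (lift k) x \<in> carrier R" by auto
      then have "(fs R (lift l) x \<oplus>\<^bsub>R\<^esub> fs R (lift k) x) \<oplus>\<^bsub>R\<^esub> \<ominus>\<^bsub>R\<^esub> (fs R (lift k) x \<oplus>\<^bsub>R\<^esub> fs R (lift l) x) = \<zero>\<^bsub>R\<^esub>" by algebra
      then show "fs R (lift (l @ k) @ coneg R (lift (k @ l))) x = fs R [] x"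
        by (simp only: li fs_append fs_coneg coefs_simps(3) coefs_coneg coefs_lift simp_thms fs_Nil)
    qed
    then show ?case by (metis in_span_cong in_span_Nil)
  next
    \<comment> \<open>No relation in \<open>cs_rels\<close> is stated for a zero entry; the scalar
      relation with r = 0 supplies it.\<close>
    case (zero g)
    let ?z = "\<zero>\<^bsub>M (n - Suc p)\<^esub>"
    have g: "(g, ?z) \<in> ?S" using zero p by (simp add: cs_gens_iff abelian_groupE(2))
    have z: "\<zero>\<^bsub>R\<^esub> \<odot>\<^bsub>M (n - Suc p)\<^esub> ?z = ?z"
      using module.smult_l_null[OF mod] by (simp add: abelian_groupE(2))
    have "[(\<one>\<^bsub>R\<^esub>, g, \<zero>\<^bsub>R\<^esub> \<odot>\<^bsub>M (n - Suc p)\<^esub> ?z), (\<ominus>\<^bsub>R\<^esub> \<zero>\<^bsub>R\<^esub>, g, ?z)] \<in> ?T"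
      unfolding cs_rels_def using g by (intro UnI1 UnI2) (auto intro!: exI)
    then have "in_span R ?T [(\<one>\<^bsub>R\<^esub>, g, ?z), (\<ominus>\<^bsub>R\<^esub> \<zero>\<^bsub>R\<^esub>, g, ?z)]" unfolding z by (rule in_span_rel)
    moreover have "fs R [(\<one>\<^bsub>R\<^esub>, g, ?z), (\<ominus>\<^bsub>R\<^esub> \<zero>\<^bsub>R\<^esub>, g, ?z)] = fs R (lift [(g, ?z)] @ coneg R (lift []))"
      by (auto simp: lift_def coneg_def fs_Cons)
    ultimately show ?case by (metis in_span_cong)
  next
    case (add g x y)
    have "lift [(g, x \<oplus>\<^bsub>M (n - Suc p)\<^esub> y)] @ coneg R (lift [(g, x), (g, y)]) \<in> ?T"
      unfolding cs_rels_def using add p by (intro UnI1) (auto simp: lift_def coneg_def cs_gens_iff intro!: exI)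
    then show ?case by (rule in_span_rel)
  next
    case (act g h x)
    have "lift [(g \<otimes>\<^bsub>G n\<^esub> os (n - Suc p) (Suc p) h (e (Suc p)), x)] @ coneg R (lift [(g, ga (n - Suc p) h x)]) \<in> ?T"
      unfolding cs_rels_def using act p by (intro UnI2) (auto simp: lift_def coneg_def cs_gens_iff intro!: exI)
    then show ?case by (rule in_span_rel)
  qed
qed

text \<open>One scalar relation per term, summed over the list.\<close>

lemma cs_eq_lift_strip:
  assumes p: "Suc p \<le> n" and L: "valid R (cs_gens G M p n) L"
  shows "cs_eq G os R M act p n L (lift (strip (n - Suc p) L))"
    "cs_eq G os R M act p n (lift (strip (n - Suc p) L)) L"
proof -
  interpret coeff_ring R by (rule coeff_ring.intro[OF ring])
  let ?T = "cs_rels G os R M act p n"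
  let ?S = "cs_gens G M p n"
  let ?l = "\<lambda>L. lift (strip (n - Suc p) L)"
  have cs: "cs_eq G os R M act p n L L' \<longleftrightarrow> in_span R ?T (L @ coneg R L')" for L L'
    by (simp add: cs_eq_def coneg_def)
  have vl: "coefs R (?l L)" for L by simp
  have "in_span R ?T (?l L @ coneg R L)" using L
  proof (induction L)
    case Nil
    show ?case using in_span_Nil by (simp add: lift_def strip_def coneg_def)
  next
    case (Cons c L)
    obtain r g x where c: "c = (r, g, x)" by (cases c)
    have v: "r \<in> carrier R" "(g, x) \<in> ?S" "valid R ?S L" using Cons.prems c by auto
    have "[(\<one>\<^bsub>R\<^esub>, g, r \<odot>\<^bsub>M (n - Suc p)\<^esub> x), (\<ominus>\<^bsub>R\<^esub> r, g, x)] \<in> ?T"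
      unfolding cs_rels_def using v by (intro UnI1 UnI2) (auto intro!: exI)
    then have 1: "in_span R ?T (?l [c] @ coneg R [c])"
      using in_span_rel by (simp add: c lift_def strip_def coneg_def)
    have v1: "coefs R [c]" "coefs R L" using v c valid_coefs by auto
    have li: "?l (c # L) = ?l [c] @ ?l L" "coneg R (c # L) = coneg R [c] @ coneg R L"
      by (simp_all add: lift_def strip_def coneg_def)
    have "fs R (?l (c # L) @ coneg R (c # L)) = fs R ((?l [c] @ coneg R [c]) @ (?l L @ coneg R L))"
    proof
      fix z
      define a where "a = fs R (?l [c]) z"
      define a' where "a' = fs R [c] z"
      define d where "d = fs R (?l L) z"
      define d' where "d' = fs R L z"
      have "a \<in> carrier R" "a' \<in> carrier R" "d \<in> carrier R" "d' \<in> carrier R"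
        using fs_closed[OF vl] fs_closed[OF v1(1)] fs_closed[OF v1(2)]
        by (auto simp only: a_def a'_def d_def d'_def)
      moreover from this have "(a \<oplus>\<^bsub>R\<^esub> d) \<oplus>\<^bsub>R\<^esub> (\<ominus>\<^bsub>R\<^esub> a' \<oplus>\<^bsub>R\<^esub> \<ominus>\<^bsub>R\<^esub> d') = (a \<oplus>\<^bsub>R\<^esub> \<ominus>\<^bsub>R\<^esub> a') \<oplus>\<^bsub>R\<^esub> (d \<oplus>\<^bsub>R\<^esub> \<ominus>\<^bsub>R\<^esub> d')" by algebra
      ultimately show "fs R (?l (c # L) @ coneg R (c # L)) z = fs R ((?l [c] @ coneg R [c]) @ (?l L @ coneg R L)) z"
        unfolding li using vl v1
        by (simp only: fs_append fs_coneg coefs_simps(3) coefs_coneg a_def a'_def d_def d'_def simp_thms)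
    qed
    moreover have "in_span R ?T ((?l [c] @ coneg R [c]) @ (?l L @ coneg R L))"
      by (rule in_span_append[OF cs_rels_coefs 1 Cons.IH[OF v(3)]])
        (use vl v1 in auto)
    ultimately show ?case by (metis in_span_cong)
  qed
  then show "cs_eq G os R M act p n (?l L) L" unfolding cs .
  have "in_span R ?T (coneg R (?l L @ coneg R L))"
    by (rule in_span_coneg[OF cs_rels_coefs \<open>in_span R ?T (?l L @ coneg R L)\<close>]) (use valid_coefs[OF L] vl in auto)
  moreover have "fs R (coneg R (?l L @ coneg R L)) = fs R (L @ coneg R (?l L))"
    using valid_coefs[OF L] by (auto simp: minus_add a_comm)
  ultimately show "cs_eq G os R M act p n L (?l L)" unfolding cs by (metis in_span_cong)
qed

lemma cs_eq_trans:
  assumes "cs_eq G os R M act p n L L'" "cs_eq G os R M act p n L' L''"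
    "valid R (cs_gens G M p n) L" "valid R (cs_gens G M p n) L'" "valid R (cs_gens G M p n) L''"
  shows "cs_eq G os R M act p n L L''"
proof -
  note vc = assms(3-5)[THEN valid_coefs]
  interpret coeff_ring R by (rule coeff_ring.intro[OF ring])
  let ?T = "cs_rels G os R M act p n"
  have cs: "cs_eq G os R M act p n L L' \<longleftrightarrow> in_span R ?T (L @ coneg R L')" for L L'
    by (simp add: cs_eq_def coneg_def)
  have "fs R (L @ coneg R L'') = fs R ((L @ coneg R L') @ (L' @ coneg R L''))"
  proof
    fix x
    define a where "a = fs R L x"
    define c0 where "c0 = fs R L' x"
    define c where "c = fs R L'' x"
    have "a \<in> carrier R" "c0 \<in> carrier R" "c \<in> carrier R" using vc by (auto simp: a_def c0_def c_def)
    moreover from this have "a \<oplus>\<^bsub>R\<^esub> \<ominus>\<^bsub>R\<^esub> c = (a \<oplus>\<^bsub>R\<^esub> \<ominus>\<^bsub>R\<^esub> c0) \<oplus>\<^bsub>R\<^esub> (c0 \<oplus>\<^bsub>R\<^esub> \<ominus>\<^bsub>R\<^esub> c)" by algebra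
    ultimately show "fs R (L @ coneg R L'') x = fs R ((L @ coneg R L') @ (L' @ coneg R L'')) x"
      using vc by (simp add: a_def c0_def c_def a_assoc)
  qed
  moreover have "in_span R ?T ((L @ coneg R L') @ (L' @ coneg R L''))"
    by (rule in_span_append[OF cs_rels_coefs]) (use assms(1,2) vc cs in auto)
  ultimately show ?thesis unfolding cs by (metis in_span_cong)
qed

text \<open>From right to left the rules translate directly. Conversely, each coordinate
  \<open>ev g\<close> extends to a linear map on formal combinations that kills all of
  \<open>cs_rels\<close>; so equivalent combinations have equal coordinates, and these determine the
  chain.\<close>

lemma cs_eq_iff_tq:
  assumes p: "Suc p \<le> n" and L: "valid R (cs_gens G M p n) L" and L': "valid R (cs_gens G M p n) L'"
  shows "cs_eq G os R M act p n L L' \<longleftrightarrow> tq n (Suc p) (strip (n - Suc p) L) (strip (n - Suc p) L')"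
proof
  let ?S = "cs_gens G M p n"
  assume "tq n (Suc p) (strip (n - Suc p) L) (strip (n - Suc p) L')"
  then have "cs_eq G os R M act p n (lift (strip (n - Suc p) L)) (lift (strip (n - Suc p) L'))"
    by (rule teq_imp_cs_eq[OF p])
  then show "cs_eq G os R M act p n L L'"
    using cs_eq_lift_strip[OF p] cs_eq_trans L L' strip_Ch valid_lift by meson
next
  let ?S = "cs_gens G M p n"
  let ?T = "cs_rels G os R M act p n"
  let ?m = "n - Suc p"
  assume "cs_eq G os R M act p n L L'"
  then have sp: "in_span R ?T (L @ coneg R L')" by (simp add: cs_eq_def coneg_def)
  interpret coeff_module R "M ?m" by (rule coeff_module.intro[OF coeff_ring.intro[OF ring] mod])
  interpret I: ind_mod "G n" "G ?m" "M ?m" "\<lambda>h. os ?m (Suc p) h (e (Suc p))" "ga ?m"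
    by (rule level_ind_mod[OF p])
  have "I.ev g (strip ?m L) = I.ev g (strip ?m L')" if g: "g \<in> carrier (G n)" for g
  proof -
    define f where "f = (\<lambda>(g', x). I.ev1 g g' x)"
    have fc: "f k \<in> carrier (M ?m)" if "k \<in> ?S" for k
      using that g by (cases k) (auto simp: f_def cs_gens_iff I.ev1_closed)
    have ga_smult: "ga ?m h (r \<odot>\<^bsub>M ?m\<^esub> x) = r \<odot>\<^bsub>M ?m\<^esub> ga ?m h x"
      if "h \<in> carrier (G ?m)" "r \<in> carrier R" "x \<in> carrier (M ?m)" for h r x
      using that by (simp add: ga_cos act_smult)
    have fr: "I.ev1 g g' (r \<odot>\<^bsub>M ?m\<^esub> x) = r \<odot>\<^bsub>M ?m\<^esub> f (g', x)"
      if "r \<in> carrier R" "(g', x) \<in> ?S" for r g' x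
    proof -
      have gx: "g' \<in> carrier (G n)" "x \<in> carrier (M ?m)" using that by (auto simp: cs_gens_iff)
      show ?thesis
        by (rule I.ev1_cases[OF gx(1) g]) (use that(1) gx in \<open>simp_all add: f_def ga_smult\<close>)
    qed
    have lin: "I.ev g (strip ?m K) = lin (M ?m) f K" if "valid R ?S K" for K
      using that by (induction K) (auto simp: strip_def fr)
    have rel: "lin (M ?m) f s = \<zero>\<^bsub>M ?m\<^esub>" if s: "s \<in> ?T" for s
    proof -
      have sc: "strip ?m s \<in> I.chains" using strip_Ch cs_rels_valid[OF s] chains_eq[OF p] by simp
      have "I.ev g (strip ?m s) = \<zero>\<^bsub>M ?m\<^esub>"
      proof -
        consider (1) g1 x y where "s = [(\<one>\<^bsub>R\<^esub>, g1, x \<oplus>\<^bsub>M ?m\<^esub> y), (\<ominus>\<^bsub>R\<^esub> \<one>\<^bsub>R\<^esub>, g1, x), (\<ominus>\<^bsub>R\<^esub> \<one>\<^bsub>R\<^esub>, g1, y)]"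
            "g1 \<in> carrier (G n)" "x \<in> carrier (M ?m)" "y \<in> carrier (M ?m)"
          | (2) g1 x r where "s = [(\<one>\<^bsub>R\<^esub>, g1, r \<odot>\<^bsub>M ?m\<^esub> x), (\<ominus>\<^bsub>R\<^esub> r, g1, x)]"
            "g1 \<in> carrier (G n)" "x \<in> carrier (M ?m)" "r \<in> carrier R"
          | (3) g1 h x where "s = [(\<one>\<^bsub>R\<^esub>, g1 \<otimes>\<^bsub>G n\<^esub> os ?m (Suc p) h (e (Suc p)), x), (\<ominus>\<^bsub>R\<^esub> \<one>\<^bsub>R\<^esub>, g1, ga ?m h x)]"
            "g1 \<in> carrier (G n)" "x \<in> carrier (M ?m)" "h \<in> carrier (G ?m)"
          using s by (auto simp: cs_rels_def cs_gens_iff)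
        then show ?thesis
        proof cases
          case 1
          have "strip ?m s = [(g1, x \<oplus>\<^bsub>M ?m\<^esub> y)] @ I.neg [(g1, x), (g1, y)]"
            using 1 by (simp add: strip_def I.neg_def smult_l_minus)
          moreover have "I.teq ([(g1, x \<oplus>\<^bsub>M ?m\<^esub> y)] @ I.neg [(g1, x), (g1, y)]) []"
            using I.teq_diff[of "[(g1, x \<oplus>\<^bsub>M ?m\<^esub> y)]" "[(g1, x), (g1, y)]"] I.add 1 by simp
          ultimately show ?thesis using I.teq_sound[OF _ g] by fastforce
        next
          case 2
          have "strip ?m s = [(g1, r \<odot>\<^bsub>M ?m\<^esub> x)] @ I.neg [(g1, r \<odot>\<^bsub>M ?m\<^esub> x)]"
            using 2 by (simp add: strip_def I.neg_def smult_l_minus)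
          moreover have "I.teq ([(g1, r \<odot>\<^bsub>M ?m\<^esub> x)] @ I.neg [(g1, r \<odot>\<^bsub>M ?m\<^esub> x)]) []"
            using 2 by (intro I.teq_neg) simp
          ultimately show ?thesis using I.teq_sound[OF _ g] by fastforce
        next
          case 3
          have a: "os ?m (Suc p) h (e (Suc p)) \<in> carrier (G n)" using 3 p by simp
          have "strip ?m s = [(g1 \<otimes>\<^bsub>G n\<^esub> os ?m (Suc p) h (e (Suc p)), x)] @ I.neg [(g1, ga ?m h x)]"
            using 3 by (simp add: strip_def I.neg_def smult_l_minus)
          moreover have "I.teq ([(g1 \<otimes>\<^bsub>G n\<^esub> os ?m (Suc p) h (e (Suc p)), x)] @ I.neg [(g1, ga ?m h x)]) []"
            using I.teq_diff[of "[(g1 \<otimes>\<^bsub>G n\<^esub> os ?m (Suc p) h (e (Suc p)), x)]" "[(g1, ga ?m h x)]"]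
              I.act[of g1 h x] 3 a by simp
          ultimately show ?thesis using I.teq_sound[OF _ g] by fastforce
        qed
      qed
      then show ?thesis using lin cs_rels_valid[OF s] by simp
    qed
    have "lin (M ?m) f (L @ coneg R L') = \<zero>\<^bsub>M ?m\<^esub>"
      by (rule lin_in_span[OF sp, of ?S]) (use L L' cs_rels_valid fc rel in auto)
    moreover have "lin (M ?m) f (L @ coneg R L') = lin (M ?m) f L \<oplus>\<^bsub>M ?m\<^esub> \<ominus>\<^bsub>M ?m\<^esub> lin (M ?m) f L'"
      using lin_append[of ?S L "coneg R L'" f] lin_coneg[of ?S L' f] L L' fc by simp
    ultimately have "lin (M ?m) f L = lin (M ?m) f L'"
      using M.minus_equality lin_closed[of ?S _ f, OF _ fc] L L'
      by (metis M.a_inv_closed M.minus_minus M.r_neg M.add.inv_equality)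
    then show ?thesis using lin L L' by simp
  qed
  then show "tq n (Suc p) (strip ?m L) (strip ?m L')"
    using I.teq_iff_ev strip_Ch[OF L] strip_Ch[OF L'] chains_eq[OF p] by simp
qed

text \<open>The isomorphism of the tensor product of R G_n and M_n over R G_n with M_n. It
  translates between chains with no added point and elements of M_n, where \<open>cs_d0\<close>
  takes its values.\<close>

definition val :: "nat \<Rightarrow> ('g \<times> 'x) list \<Rightarrow> 'x" where
  "val n l = foldr (\<lambda>(g, x) s. ga n g x \<oplus>\<^bsub>M n\<^esub> s) l \<zero>\<^bsub>M n\<^esub>"

lemma val_closed: "l \<in> Ch n 0 \<Longrightarrow> val n l \<in> carrier (M n)"
  by (induction l) (auto simp: val_def abelian_groupE(1,2))

lemma tq_0_iff:
  assumes "l \<in> Ch n 0" "k \<in> Ch n 0"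
  shows "tq n 0 l k \<longleftrightarrow> val n l = val n k"
proof -
  interpret I: ind_mod "G n" "G n" "M n" "\<lambda>h. os n 0 h (e 0)" "ga n"
    using level_ind_mod[of 0 n] by simp
  have T: "tq n 0 = I.teq" by simp
  have v: "I.ev (e n) l = val n l" if "l \<in> Ch n 0" for l
    using that
  proof (induction l)
    case (Cons a l)
    obtain g x where a: "a = (g, x)" by (cases a)
    have "I.ev1 (e n) g x = ga n g x" using Cons.prems a I.ev1_eq'[of g "e n" g x] by simp
    then show ?case using Cons a by (simp add: val_def)
  qed (simp add: val_def)
  have t: "I.teq l [(e n, val n l)]" if "l \<in> Ch n 0" for l
    using that
  proof (induction l)
    case Nil
    show ?case using I.sym[OF I.zero[of "e n"]] by (simp add: val_def)
  next
    case (Cons a l)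
    obtain g x where a: "a = (g, x)" by (cases a)
    have g: "g \<in> carrier (G n)" "x \<in> carrier (M n)" "l \<in> Ch n 0" using Cons.prems a by auto
    have "I.teq [(g, x)] [(e n, ga n g x)]" using I.act[of "e n" g x] g by simp
    from I.append[OF this Cons.IH[OF g(3)]]
    have "I.teq (a # l) [(e n, ga n g x), (e n, val n l)]" using a by simp
    also have "I.teq \<dots> [(e n, ga n g x \<oplus>\<^bsub>M n\<^esub> val n l)]"
      using I.sym[OF I.add[of "e n" "ga n g x" "val n l"]] g val_closed by simp
    finally show ?case using a by (simp add: val_def)
  qed
  show ?thesis unfolding T
  proof
    assume "I.teq l k"
    then show "val n l = val n k" using I.teq_sound[of l k "e n"] v assms by simp
  next
    assume "val n l = val n k"
    then show "I.teq l k" using t[OF assms(1)] I.sym[OF t[OF assms(2)]] I.trans by simp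
  qed
qed

text \<open>The only face in this degree is built from \<open>b 1 0\<close> and hence
  trivial.\<close>

lemma cs_d0_val:
  assumes "valid R (cs_gens G M 0 n) L"
  shows "cs_d0 G os b M act n L = val n (bd n 0 (strip (n - Suc 0) L))"
  using assms
proof (induction L)
  case Nil
  show ?case by (simp add: cs_d0_def val_def strip_def)
next
  case (Cons c L)
  obtain r g x where c: "c = (r, g, x)" by (cases c)
  have q: "n = Suc (n - Suc 0)" and x: "r \<in> carrier R" "x \<in> carrier (M (n - Suc 0))" "g \<in> carrier (G n)"
    using Cons.prems c by (auto simp: cs_gens_iff)
  have sx: "sig (n - Suc 0) x \<in> carrier (M n)" using sig_closed[OF x(2)] q by simp
  have f: "cs_face G os b 0 n 0 = e n"
    using q by (simp add: cs_face_def b_zero_right)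
  have "sig (n - Suc 0) (r \<odot>\<^bsub>M (n - Suc 0)\<^esub> x) = r \<odot>\<^bsub>M n\<^esub> sig (n - Suc 0) x"
    using sig_smult[OF x(2,1)] q by simp
  then have "bd n 0 (strip (n - Suc 0) (c # L)) = (g, r \<odot>\<^bsub>M n\<^esub> sig (n - Suc 0) x) # bd n 0 (strip (n - Suc 0) L)"
    using x f by (simp add: c strip_def bd_def multi_map_def sg_def)
  moreover have "ga n g (r \<odot>\<^bsub>M n\<^esub> sig (n - Suc 0) x) = r \<odot>\<^bsub>M n\<^esub> ga n g (sig (n - Suc 0) x)"
    using sx x by (simp add: ga_cos act_smult)
  moreover have "cs_d0 G os b M act n (c # L) = r \<odot>\<^bsub>M n\<^esub> ga n g (sig (n - Suc 0) x) \<oplus>\<^bsub>M n\<^esub> cs_d0 G os b M act n L"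
    by (simp add: c cs_d0_def)
  ultimately show ?case using Cons c by (simp add: val_def)
qed

lemma boundary_iff:
  assumes p: "Suc p \<le> n" and L: "valid R (cs_gens G M p n) L"
  shows "(\<exists>L'. valid R (cs_gens G M (Suc p) n) L' \<and> cs_eq G os R M act p n (cs_d G os b R act (Suc p) n L') L)
    \<longleftrightarrow> (\<exists>l'\<in>Ch n (Suc (Suc p)). tq n (Suc p) (bd n (Suc p) l') (strip (n - Suc p) L))"
proof
  assume "\<exists>L'. valid R (cs_gens G M (Suc p) n) L' \<and> cs_eq G os R M act p n (cs_d G os b R act (Suc p) n L') L"
  then obtain L' where L': "valid R (cs_gens G M (Suc p) n) L'" "cs_eq G os R M act p n (cs_d G os b R act (Suc p) n L') L"
    by blast
  then have "tq n (Suc p) (bd n (Suc p) (strip (n - Suc (Suc p)) L')) (strip (n - Suc p) L)"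
    using cs_eq_iff_tq[OF p cs_d_valid L] strip_cs_d by simp
  then show "\<exists>l'\<in>Ch n (Suc (Suc p)). tq n (Suc p) (bd n (Suc p) l') (strip (n - Suc p) L)"
    using strip_Ch[OF L'(1)] by blast
next
  assume "\<exists>l'\<in>Ch n (Suc (Suc p)). tq n (Suc p) (bd n (Suc p) l') (strip (n - Suc p) L)"
  then obtain l' where l': "l' \<in> Ch n (Suc (Suc p))" "tq n (Suc p) (bd n (Suc p) l') (strip (n - Suc p) L)" by blast
  have v: "valid R (cs_gens G M (Suc p) n) (lift l')" using valid_lift l' by blast
  have "cs_eq G os R M act p n (cs_d G os b R act (Suc p) n (lift l')) L"
    using cs_eq_iff_tq[OF p cs_d_valid[OF v] L] strip_cs_d[OF v] strip_lift[OF l'(1)] l'(2) by simp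
  then show "\<exists>L'. valid R (cs_gens G M (Suc p) n) L' \<and> cs_eq G os R M act p n (cs_d G os b R act (Suc p) n L') L"
    using v by blast
qed

text \<open>The low degrees are treated separately in \<open>cs_homology_vanishes\<close>; on chains
  all cases become one condition, since equality in M_n is \<open>tq n 0\<close> under
  \<open>val\<close>.\<close>

theorem cs_homology_vanishes_iff:
  "cs_homology_vanishes G os b R M act (int q - 1) n \<longleftrightarrow> exact_at n q"
proof (cases q)
  case 0
  have "exact_at n 0 \<longleftrightarrow> (\<forall>l\<in>Ch n 0. \<exists>l'\<in>Ch n (Suc 0). val n (bd n 0 l') = val n l)"
    using tq_0_iff bd_Ch by (auto simp: exact_at_def)
  also have "\<dots> \<longleftrightarrow> (\<forall>x\<in>carrier (M n). \<exists>l'\<in>Ch n (Suc 0). val n (bd n 0 l') = x)"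
  proof (intro iffI ballI)
    fix x assume a: "\<forall>l\<in>Ch n 0. \<exists>l'\<in>Ch n (Suc 0). val n (bd n 0 l') = val n l" and x: "x \<in> carrier (M n)"
    have "val n [(e n, x)] = x" using x act_uid[of x n]
      by (simp add: val_def ga_cos uid_cos abelian_monoid.r_zero[OF abelian_group.axioms(1)[OF abg]])
    then show "\<exists>l'\<in>Ch n (Suc 0). val n (bd n 0 l') = x" using a x by (metis Ch_Cons Ch_Nil diff_zero grp_simps(4) le0)
  qed (use val_closed in blast)
  also have "\<dots> \<longleftrightarrow> (\<forall>x\<in>carrier (M n). \<exists>L. valid R (cs_gens G M 0 n) L \<and> cs_d0 G os b M act n L = x)"
  proof (intro ball_cong HOL.refl iffI)
    fix x assume "\<exists>l'\<in>Ch n (Suc 0). val n (bd n 0 l') = x"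
    then obtain l' where l': "l' \<in> Ch n (Suc 0)" "val n (bd n 0 l') = x" by blast
    then show "\<exists>L. valid R (cs_gens G M 0 n) L \<and> cs_d0 G os b M act n L = x"
      using valid_lift[OF l'(1)] cs_d0_val[of n "lift l'"] strip_lift[OF l'(1)] by auto
  next
    fix x assume "\<exists>L. valid R (cs_gens G M 0 n) L \<and> cs_d0 G os b M act n L = x"
    then obtain L where L: "valid R (cs_gens G M 0 n) L" "cs_d0 G os b M act n L = x" by blast
    then show "\<exists>l'\<in>Ch n (Suc 0). val n (bd n 0 l') = x" using cs_d0_val[OF L(1)] strip_Ch[OF L(1)] by auto
  qed
  finally show ?thesis using 0 by (simp add: cs_homology_vanishes_def)
next
  case (Suc p)
  show ?thesis
  proof (cases "Suc p \<le> n")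
    case False
    \<comment> \<open>There are no generators when n < q, so every cycle is the empty combination
      and both sides hold.\<close>
    have "L = []" if "valid R (cs_gens G M p n) L" for L
      using that False by (cases L) (auto simp: cs_gens_iff)
    moreover have "valid R S [] \<and> cs_eq G os R M act p n (cs_d G os b R act (Suc p) n []) []" for S
      by (simp add: cs_eq_def cs_d_def coeff_ring.in_span_Nil[OF coeff_ring.intro[OF ring]])
    ultimately have "cs_homology_vanishes G os b R M act (int q - 1) n"
      unfolding Suc cs_homology_vanishes_def by (cases p) (auto simp: nat_add_distrib intro!: exI[of _ "[]"])
    then show ?thesis using Suc False by (simp add: exact_at_def)
  next
    case p: True
    let ?cyc = "\<lambda>L. if p = 0 then cs_d0 G os b M act n L = \<zero>\<^bsub>M n\<^esub>
        else cs_eq G os R M act (p - 1) n (cs_d G os b R act p n L) []"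
    have cyc: "?cyc L \<longleftrightarrow> tq n p (bd n p (strip (n - Suc p) L)) []" if L: "valid R (cs_gens G M p n) L" for L
    proof (cases p)
      case 0
      then show ?thesis using cs_d0_val[of n L] L tq_0_iff[of "bd n 0 (strip (n - Suc 0) L)" n "[]"] bd_Ch strip_Ch[OF L]
        by (simp add: val_def)
    next
      case (Suc p')
      then show ?thesis
        using cs_eq_iff_tq[of p' n "cs_d G os b R act p n L" "[]"] p cs_d_valid[of p' n L] L strip_cs_d[OF L]
        by (simp add: strip_def)
    qed
    have "cs_homology_vanishes G os b R M act (int q - 1) n \<longleftrightarrow>
      (\<forall>L. valid R (cs_gens G M p n) L \<and> ?cyc L \<longrightarrow>
        (\<exists>L'. valid R (cs_gens G M (Suc p) n) L' \<and> cs_eq G os R M act p n (cs_d G os b R act (Suc p) n L') L))"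
      unfolding Suc cs_homology_vanishes_def by (cases p) (simp_all add: nat_add_distrib)
    also have "\<dots> \<longleftrightarrow> (\<forall>L. valid R (cs_gens G M p n) L \<and> tq n p (bd n p (strip (n - Suc p) L)) [] \<longrightarrow>
        (\<exists>l'\<in>Ch n (Suc (Suc p)). tq n (Suc p) (bd n (Suc p) l') (strip (n - Suc p) L)))"
    proof (intro arg_cong[of _ _ All] ext)
      fix L
      show "(valid R (cs_gens G M p n) L \<and> ?cyc L \<longrightarrow>
          (\<exists>L'. valid R (cs_gens G M (Suc p) n) L' \<and> cs_eq G os R M act p n (cs_d G os b R act (Suc p) n L') L))
        = (valid R (cs_gens G M p n) L \<and> tq n p (bd n p (strip (n - Suc p) L)) [] \<longrightarrow>
          (\<exists>l'\<in>Ch n (Suc (Suc p)). tq n (Suc p) (bd n (Suc p) l') (strip (n - Suc p) L)))"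
        using cyc[of L] boundary_iff[OF p, of L] by argo
    qed
    also have "\<dots> \<longleftrightarrow> exact_at n q"
    proof
      assume a: "\<forall>L. valid R (cs_gens G M p n) L \<and> tq n p (bd n p (strip (n - Suc p) L)) [] \<longrightarrow>
        (\<exists>l'\<in>Ch n (Suc (Suc p)). tq n (Suc p) (bd n (Suc p) l') (strip (n - Suc p) L))"
      have "\<exists>l'\<in>Ch n (Suc (Suc p)). tq n (Suc p) (bd n (Suc p) l') l"
        if "l \<in> Ch n (Suc p)" "tq n p (bd n p l) []" for l
        using a[rule_format, of "lift l"] strip_lift[OF that(1)] valid_lift[OF that(1)] that(2) by simp
      then show "exact_at n q" by (simp add: exact_at_def Suc)
    next
      assume "exact_at n q"
      then show "\<forall>L. valid R (cs_gens G M p n) L \<and> tq n p (bd n p (strip (n - Suc p) L)) [] \<longrightarrow>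
        (\<exists>l'\<in>Ch n (Suc (Suc p)). tq n (Suc p) (bd n (Suc p) l') (strip (n - Suc p) L))"
        using strip_Ch p by (simp add: exact_at_def Suc)
    qed
    finally show ?thesis .
  qed
qed

end

section \<open>Free modules\<close>

locale free_ug = braided_stab G os b + R: cring R
  for G :: "nat \<Rightarrow> 'g monoid" and os b and R :: "'r ring" +
  fixes J :: "'j set" and rk :: "'j \<Rightarrow> nat"
begin

declare split_paired_All [simp del]

abbreviation F :: "nat \<Rightarrow> ('r, 'j \<times> 'g set \<Rightarrow> 'r) module" where "F \<equiv> free_mod G os R J rk"
abbreviation fa :: "nat \<Rightarrow> nat \<Rightarrow> 'g set \<Rightarrow> ('j \<times> 'g set \<Rightarrow> 'r) \<Rightarrow> ('j \<times> 'g set \<Rightarrow> 'r)" where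
  "fa \<equiv> free_act G os R rk"

definition idx :: "nat \<Rightarrow> ('j \<times> 'g set) set" where
  "idx n = {(j, \<phi>). j \<in> J \<and> \<phi> \<in> UHom G os (rk j) n}"

definition supp :: "('j \<times> 'g set \<Rightarrow> 'r) \<Rightarrow> ('j \<times> 'g set) set" where
  "supp c = {x. c x \<noteq> \<zero>\<^bsub>R\<^esub>}"

definition bas :: "'r \<Rightarrow> 'j \<Rightarrow> 'g set \<Rightarrow> 'j \<times> 'g set \<Rightarrow> 'r" where
  "bas r j \<phi> = (\<lambda>x. if x = (j, \<phi>) then r else \<zero>\<^bsub>R\<^esub>)"

lemma F_carrier: "c \<in> carrier (F n) \<longleftrightarrow> (\<forall>x. c x \<in> carrier R) \<and> finite (supp c) \<and> supp c \<subseteq> idx n"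
  by (simp add: free_mod_def supp_def idx_def)

lemma F_zero: "\<zero>\<^bsub>F n\<^esub> = (\<lambda>x. \<zero>\<^bsub>R\<^esub>)"
  and F_add: "c \<oplus>\<^bsub>F n\<^esub> d = (\<lambda>x. c x \<oplus>\<^bsub>R\<^esub> d x)"
  and F_smult: "r \<odot>\<^bsub>F n\<^esub> c = (\<lambda>x. r \<otimes>\<^bsub>R\<^esub> c x)"
  by (simp_all add: free_mod_def)

lemma supp_add: "supp (\<lambda>x. c x \<oplus>\<^bsub>R\<^esub> d x) \<subseteq> supp c \<union> supp d"
  by (auto simp: supp_def)

lemma F_add_closed: "\<lbrakk>c \<in> carrier (F n); d \<in> carrier (F n)\<rbrakk> \<Longrightarrow> c \<oplus>\<^bsub>F n\<^esub> d \<in> carrier (F n)"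
  unfolding F_carrier F_add using supp_add[of c d] finite_subset[OF supp_add[of c d]] by auto

lemma F_smult_closed: "\<lbrakk>r \<in> carrier R; c \<in> carrier (F n)\<rbrakk> \<Longrightarrow> r \<odot>\<^bsub>F n\<^esub> c \<in> carrier (F n)"
proof -
  assume a: "r \<in> carrier R" "c \<in> carrier (F n)"
  then have "supp (\<lambda>x. r \<otimes>\<^bsub>R\<^esub> c x) \<subseteq> supp c" by (auto simp: supp_def)
  then show ?thesis using a finite_subset unfolding F_carrier F_smult by blast
qed

lemma F_zero_closed: "\<zero>\<^bsub>F n\<^esub> \<in> carrier (F n)"
  by (simp add: F_carrier F_zero supp_def)

lemma F_module: "module R (F n)"
proof (rule moduleI)
  show "cring R" by (rule R.is_cring)
  show "abelian_group (F n)"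
  proof (rule abelian_groupI)
    fix c assume c: "c \<in> carrier (F n)"
    show "\<zero>\<^bsub>F n\<^esub> \<oplus>\<^bsub>F n\<^esub> c = c" using c by (simp add: F_carrier F_zero F_add)
    have "supp (\<lambda>x. \<ominus>\<^bsub>R\<^esub> c x) \<subseteq> supp c" by (auto simp: supp_def)
    then have "(\<lambda>x. \<ominus>\<^bsub>R\<^esub> c x) \<in> carrier (F n)" using c finite_subset unfolding F_carrier by blast
    moreover have "(\<lambda>x. \<ominus>\<^bsub>R\<^esub> c x) \<oplus>\<^bsub>F n\<^esub> c = \<zero>\<^bsub>F n\<^esub>" using c by (simp add: F_carrier F_zero F_add R.l_neg)
    ultimately show "\<exists>d\<in>carrier (F n). d \<oplus>\<^bsub>F n\<^esub> c = \<zero>\<^bsub>F n\<^esub>" by blast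
  next
    fix x y assume "x \<in> carrier (F n)" "y \<in> carrier (F n)"
    then show "x \<oplus>\<^bsub>F n\<^esub> y = y \<oplus>\<^bsub>F n\<^esub> x" by (simp add: F_carrier F_add R.a_comm)
  next
    fix x y z assume "x \<in> carrier (F n)" "y \<in> carrier (F n)" "z \<in> carrier (F n)"
    then show "x \<oplus>\<^bsub>F n\<^esub> y \<oplus>\<^bsub>F n\<^esub> z = x \<oplus>\<^bsub>F n\<^esub> (y \<oplus>\<^bsub>F n\<^esub> z)" by (simp add: F_carrier F_add R.a_assoc)
  qed (auto simp: F_add_closed F_zero_closed)
next
  fix a c d assume "a \<in> carrier R" "c \<in> carrier (F n)" "d \<in> carrier (F n)"
  then show "a \<odot>\<^bsub>F n\<^esub> (c \<oplus>\<^bsub>F n\<^esub> d) = a \<odot>\<^bsub>F n\<^esub> c \<oplus>\<^bsub>F n\<^esub> a \<odot>\<^bsub>F n\<^esub> d"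
    by (simp add: F_carrier F_add F_smult R.r_distr)
next
  fix a a' c assume a: "a \<in> carrier R" "a' \<in> carrier R" "c \<in> carrier (F n)"
  show "(a \<oplus>\<^bsub>R\<^esub> a') \<odot>\<^bsub>F n\<^esub> c = a \<odot>\<^bsub>F n\<^esub> c \<oplus>\<^bsub>F n\<^esub> a' \<odot>\<^bsub>F n\<^esub> c"
    using a by (simp add: F_carrier F_add F_smult R.l_distr)
  show "(a \<otimes>\<^bsub>R\<^esub> a') \<odot>\<^bsub>F n\<^esub> c = a \<odot>\<^bsub>F n\<^esub> (a' \<odot>\<^bsub>F n\<^esub> c)"
    using a by (simp add: F_carrier F_smult R.m_assoc)
next
  fix c assume "c \<in> carrier (F n)"
  then show "\<one>\<^bsub>R\<^esub> \<odot>\<^bsub>F n\<^esub> c = c" by (simp add: F_carrier F_smult)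
qed (rule F_smult_closed)

lemma bas_closed [simp]: "\<lbrakk>r \<in> carrier R; j \<in> J; \<phi> \<in> UHom G os (rk j) n\<rbrakk> \<Longrightarrow> bas r j \<phi> \<in> carrier (F n)"
proof -
  have "supp (bas r j \<phi>) \<subseteq> {(j, \<phi>)}" by (auto simp: supp_def bas_def)
  then show "\<lbrakk>r \<in> carrier R; j \<in> J; \<phi> \<in> UHom G os (rk j) n\<rbrakk> \<Longrightarrow> bas r j \<phi> \<in> carrier (F n)"
    using finite_subset unfolding F_carrier by (fastforce simp: bas_def idx_def)
qed

text \<open>Induction on the support, splitting off one basis element at a time; additive statements
  about free modules are thereby reduced to the elements \<open>bas r j \<phi>\<close>.\<close>

lemma F_induct [consumes 1, case_names zero bas add]:
  assumes "c \<in> carrier (F n)" and zero: "P \<zero>\<^bsub>F n\<^esub>"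
    and bas: "\<And>r j \<phi>. \<lbrakk>r \<in> carrier R; j \<in> J; \<phi> \<in> UHom G os (rk j) n\<rbrakk> \<Longrightarrow> P (bas r j \<phi>)"
    and add: "\<And>c d. \<lbrakk>c \<in> carrier (F n); d \<in> carrier (F n); P c; P d\<rbrakk> \<Longrightarrow> P (c \<oplus>\<^bsub>F n\<^esub> d)"
  shows "P c"
proof -
  have "\<forall>c. c \<in> carrier (F n) \<and> supp c \<subseteq> S \<longrightarrow> P c" if "finite S" for S
    using that
  proof (induction S)
    case empty
    show ?case
    proof (intro allI impI)
      fix c assume "c \<in> carrier (F n) \<and> supp c \<subseteq> {}"
      then have "c = \<zero>\<^bsub>F n\<^esub>" by (auto simp: F_zero supp_def)
      then show "P c" using zero by simp
    qed
  next
    case (insert x S)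
    show ?case
    proof (intro allI impI)
      fix c assume c: "c \<in> carrier (F n) \<and> supp c \<subseteq> insert x S"
      show "P c"
      proof (cases "c x = \<zero>\<^bsub>R\<^esub>")
        case True
        then have "supp c \<subseteq> S" using c by (auto simp: supp_def)
        then show ?thesis using insert.IH c by blast
      next
        case False
        obtain j \<phi> where x: "x = (j, \<phi>)" by (cases x)
        have "x \<in> supp c" using False by (simp add: supp_def)
        then have j: "j \<in> J" "\<phi> \<in> UHom G os (rk j) n" "c x \<in> carrier R" using c x by (auto simp: F_carrier idx_def)
        let ?d = "\<lambda>y. if y = x then \<zero>\<^bsub>R\<^esub> else c y"
        have sd: "supp ?d = supp c - {x}" by (auto simp: supp_def)
        have d: "?d \<in> carrier (F n)" unfolding F_carrier sd using c by (auto simp: F_carrier)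
        have "supp ?d \<subseteq> S" unfolding sd using c by auto
        then have "P ?d" using insert.IH d by blast
        moreover have "c = bas (c x) j \<phi> \<oplus>\<^bsub>F n\<^esub> ?d" using c x by (auto simp: F_add bas_def F_carrier)
        ultimately show ?thesis using add[OF bas_closed[OF j(3,1,2)] d bas[OF j(3,1,2)]] by metis
      qed
    qed
  qed
  then show ?thesis using assms(1) unfolding F_carrier by blast
qed

text \<open>The index set in \<open>free_act\<close> depends on the support of \<open>c\<close>, so
  the sums for two elements and for their sum run over different sets; padding with zeros to a
  common finite \<open>T\<close> makes additivity visible.\<close>

lemma fa_alt:
  assumes "c \<in> carrier (F s)" "finite T" "{\<phi>. c (j, \<phi>) \<noteq> \<zero>\<^bsub>R\<^esub>} \<subseteq> T"
  shows "fa s t \<psi> c (j, \<phi>') = (\<Oplus>\<^bsub>R\<^esub>\<phi>\<in>T. if ucomp G os (rk j) s t \<psi> \<phi> = \<phi>' then c (j, \<phi>) else \<zero>\<^bsub>R\<^esub>)"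
  unfolding free_act_def case_prod_conv
proof (rule R.add.finprod_mono_neutral_cong_left)
  have "\<phi> \<in> UHom G os (rk j) s" if "c (j, \<phi>) \<noteq> \<zero>\<^bsub>R\<^esub>" for \<phi>
    using that assms(1) by (auto simp: F_carrier supp_def idx_def)
  then show "\<And>i. i \<in> T - {\<phi> \<in> UHom G os (rk j) s. c (j, \<phi>) \<noteq> \<zero>\<^bsub>R\<^esub> \<and> ucomp G os (rk j) s t \<psi> \<phi> = \<phi>'} \<Longrightarrow>
    (if ucomp G os (rk j) s t \<psi> i = \<phi>' then c (j, i) else \<zero>\<^bsub>R\<^esub>) = \<zero>\<^bsub>R\<^esub>" by auto
qed (use assms in \<open>auto simp: F_carrier\<close>)

lemma supp_fst_finite: "c \<in> carrier (F s) \<Longrightarrow> finite {\<phi>. c (j, \<phi>) \<noteq> \<zero>\<^bsub>R\<^esub>}"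
proof -
  assume "c \<in> carrier (F s)"
  moreover have "{\<phi>. c (j, \<phi>) \<noteq> \<zero>\<^bsub>R\<^esub>} \<subseteq> snd ` supp c" by (force simp: supp_def)
  ultimately show ?thesis using finite_subset unfolding F_carrier by blast
qed

lemma fa_add:
  assumes "c \<in> carrier (F s)" "d \<in> carrier (F s)"
  shows "fa s t \<psi> (c \<oplus>\<^bsub>F s\<^esub> d) = fa s t \<psi> c \<oplus>\<^bsub>F t\<^esub> fa s t \<psi> d"
proof
  fix y :: "'j \<times> 'g set"
  obtain j \<phi>' where y: "y = (j, \<phi>')" by (cases y)
  let ?T = "{\<phi>. c (j, \<phi>) \<noteq> \<zero>\<^bsub>R\<^esub>} \<union> {\<phi>. d (j, \<phi>) \<noteq> \<zero>\<^bsub>R\<^esub>}"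
  let ?f = "\<lambda>c \<phi>. if ucomp G os (rk j) s t \<psi> \<phi> = \<phi>' then c (j, \<phi>) else \<zero>\<^bsub>R\<^esub>"
  have T: "finite ?T" using assms supp_fst_finite by simp
  have cl: "c x \<in> carrier R" "d x \<in> carrier R" for x using assms by (auto simp: F_carrier)
  have "{\<phi>. (c \<oplus>\<^bsub>F s\<^esub> d) (j, \<phi>) \<noteq> \<zero>\<^bsub>R\<^esub>} \<subseteq> ?T" by (auto simp: F_add)
  then have "fa s t \<psi> (c \<oplus>\<^bsub>F s\<^esub> d) y = (\<Oplus>\<^bsub>R\<^esub>\<phi>\<in>?T. ?f (c \<oplus>\<^bsub>F s\<^esub> d) \<phi>)"
    unfolding y using fa_alt[OF F_add_closed[OF assms] T] by blast
  also have "\<dots> = (\<Oplus>\<^bsub>R\<^esub>\<phi>\<in>?T. ?f c \<phi> \<oplus>\<^bsub>R\<^esub> ?f d \<phi>)"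
    by (rule R.finsum_cong') (auto simp: F_add cl)
  also have "\<dots> = (\<Oplus>\<^bsub>R\<^esub>\<phi>\<in>?T. ?f c \<phi>) \<oplus>\<^bsub>R\<^esub> (\<Oplus>\<^bsub>R\<^esub>\<phi>\<in>?T. ?f d \<phi>)"
    by (rule R.finsum_addf) (auto simp: cl)
  also have "\<dots> = fa s t \<psi> c y \<oplus>\<^bsub>R\<^esub> fa s t \<psi> d y"
    unfolding y using fa_alt[OF assms(1) T] fa_alt[OF assms(2) T] by auto
  finally show "fa s t \<psi> (c \<oplus>\<^bsub>F s\<^esub> d) y = (fa s t \<psi> c \<oplus>\<^bsub>F t\<^esub> fa s t \<psi> d) y" by (simp add: F_add)
qed

lemma fa_bas:
  assumes "r \<in> carrier R" "j \<in> J" "\<phi> \<in> UHom G os (rk j) s"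
  shows "fa s t \<psi> (bas r j \<phi>) = bas r j (ucomp G os (rk j) s t \<psi> \<phi>)"
proof
  fix y :: "'j \<times> 'g set"
  obtain i \<phi>' where y: "y = (i, \<phi>')" by (cases y)
  have "{\<phi>'. bas r j \<phi> (i, \<phi>') \<noteq> \<zero>\<^bsub>R\<^esub>} \<subseteq> {\<phi>}" by (auto simp: bas_def)
  then have "fa s t \<psi> (bas r j \<phi>) y = (\<Oplus>\<^bsub>R\<^esub>\<chi>\<in>{\<phi>}. if ucomp G os (rk i) s t \<psi> \<chi> = \<phi>' then bas r j \<phi> (i, \<chi>) else \<zero>\<^bsub>R\<^esub>)"
    unfolding y by (intro fa_alt[OF bas_closed[OF assms]]) simp_all
  also have "\<dots> = bas r j (ucomp G os (rk j) s t \<psi> \<phi>) y"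
    using assms(1) by (auto simp: y bas_def)
  finally show "fa s t \<psi> (bas r j \<phi>) y = bas r j (ucomp G os (rk j) s t \<psi> \<phi>) y" .
qed

lemma fa_zero: "fa s t \<psi> \<zero>\<^bsub>F s\<^esub> = \<zero>\<^bsub>F t\<^esub>"
  by (auto simp: free_act_def F_zero)

lemma fa_closed:
  assumes "c \<in> carrier (F s)" "\<psi> \<in> UHom G os s t"
  shows "fa s t \<psi> c \<in> carrier (F t)"
  using assms(1)
proof (induction rule: F_induct)
  case zero
  then show ?case by (simp add: fa_zero F_zero_closed)
next
  case (bas r j \<phi>)
  then show ?case using assms(2) by (simp add: fa_bas ucomp_UHom)
next
  case (add c d)
  then show ?case by (simp add: fa_add F_add_closed)
qed

lemma bas_smult: "\<lbrakk>a \<in> carrier R; r \<in> carrier R\<rbrakk> \<Longrightarrow> a \<odot>\<^bsub>F n\<^esub> bas r j \<phi> = bas (a \<otimes>\<^bsub>R\<^esub> r) j \<phi>"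
  by (auto simp: F_smult bas_def)

lemma fa_smult:
  assumes "c \<in> carrier (F s)" "a \<in> carrier R" "\<psi> \<in> UHom G os s t"
  shows "fa s t \<psi> (a \<odot>\<^bsub>F s\<^esub> c) = a \<odot>\<^bsub>F t\<^esub> fa s t \<psi> c"
proof -
  interpret S: module R "F s" by (rule F_module)
  interpret T: module R "F t" by (rule F_module)
  show ?thesis using assms(1)
  proof (induction rule: F_induct)
    case zero
    then show ?case using assms(2) by (simp add: fa_zero)
  next
    case (bas r j \<phi>)
    then show ?case using assms(2) by (simp add: fa_bas bas_smult)
  next
    case (add c d)
    then show ?case using assms(2,3) by (simp add: S.smult_r_distr T.smult_r_distr fa_add fa_closed)
  qed
qed

lemma free_ug_module: "ug_module G os R F fa"
  unfolding ug_module_def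
proof (intro conjI allI impI)
  fix n show "module R (F n)" by (rule F_module)
next
  fix s t \<phi> assume "\<phi> \<in> UHom G os s t"
  then show "linear_map R (F s) (F t) (fa s t \<phi>)"
    by (simp add: linear_map_def fa_closed fa_add fa_smult)
next
  fix n c assume "c \<in> carrier (F n)"
  then show "fa n n (uid G os n) c = c"
    by (induction rule: F_induct) (auto simp: fa_zero fa_bas ucomp_uid fa_add)
next
  fix s t u \<phi> \<psi> c assume a: "\<phi> \<in> UHom G os s t \<and> \<psi> \<in> UHom G os t u \<and> c \<in> carrier (F s)"
  then have "c \<in> carrier (F s)" by simp
  then show "fa s u (ucomp G os s t u \<psi> \<phi>) c = fa t u \<psi> (fa s t \<phi> c)"
    by (induction rule: F_induct) (use a in \<open>auto simp: fa_zero fa_bas ucomp_UHom ucomp_assoc fa_add fa_closed\<close>)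
qed

sublocale FM: ugm G os b R F fa
  by unfold_locales (rule free_ug_module)

end

section \<open>The universal property of free modules\<close>

locale free_ug_map = free_ug G os b R J rk + N: ugm G os b R N nact
  for G :: "nat \<Rightarrow> 'g monoid" and os b and R :: "'r ring" and J :: "'j set" and rk
    and N :: "nat \<Rightarrow> ('r, 'y) module" and nact +
  fixes v :: "'j \<Rightarrow> 'y"
  assumes v: "j \<in> J \<Longrightarrow> v j \<in> carrier (N (rk j))"
begin

text \<open>The homomorphism given by the Yoneda lemma that sends the identity morphism in the
  summand \<open>j\<close> to \<open>v j\<close>.\<close>

definition ext :: "nat \<Rightarrow> ('j \<times> 'g set \<Rightarrow> 'r) \<Rightarrow> 'y" where
  "ext n c = (\<Oplus>\<^bsub>N n\<^esub>x\<in>supp c. c x \<odot>\<^bsub>N n\<^esub> nact (rk (fst x)) n (snd x) (v (fst x)))"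

lemma term_closed: "\<lbrakk>x \<in> idx n; r \<in> carrier R\<rbrakk> \<Longrightarrow> r \<odot>\<^bsub>N n\<^esub> nact (rk (fst x)) n (snd x) (v (fst x)) \<in> carrier (N n)"
  using v N.act_closed by (auto simp: idx_def)

lemma ext_alt:
  assumes "c \<in> carrier (F n)" "finite T" "supp c \<subseteq> T" "T \<subseteq> idx n"
  shows "ext n c = (\<Oplus>\<^bsub>N n\<^esub>x\<in>T. c x \<odot>\<^bsub>N n\<^esub> nact (rk (fst x)) n (snd x) (v (fst x)))"
proof -
  interpret module R "N n" by (rule N.mod)
  show ?thesis unfolding ext_def
  proof (rule M.add.finprod_mono_neutral_cong_left)
    fix x assume "x \<in> T - supp c"
    then have "c x = \<zero>\<^bsub>R\<^esub>" "x \<in> idx n" using assms by (auto simp: supp_def)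
    then show "c x \<odot>\<^bsub>N n\<^esub> nact (rk (fst x)) n (snd x) (v (fst x)) = \<zero>\<^bsub>N n\<^esub>"
      using v N.act_closed by (auto simp: idx_def)
  qed (use assms term_closed in \<open>auto simp: F_carrier\<close>)
qed

lemma ext_add:
  assumes "c \<in> carrier (F n)" "d \<in> carrier (F n)"
  shows "ext n (c \<oplus>\<^bsub>F n\<^esub> d) = ext n c \<oplus>\<^bsub>N n\<^esub> ext n d"
proof -
  interpret module R "N n" by (rule N.mod)
  let ?T = "supp c \<union> supp d"
  let ?w = "\<lambda>x. nact (rk (fst x)) n (snd x) (v (fst x))"
  have T: "finite ?T" "?T \<subseteq> idx n" using assms by (auto simp: F_carrier)
  have cl: "c x \<in> carrier R" "d x \<in> carrier R" for x using assms by (auto simp: F_carrier)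
  have w: "?w x \<in> carrier (N n)" if "x \<in> ?T" for x using that T v N.act_closed by (auto simp: idx_def)
  have "ext n (c \<oplus>\<^bsub>F n\<^esub> d) = (\<Oplus>\<^bsub>N n\<^esub>x\<in>?T. (c \<oplus>\<^bsub>F n\<^esub> d) x \<odot>\<^bsub>N n\<^esub> ?w x)"
    by (rule ext_alt[OF F_add_closed[OF assms] T(1) _ T(2)]) (use supp_add[of c d] in \<open>simp add: F_add\<close>)
  also have "\<dots> = (\<Oplus>\<^bsub>N n\<^esub>x\<in>?T. c x \<odot>\<^bsub>N n\<^esub> ?w x \<oplus>\<^bsub>N n\<^esub> d x \<odot>\<^bsub>N n\<^esub> ?w x)"
    by (rule M.finsum_cong') (use w cl in \<open>auto simp: F_add smult_l_distr\<close>)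
  also have "\<dots> = (\<Oplus>\<^bsub>N n\<^esub>x\<in>?T. c x \<odot>\<^bsub>N n\<^esub> ?w x) \<oplus>\<^bsub>N n\<^esub> (\<Oplus>\<^bsub>N n\<^esub>x\<in>?T. d x \<odot>\<^bsub>N n\<^esub> ?w x)"
    by (rule M.finsum_addf) (use w cl in auto)
  finally show ?thesis using ext_alt[OF assms(1) T(1) _ T(2)] ext_alt[OF assms(2) T(1) _ T(2)] by simp
qed

lemma ext_bas:
  assumes "r \<in> carrier R" "j \<in> J" "\<phi> \<in> UHom G os (rk j) n"
  shows "ext n (bas r j \<phi>) = r \<odot>\<^bsub>N n\<^esub> nact (rk j) n \<phi> (v j)"
proof -
  interpret module R "N n" by (rule N.mod)
  have "ext n (bas r j \<phi>) = (\<Oplus>\<^bsub>N n\<^esub>x\<in>{(j, \<phi>)}. bas r j \<phi> x \<odot>\<^bsub>N n\<^esub> nact (rk (fst x)) n (snd x) (v (fst x)))"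
    by (rule ext_alt[OF bas_closed[OF assms]]) (use assms in \<open>auto simp: supp_def bas_def idx_def\<close>)
  also have "\<dots> = r \<odot>\<^bsub>N n\<^esub> nact (rk j) n \<phi> (v j)"
    using assms N.act_closed v by (simp add: bas_def)
  finally show ?thesis .
qed

lemma ext_zero: "ext n \<zero>\<^bsub>F n\<^esub> = \<zero>\<^bsub>N n\<^esub>"
proof -
  interpret module R "N n" by (rule N.mod)
  show ?thesis by (simp add: ext_def F_zero supp_def)
qed

lemma ext_closed: "c \<in> carrier (F n) \<Longrightarrow> ext n c \<in> carrier (N n)"
proof (induction rule: F_induct)
  case zero
  then show ?case by (simp add: ext_zero abelian_groupE(2))
next
  case (bas r j \<phi>)
  then show ?case by (simp add: ext_bas N.act_closed v)
next
  case (add c d)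
  then show ?case by (simp add: ext_add abelian_groupE(1))
qed

lemma ext_ug_hom: "ug_hom G os R F fa N nact ext"
  unfolding ug_hom_def
proof (intro conjI allI impI)
  fix n
  interpret Nn: module R "N n" by (rule N.mod)
  interpret Fn: module R "F n" by (rule F_module)
  have "ext n (a \<odot>\<^bsub>F n\<^esub> c) = a \<odot>\<^bsub>N n\<^esub> ext n c" if a: "a \<in> carrier R" and "c \<in> carrier (F n)" for a c
    using that(2)
  proof (induction rule: F_induct)
    case zero
    then show ?case using a by (simp add: ext_zero)
  next
    case (bas r j \<phi>)
    then show ?case using a by (simp add: ext_bas bas_smult Nn.smult_assoc1 N.act_closed v)
  next
    case (add c d)
    then show ?case using a by (simp add: Fn.smult_r_distr Nn.smult_r_distr ext_add ext_closed)
  qed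
  then show "linear_map R (F n) (N n) (ext n)" by (simp add: linear_map_def ext_closed ext_add)
next
  fix s t \<phi> c assume a: "\<phi> \<in> UHom G os s t \<and> c \<in> carrier (F s)"
  then have \<phi>: "\<phi> \<in> UHom G os s t" and "c \<in> carrier (F s)" by auto
  interpret Ns: module R "N s" by (rule N.mod)
  interpret Nt: module R "N t" by (rule N.mod)
  have z: "nact s t \<phi> \<zero>\<^bsub>N s\<^esub> = \<zero>\<^bsub>N t\<^esub>"
    using N.act_add[OF \<phi>, of "\<zero>\<^bsub>N s\<^esub>" "\<zero>\<^bsub>N s\<^esub>"] N.act_closed[OF \<phi>, of "\<zero>\<^bsub>N s\<^esub>"] by simp
  show "ext t (fa s t \<phi> c) = nact s t \<phi> (ext s c)"
    using \<open>c \<in> carrier (F s)\<close>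
  proof (induction rule: F_induct)
    case zero
    then show ?case by (simp add: fa_zero ext_zero z)
  next
    case (bas r j \<psi>)
    then show ?case using \<phi>
      by (simp add: fa_bas ext_bas ucomp_UHom N.act_smult N.act_closed v N.act_ucomp)
  next
    case (add c d)
    then show ?case using \<phi> by (simp add: fa_add ext_add fa_closed ext_closed N.act_add)
  qed
qed

end

section \<open>Acyclicity of free modules\<close>

context braided_stab
begin

text \<open>Put s = n - m - q. In the complex of R Hom(m,-) the blocks stand in the order s, m, q
  with the added points last; in the complex of the constant functor in rank n - m, followed by m
  points, the order is s, q, m. The braid exchanges the last two blocks.\<close>

definition tw :: "nat \<Rightarrow> nat \<Rightarrow> nat \<Rightarrow> 'g" where
  "tw m n q = os (n - m - q) (m + q) (e (n - m - q)) (b m q)"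

lemma tw_closed [simp]: "m + q \<le> n \<Longrightarrow> tw m n q \<in> carrier (G n)"
  unfolding tw_def by (intro os_closed) auto

lemma tw_emb:
  assumes "m + q \<le> n" "h \<in> carrier (G (n - m - q))"
  shows "os (n - m) m (os (n - m - q) q h (e q)) (e m) \<otimes>\<^bsub>G n\<^esub> tw m n q
    = tw m n q \<otimes>\<^bsub>G n\<^esub> os (n - q) q (os (n - m - q) m h (e m)) (e q)"
proof -
  define s where "s = n - m - q"
  have n: "n - m = s + q" "n - q = s + m" "n = s + (m + q)" and h: "h \<in> carrier (G s)"
    using assms by (auto simp: s_def)
  have "os (s + q) m (os s q h (e q)) (e m) = os s (m + q) h (e (m + q))"
    using h by (simp add: os_assoc add.commute)
  moreover have "os (s + m) q (os s m h (e m)) (e q) = os s (m + q) h (e (m + q))"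
    using h by (simp add: os_assoc)
  ultimately show ?thesis
    unfolding tw_def s_def[symmetric] n(1,2) using h n(3) by (simp add: os_mult)
qed

text \<open>Naturality carries the face past the braid of the m points with all q + 1 added ones,
  and the hexagon splits off the braid with a single added point. The correction on the left is the
  representative found in \<open>sigma_unit\<close>, so it can be absorbed by the module
  entry.\<close>

lemma tw_face:
  assumes "m + Suc q \<le> n" "i \<le> q"
  shows "tw m n (Suc q) \<otimes>\<^bsub>G n\<^esub> cs_face G os b q n i
      \<otimes>\<^bsub>G n\<^esub> os (n - q) q (os (n - m - Suc q) (Suc m) (e (n - m - Suc q)) (inv\<^bsub>G (Suc m)\<^esub> (b m 1))) (e q)
    = os (n - m) m (cs_face G os b q (n - m) i) (e m) \<otimes>\<^bsub>G n\<^esub> tw m n q"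
proof -
  define s where "s = n - m - Suc q"
  define x where "x = os (Suc i) (q - i) (b 1 i) (e (q - i))"
  define K where "K = m + Suc q"
  have n: "n - m = s + Suc q" "n - q = Suc (s + m)" "n = s + K" "n - m - q = Suc s" "n - Suc q = s + m" "n - m - Suc q = s"
    using assms by (auto simp: s_def K_def)
  have x: "x \<in> carrier (G (Suc q))" using assms unfolding x_def by (intro os_closed) auto
  have ib: "inv\<^bsub>G (Suc m)\<^esub> (b m 1) \<in> carrier (G (Suc m))" by simp
  have 1: "cs_face G os b q n i = os s K (e s) (os m (Suc q) (e m) x)"
    using os_assoc[of "e s" s "e m" m x "Suc q" "s + m"] x n by (simp add: cs_face_def x_def K_def)
  have 2: "os (n - q) q (os s (Suc m) (e s) (inv\<^bsub>G (Suc m)\<^esub> (b m 1))) (e q)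
      = os s K (e s) (os (Suc m) q (inv\<^bsub>G (Suc m)\<^esub> (b m 1)) (e q))"
    using os_assoc[of "e s" s "inv\<^bsub>G (Suc m)\<^esub> (b m 1)" "Suc m" "e q" q "Suc (s + m)"] ib n by (simp add: K_def)
  have "cs_face G os b q (n - m) i = os s (Suc q) (e s) x"
    using n by (simp add: cs_face_def x_def)
  then have 3: "os (n - m) m (cs_face G os b q (n - m) i) (e m) = os s K (e s) (os (Suc q) m x (e m))"
    using os_assoc[of "e s" s x "Suc q" "e m" m "n - m"] x n by (simp add: K_def add.commute)
  have 4: "tw m n q = os s K (e s) (os 1 (m + q) (e 1) (b m q))"
    using os_assoc[of "e s" s "e 1" 1 "b m q" "m + q" "Suc s"] n by (simp add: tw_def K_def)
  have 5: "tw m n (Suc q) = os s K (e s) (b m (Suc q))"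
    by (simp add: tw_def n K_def)
  have c: "b m (Suc q) \<in> carrier (G K)" "os m (Suc q) (e m) x \<in> carrier (G K)"
    "os (Suc m) q (inv\<^bsub>G (Suc m)\<^esub> (b m 1)) (e q) \<in> carrier (G K)" "os (Suc q) m x (e m) \<in> carrier (G K)"
    "os 1 (m + q) (e 1) (b m q) \<in> carrier (G K)" "os (Suc m) q (b m 1) (e q) \<in> carrier (G K)"
    using x by (auto simp: K_def)
  have "b m (Suc q) = os 1 (m + q) (e 1) (b m q) \<otimes>\<^bsub>G K\<^esub> os (Suc m) q (b m 1) (e q)"
    using b_add_right[of m 1 q] by (simp add: K_def)
  moreover have "os (Suc m) q (b m 1) (e q) \<otimes>\<^bsub>G K\<^esub> os (Suc m) q (inv\<^bsub>G (Suc m)\<^esub> (b m 1)) (e q) = e K"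
    using ib by (simp add: os_mult K_def)
  ultimately have 6: "b m (Suc q) \<otimes>\<^bsub>G K\<^esub> os (Suc m) q (inv\<^bsub>G (Suc m)\<^esub> (b m 1)) (e q) = os 1 (m + q) (e 1) (b m q)"
    using c by (simp add: m_assoc)
  have "b m (Suc q) \<otimes>\<^bsub>G K\<^esub> os m (Suc q) (e m) x \<otimes>\<^bsub>G K\<^esub> os (Suc m) q (inv\<^bsub>G (Suc m)\<^esub> (b m 1)) (e q)
     = os (Suc q) m x (e m) \<otimes>\<^bsub>G K\<^esub> b m (Suc q) \<otimes>\<^bsub>G K\<^esub> os (Suc m) q (inv\<^bsub>G (Suc m)\<^esub> (b m 1)) (e q)"
    using b_nat[of "e m" m x "Suc q" K] x by (simp add: K_def)
  also have "\<dots> = os (Suc q) m x (e m) \<otimes>\<^bsub>G K\<^esub> os 1 (m + q) (e 1) (b m q)"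
    using c 6 by (simp add: m_assoc)
  finally have 7: "b m (Suc q) \<otimes>\<^bsub>G K\<^esub> os m (Suc q) (e m) x \<otimes>\<^bsub>G K\<^esub> os (Suc m) q (inv\<^bsub>G (Suc m)\<^esub> (b m 1)) (e q)
     = os (Suc q) m x (e m) \<otimes>\<^bsub>G K\<^esub> os 1 (m + q) (e 1) (b m q)" .
  have "os s K (e s) (b m (Suc q)) \<otimes>\<^bsub>G n\<^esub> os s K (e s) (os m (Suc q) (e m) x)
       \<otimes>\<^bsub>G n\<^esub> os s K (e s) (os (Suc m) q (inv\<^bsub>G (Suc m)\<^esub> (b m 1)) (e q))
     = os s K (e s) (b m (Suc q) \<otimes>\<^bsub>G K\<^esub> os m (Suc q) (e m) x \<otimes>\<^bsub>G K\<^esub> os (Suc m) q (inv\<^bsub>G (Suc m)\<^esub> (b m 1)) (e q))"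
    using c n(3) by (simp add: os_mult)
  also have "\<dots> = os s K (e s) (os (Suc q) m x (e m)) \<otimes>\<^bsub>G n\<^esub> os s K (e s) (os 1 (m + q) (e 1) (b m q))"
    unfolding 7 using c n(3) by (simp add: os_mult)
  finally show ?thesis unfolding 1 2 3 4 5 n(6) .
qed

text \<open>The hexagon writes \<open>b r 1\<close> as a braid of the first r - m points and a braid
  of the last m points with the new one; after inversion the former stands on the right and is
  absorbed by the coset.\<close>

lemma sigma_unit:
  assumes "m \<le> r"
  shows "ucomp G os m r (Suc r) (ginc G os b r) (cos m r (e r))
    = cos m (Suc r) (os (r - m) (Suc m) (e (r - m)) (inv\<^bsub>G (Suc m)\<^esub> (b m 1)))"
proof -
  define s where "s = r - m"
  have r: "r = s + m" "Suc r - m = Suc s" using assms by (auto simp: s_def)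
  have "b r 1 = os (Suc s) m (b s 1) (e m) \<otimes>\<^bsub>G (Suc r)\<^esub> os s (Suc m) (e s) (b m 1)"
    using b_add_left[of s m 1] r(1) by simp
  then have "inv\<^bsub>G (Suc r)\<^esub> (b r 1) = os s (Suc m) (e s) (inv\<^bsub>G (Suc m)\<^esub> (b m 1))
      \<otimes>\<^bsub>G (Suc r)\<^esub> os (Suc s) m (inv\<^bsub>G (Suc s)\<^esub> (b s 1)) (e m)"
    using r(1) by (simp add: group.inv_mult_group os_inv)
  moreover have "os s (Suc m) (e s) (inv\<^bsub>G (Suc m)\<^esub> (b m 1)) \<in> carrier (G (Suc r))" using r(1) by simp
  ultimately have "cos m (Suc r) (inv\<^bsub>G (Suc r)\<^esub> (b r 1)) = cos m (Suc r) (os s (Suc m) (e s) (inv\<^bsub>G (Suc m)\<^esub> (b m 1)))"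
    using cos_absorb[of m "Suc r" "os s (Suc m) (e s) (inv\<^bsub>G (Suc m)\<^esub> (b m 1))" "inv\<^bsub>G (Suc s)\<^esub> (b s 1)"] assms r(2)
    by simp
  then show ?thesis using assms by (simp add: ginc_cos ucomp_cos s_def[symmetric])
qed

lemma const_ug_module:
  assumes "cring R"
  shows "ug_module G os R (\<lambda>n. ring_mod R) const_act"
proof -
  interpret cring R by (rule assms)
  have "abelian_group (ring_mod R)"
  proof (rule abelian_groupI)
    fix x assume "x \<in> carrier (ring_mod R)"
    then show "\<exists>y\<in>carrier (ring_mod R). y \<oplus>\<^bsub>ring_mod R\<^esub> x = \<zero>\<^bsub>ring_mod R\<^esub>"
      using l_neg by (auto simp: ring_mod_def)
  qed (auto simp: ring_mod_def a_ac)
  then have "module R (ring_mod R)"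
    by (intro moduleI assms) (auto simp: ring_mod_def l_distr r_distr m_assoc)
  then show ?thesis by (simp add: ug_module_def linear_map_def const_act_def ring_mod_def)
qed

end

context ind_mod
begin

lemma teq_map: "(\<And>i. i \<in> set is \<Longrightarrow> [f i] \<bowtie> [f' i]) \<Longrightarrow> map f is \<bowtie> map f' is"
  using teq_concat[of "is" "\<lambda>i. [f i]" "\<lambda>i. [f' i]"] by simp

end

context free_ug
begin

sublocale CM: ugm G os b R "\<lambda>n. ring_mod R" const_act
  by unfold_locales (rule const_ug_module[OF R.is_cring])

lemma const_simps [simp]: "carrier (ring_mod R) = carrier R" "\<zero>\<^bsub>ring_mod R\<^esub> = \<zero>\<^bsub>R\<^esub>"
    "x \<oplus>\<^bsub>ring_mod R\<^esub> y = x \<oplus>\<^bsub>R\<^esub> y" "CM.ga n g x = x" "CM.sig n x = x"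
  by (simp_all add: ring_mod_def gact_def minc_def const_act_def)

lemma const_neg: "x \<in> carrier R \<Longrightarrow> \<ominus>\<^bsub>ring_mod R\<^esub> x = \<ominus>\<^bsub>R\<^esub> x"
  using abelian_group.minus_equality[OF CM.abg, of "\<ominus>\<^bsub>R\<^esub> x" x] R.l_neg by simp

text \<open>On the constant functor stabilisation is the identity and the only face is trivial, so
  each chain is its own preimage. At i = -1 the bound of H3 is a - k, whereas a generator of rank m
  in rank n > d_0 calls for every n - m > 0.\<close>

lemma const_exact_at_0:
  assumes "0 < n"
  shows "CM.exact_at n 0"
  unfolding CM.exact_at_def
proof (intro impI ballI)
  fix l assume l: "l \<in> CM.Ch n 0"
  have f: "cs_face G os b 0 n 0 = e n" using assms by (simp add: cs_face_def b_zero_right)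
  have l1: "l \<in> CM.Ch n (Suc 0)" using l assms by (auto simp: CM.Ch_def)
  have "CM.bd n 0 l = l" using l
  proof (induction l)
    case (Cons a l)
    obtain g x where a: "a = (g, x)" by (cases a)
    then show ?case using Cons CM.bd_append[of n 0 "[a]" l]
      by (simp add: CM.bd_def multi_map_def f sg_def)
  qed simp
  then show "\<exists>l'\<in>CM.Ch n (Suc 0). CM.tq n 0 (CM.bd n 0 l') l"
    using l1 CM.tq_refl[OF le0 l] by (intro bexI[of _ l]) simp_all
qed

abbreviation unit :: "'j \<Rightarrow> nat \<Rightarrow> 'g set" where "unit j r \<equiv> cos (rk j) r (e r)"

definition pos :: "'j \<Rightarrow> 'g \<Rightarrow> nat \<Rightarrow> nat \<Rightarrow> 'g \<Rightarrow> 'g" where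
  "pos j g n q f = g \<otimes>\<^bsub>G n\<^esub> (os (n - rk j) (rk j) f (e (rk j)) \<otimes>\<^bsub>G n\<^esub> tw (rk j) n q)"

text \<open>Up to the twist, the complex of a representable functor is induced from the complex of the constant functor.\<close>

definition Phi :: "'j \<Rightarrow> 'g \<Rightarrow> nat \<Rightarrow> nat \<Rightarrow> ('g \<times> 'r) list \<Rightarrow> ('g \<times> ('j \<times> 'g set \<Rightarrow> 'r)) list" where
  "Phi j g n q = map (\<lambda>(f, r). (pos j g n q f, bas r j (unit j (n - q))))"

lemma Phi_simps [simp]: "Phi j g n q [] = []" "Phi j g n q (l @ k) = Phi j g n q l @ Phi j g n q k"
    "Phi j g n q ((f, r) # l) = (pos j g n q f, bas r j (unit j (n - q))) # Phi j g n q l"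
  by (simp_all add: Phi_def)

lemma Phi_multi_map: "Phi j g n q l = multi_map [()] (\<lambda>_. pos j g n q) (\<lambda>_ r. bas r j (unit j (n - q))) l"
  by (induction l) (auto simp: multi_map_def Phi_def)

lemma pos_closed [simp]: "\<lbrakk>rk j + q \<le> n; g \<in> carrier (G n); f \<in> carrier (G (n - rk j))\<rbrakk> \<Longrightarrow> pos j g n q f \<in> carrier (G n)"
  by (simp add: pos_def)

lemma ga_bas:
  assumes "r \<in> carrier R" "j \<in> J" "rk j \<le> m" "h \<in> carrier (G m)"
  shows "FM.ga m h (bas r j (unit j m)) = bas r j (cos (rk j) m h)"
  using assms by (simp add: FM.ga_cos fa_bas ucomp_cos)

lemma bas_add: "\<lbrakk>r \<in> carrier R; r' \<in> carrier R\<rbrakk> \<Longrightarrow> bas (r \<oplus>\<^bsub>R\<^esub> r') j \<phi> = bas r j \<phi> \<oplus>\<^bsub>F n\<^esub> bas r' j \<phi>"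
  by (auto simp: bas_def F_add)

lemma bas_neg:
  assumes "r \<in> carrier R" "j \<in> J" "\<phi> \<in> UHom G os (rk j) n"
  shows "\<ominus>\<^bsub>F n\<^esub> bas r j \<phi> = bas (\<ominus>\<^bsub>R\<^esub> r) j \<phi>"
proof (rule abelian_group.minus_equality[OF FM.abg])
  have "bas \<zero>\<^bsub>R\<^esub> j \<phi> = \<zero>\<^bsub>F n\<^esub>" by (auto simp: bas_def F_zero)
  then show "bas (\<ominus>\<^bsub>R\<^esub> r) j \<phi> \<oplus>\<^bsub>F n\<^esub> bas r j \<phi> = \<zero>\<^bsub>F n\<^esub>"
    using assms bas_add[of "\<ominus>\<^bsub>R\<^esub> r" r j \<phi> n] by (simp add: R.l_neg)
qed (use assms in simp_all)

lemma bas_sg: "\<lbrakk>r \<in> carrier R; j \<in> J; \<phi> \<in> UHom G os (rk j) n\<rbrakk> \<Longrightarrow> sg (F n) i (bas r j \<phi>) = bas (sg (ring_mod R) i r) j \<phi>"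
  by (simp add: sg_def bas_neg const_neg)

lemma pos_emb:
  assumes "rk j + q \<le> n" "g \<in> carrier (G n)" "f \<in> carrier (G (n - rk j))" "h \<in> carrier (G (n - rk j - q))"
  shows "pos j g n q (f \<otimes>\<^bsub>G (n - rk j)\<^esub> os (n - rk j - q) q h (e q))
    = pos j g n q f \<otimes>\<^bsub>G n\<^esub> os (n - q) q (os (n - rk j - q) (rk j) h (e (rk j))) (e q)"
proof -
  let ?m = "rk j"
  have c: "os (n - ?m - q) q h (e q) \<in> carrier (G (n - ?m))" using assms by simp
  have c2: "os (n - ?m) ?m (os (n - ?m - q) q h (e q)) (e ?m) \<in> carrier (G n)" using c assms by simp
  have c3: "os (n - q) q (os (n - ?m - q) ?m h (e ?m)) (e q) \<in> carrier (G n)"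
    using assms by (intro os_closed) auto
  have c4: "os (n - ?m) ?m f (e ?m) \<in> carrier (G n)" using assms by simp
  have "os (n - ?m) ?m (f \<otimes>\<^bsub>G (n - ?m)\<^esub> os (n - ?m - q) q h (e q)) (e ?m)
     = os (n - ?m) ?m f (e ?m) \<otimes>\<^bsub>G n\<^esub> os (n - ?m) ?m (os (n - ?m - q) q h (e q)) (e ?m)"
    using assms c by (simp add: os_mult)
  then show ?thesis unfolding pos_def using assms c2 c3 c4 tw_emb[OF assms(1,4)] by (simp add: m_assoc)
qed

lemma Phi_ind_map:
  assumes j: "j \<in> J" "rk j + q \<le> n" and g: "g \<in> carrier (G n)"
  shows "ind_map (G (n - rk j)) (G (n - rk j - q)) (ring_mod R) (\<lambda>h. os (n - rk j - q) q h (e q)) (CM.ga (n - rk j - q))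
    (G n) (G (n - q)) (F (n - q)) (\<lambda>h. os (n - q) q h (e q)) (FM.ga (n - q))
    [()] (\<lambda>_. pos j g n q) (\<lambda>_ h. os (n - rk j - q) (rk j) h (e (rk j))) (\<lambda>_ r. bas r j (unit j (n - q)))"
proof (intro ind_map.intro ind_map_axioms.intro)
  show "ind_mod (G (n - rk j)) (G (n - rk j - q)) (ring_mod R) (\<lambda>h. os (n - rk j - q) q h (e q)) (CM.ga (n - rk j - q))"
    by (rule CM.level_ind_mod) (use j in simp)
  show "ind_mod (G n) (G (n - q)) (F (n - q)) (\<lambda>h. os (n - q) q h (e q)) (FM.ga (n - q))"
    by (rule FM.level_ind_mod) (use j in simp)
next
  fix f h assume fh: "f \<in> carrier (G (n - rk j))" "h \<in> carrier (G (n - rk j - q))"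
  show "pos j g n q (f \<otimes>\<^bsub>G (n - rk j)\<^esub> os (n - rk j - q) q h (e q)) =
    pos j g n q f \<otimes>\<^bsub>G n\<^esub> os (n - q) q (os (n - rk j - q) (rk j) h (e (rk j))) (e q)"
    by (rule pos_emb[OF j(2) g fh])
next
  fix r h assume h: "r \<in> carrier (ring_mod R)" "h \<in> carrier (G (n - rk j - q))"
  have d: "n - q - rk j = n - rk j - q" by simp
  have "cos (rk j) (n - q) (os (n - rk j - q) (rk j) h (e (rk j))) = unit j (n - q)"
    using cos_absorb[of "rk j" "n - q" "e (n - q)" h, unfolded d] h j by simp
  then show "bas (CM.ga (n - rk j - q) h r) j (unit j (n - q)) =
      FM.ga (n - q) (os (n - rk j - q) (rk j) h (e (rk j))) (bas r j (unit j (n - q)))"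
    using h j by (simp add: ga_bas)
qed (use j g in \<open>auto simp: bas_add\<close>)

lemma Phi_tq:
  "\<lbrakk>j \<in> J; rk j + q \<le> n; g \<in> carrier (G n); CM.tq (n - rk j) q l k\<rbrakk> \<Longrightarrow> FM.tq n q (Phi j g n q l) (Phi j g n q k)"
  unfolding Phi_multi_map by (rule ind_map.multi_map_teq[OF Phi_ind_map])

lemma Phi_Ch:
  "\<lbrakk>j \<in> J; rk j \<le> n; g \<in> carrier (G n); l \<in> CM.Ch (n - rk j) q\<rbrakk> \<Longrightarrow> Phi j g n q l \<in> FM.Ch n q"
  by (induction l) auto

text \<open>Face by face: \<open>tw_face\<close> matches the group elements up to a factor from
  G_(n-q), and by \<open>sigma_unit\<close> stabilising the unit morphism produces exactly this
  factor, so \<open>act\<close> trades one for the other.\<close>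

lemma Phi_bd:
  assumes j: "j \<in> J" "rk j + q \<le> n" and g: "g \<in> carrier (G n)" and l: "l \<in> CM.Ch (n - rk j) (Suc q)"
  shows "FM.tq n q (FM.bd n q (Phi j g n (Suc q) l)) (Phi j g n q (CM.bd (n - rk j) q l))"
proof -
  have q: "q \<le> n" using j by simp
  interpret I: ind_mod "G n" "G (n - q)" "F (n - q)" "\<lambda>h. os (n - q) q h (e q)" "FM.ga (n - q)"
    by (rule FM.level_ind_mod[OF q])
  show ?thesis using l
  proof (induction l)
    case Nil
    show ?case using I.refl by simp
  next
    case (Cons a l)
    obtain f r where a: "a = (f, r)" by (cases a)
    define m where "m = rk j"
    have mq: "m + Suc q \<le> n" and f: "f \<in> carrier (G (n - m))" and r: "r \<in> carrier R"
      using Cons.prems a j by (auto simp: m_def)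
    have nq: "n - q = Suc (n - Suc q)" using mq by simp
    define u where "u = os (n - m - Suc q) (Suc m) (e (n - m - Suc q)) (inv\<^bsub>G (Suc m)\<^esub> (b m 1))"
    have ib: "inv\<^bsub>G (Suc m)\<^esub> (b m 1) \<in> carrier (G (Suc m))" by simp
    have u: "u \<in> carrier (G (n - q))" unfolding u_def using mq by (intro os_closed ib) auto
    have X: "pos j g n (Suc q) f \<in> carrier (G n)" using j mq g f by (simp add: m_def)
    have d: "n - Suc q - m = n - m - Suc q" by simp
    have sig: "FM.sig (n - Suc q) (bas r j (unit j (n - Suc q))) = FM.ga (n - q) u (bas r j (unit j (n - q)))"
    proof -
      have "FM.sig (n - Suc q) (bas r j (unit j (n - Suc q))) = bas r j (ucomp G os m (n - Suc q) (Suc (n - Suc q)) (ginc G os b (n - Suc q)) (unit j (n - Suc q)))"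
        using r j mq by (simp add: minc_def fa_bas m_def)
      also have "\<dots> = bas r j (cos m (n - q) u)"
        using sigma_unit[of m "n - Suc q", unfolded d] mq unfolding nq u_def by (simp add: m_def)
      also have "\<dots> = FM.ga (n - q) u (bas r j (unit j (n - q)))"
        using r j mq u by (simp add: ga_bas m_def)
      finally show ?thesis .
    qed
    let ?F = "\<lambda>i. (pos j g n (Suc q) f \<otimes>\<^bsub>G n\<^esub> cs_face G os b q n i,
        sg (F (n - q)) i (FM.sig (n - Suc q) (bas r j (unit j (n - Suc q)))))"
    let ?F' = "\<lambda>i. (pos j g n q (f \<otimes>\<^bsub>G (n - m)\<^esub> cs_face G os b q (n - m) i),
        bas (sg (ring_mod R) i r) j (unit j (n - q)))"
    have B: "bas r j (unit j (n - q)) \<in> carrier (F (n - q))" using r j by simp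
    have "I.teq (map ?F [0..<Suc q]) (map ?F' [0..<Suc q])"
    proof (rule I.teq_map)
      fix i assume "i \<in> set [0..<Suc q]"
      then have i: "i \<le> q" by auto
      have fc: "cs_face G os b q n i \<in> carrier (G n)" using i mq by simp
      have fc': "cs_face G os b q (n - m) i \<in> carrier (G (n - m))" using i mq by simp
      have uc: "os (n - q) q u (e q) \<in> carrier (G n)" using u q by simp
      have fm: "os (n - m) m f (e m) \<in> carrier (G n)" using f mq by simp
      have fcm: "os (n - m) m (cs_face G os b q (n - m) i) (e m) \<in> carrier (G n)" using fc' mq by simp
      have "pos j g n (Suc q) f \<otimes>\<^bsub>G n\<^esub> cs_face G os b q n i \<otimes>\<^bsub>G n\<^esub> os (n - q) q u (e q)
         = g \<otimes>\<^bsub>G n\<^esub> (os (n - m) m f (e m) \<otimes>\<^bsub>G n\<^esub> (tw m n (Suc q) \<otimes>\<^bsub>G n\<^esub> cs_face G os b q n i \<otimes>\<^bsub>G n\<^esub> os (n - q) q u (e q)))"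
        using fc uc fm g mq by (simp add: pos_def m_def[symmetric] m_assoc)
      also have "\<dots> = g \<otimes>\<^bsub>G n\<^esub> (os (n - m) m f (e m) \<otimes>\<^bsub>G n\<^esub> (os (n - m) m (cs_face G os b q (n - m) i) (e m) \<otimes>\<^bsub>G n\<^esub> tw m n q))"
        unfolding u_def tw_face[OF mq i] ..
      also have "\<dots> = pos j g n q (f \<otimes>\<^bsub>G (n - m)\<^esub> cs_face G os b q (n - m) i)"
      proof -
        have "os (n - m) m (f \<otimes>\<^bsub>G (n - m)\<^esub> cs_face G os b q (n - m) i) (e m)
           = os (n - m) m f (e m) \<otimes>\<^bsub>G n\<^esub> os (n - m) m (cs_face G os b q (n - m) i) (e m)"
          using f fc' mq by (simp add: os_mult)
        then show ?thesis using fm fcm g mq by (simp add: pos_def m_def[symmetric] m_assoc)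
      qed
      finally have eq: "pos j g n (Suc q) f \<otimes>\<^bsub>G n\<^esub> cs_face G os b q n i \<otimes>\<^bsub>G n\<^esub> os (n - q) q u (e q)
          = pos j g n q (f \<otimes>\<^bsub>G (n - m)\<^esub> cs_face G os b q (n - m) i)" .
      have "sg (F (n - q)) i (FM.sig (n - Suc q) (bas r j (unit j (n - Suc q))))
          = FM.ga (n - q) u (bas (sg (ring_mod R) i r) j (unit j (n - q)))"
        unfolding sig using FM.ga_sg[OF B u, of i] bas_sg[OF r j(1), of "unit j (n - q)" "n - q" i] j by simp
      moreover have "bas (sg (ring_mod R) i r) j (unit j (n - q)) \<in> carrier (F (n - q))"
        using bas_sg[OF r j(1), of "unit j (n - q)" "n - q" i] j FM.sg_closed[OF B, of i] by simp
      ultimately show "I.teq [?F i] [?F' i]"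
        using I.sym[OF I.act[of "pos j g n (Suc q) f \<otimes>\<^bsub>G n\<^esub> cs_face G os b q n i" u
            "bas (sg (ring_mod R) i r) j (unit j (n - q))"]] eq X fc u by simp
    qed
    moreover have "FM.bd n q [(pos j g n (Suc q) f, bas r j (unit j (n - Suc q)))] = map ?F [0..<Suc q]"
      by (simp add: FM.bd_def multi_map_def)
    moreover have "Phi j g n q (CM.bd (n - m) q [(f, r)]) = map ?F' [0..<Suc q]"
      by (simp add: CM.bd_def multi_map_def Phi_def)
    ultimately have 1: "I.teq (FM.bd n q [(pos j g n (Suc q) f, bas r j (unit j (n - Suc q)))])
        (Phi j g n q (CM.bd (n - m) q [(f, r)]))" by simp
    have "I.teq (FM.bd n q (Phi j g n (Suc q) l)) (Phi j g n q (CM.bd (n - rk j) q l))" using Cons a by simp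
    from I.append[OF 1 this]
    have "I.teq (FM.bd n q ([(pos j g n (Suc q) f, bas r j (unit j (n - Suc q)))] @ Phi j g n (Suc q) l))
        (Phi j g n q (CM.bd (n - rk j) q ([(f, r)] @ l)))"
      unfolding FM.bd_append CM.bd_append Phi_simps(2) m_def .
    then show ?case using a by simp
  qed
qed

text \<open>The coefficient of a chain at the unit morphism separates the summands of the free module and, within
  each summand, the cosets of the automorphisms of \<open>n - rk j\<close>.\<close>

lemma ev1_coeff:
  assumes j: "j \<in> J" "rk j + q \<le> n" "g \<in> carrier (G n)" "f \<in> carrier (G (n - rk j))" and r: "r \<in> carrier R"
    and j0: "j0 \<in> J" "rk j0 + q \<le> n" "g0 \<in> carrier (G n)" "f0 \<in> carrier (G (n - rk j0))"
  shows "ind_mod.ev1 (G n) (G (n - q)) (F (n - q)) (\<lambda>h. os (n - q) q h (e q)) (FM.ga (n - q))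
      (pos j0 g0 n q f0) (pos j g n q f) (bas r j (unit j (n - q))) (j0, unit j0 (n - q))
    = (if j = j0 \<and> (\<exists>h\<in>carrier (G (n - rk j - q)).
        g \<otimes>\<^bsub>G n\<^esub> os (n - rk j) (rk j) f (e (rk j))
        = g0 \<otimes>\<^bsub>G n\<^esub> os (n - rk j) (rk j) (f0 \<otimes>\<^bsub>G (n - rk j)\<^esub> os (n - rk j - q) q h (e q)) (e (rk j)))
      then r else \<zero>\<^bsub>R\<^esub>)" (is "?L = (if j = j0 \<and> ?E then r else _)")
proof -
  have q: "q \<le> n" using j by simp
  interpret I: ind_mod "G n" "G (n - q)" "F (n - q)" "\<lambda>h. os (n - q) q h (e q)" "FM.ga (n - q)"
    by (rule FM.level_ind_mod[OF q])
  let ?m = "rk j"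
  have d: "n - q - ?m = n - ?m - q" by simp
  have X: "pos j g n q f \<in> carrier (G n)" "pos j0 g0 n q f0 \<in> carrier (G n)" using j j0 by auto
  have emb: "os (n - q) q h (e q) \<in> carrier (G n)" if "h \<in> carrier (G (n - q))" for h
    using that q by simp
  show ?thesis
  proof (cases "j = j0")
    case False
    have "I.ev1 x y (bas r j \<phi>) (j0, \<psi>) = \<zero>\<^bsub>R\<^esub>" if "x \<in> carrier (G n)" "y \<in> carrier (G n)" "\<phi> = unit j (n - q)" for x y \<phi> \<psi>
    proof -
      have gb: "FM.ga (n - q) h (bas r j (unit j (n - q))) (j0, \<psi>) = \<zero>\<^bsub>R\<^esub>" if "h \<in> carrier (G (n - q))" for h
        using ga_bas[OF r j(1), of "n - q" h] that j False by (simp add: bas_def)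
      show ?thesis
        by (rule I.ev1_cases[OF that(2,1)]) (simp_all add: that(3) F_zero gb)
    qed
    then show ?thesis using X False by simp
  next
    case jj: True
    have fm: "os (n - ?m) ?m f (e ?m) \<in> carrier (G n)" using j by simp
    have tc: "tw ?m n q \<in> carrier (G n)" using j by simp
    \<comment> \<open>Cancelling the twist turns the coset condition at twisted positions into one
      between untwisted group elements.\<close>
    have conv: "pos j g n q f = pos j g0 n q f0 \<otimes>\<^bsub>G n\<^esub> os (n - q) q (os (n - ?m - q) ?m h (e ?m)) (e q)
        \<longleftrightarrow> g \<otimes>\<^bsub>G n\<^esub> os (n - ?m) ?m f (e ?m)
          = g0 \<otimes>\<^bsub>G n\<^esub> os (n - ?m) ?m (f0 \<otimes>\<^bsub>G (n - ?m)\<^esub> os (n - ?m - q) q h (e q)) (e ?m)"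
      if h: "h \<in> carrier (G (n - ?m - q))" for h
    proof -
      have c: "os (n - ?m - q) q h (e q) \<in> carrier (G (n - ?m))" using h j by simp
      have c2: "os (n - ?m) ?m (f0 \<otimes>\<^bsub>G (n - ?m)\<^esub> os (n - ?m - q) q h (e q)) (e ?m) \<in> carrier (G n)"
        using c j j0 jj by (intro os_closed) auto
      have "pos j g0 n q f0 \<otimes>\<^bsub>G n\<^esub> os (n - q) q (os (n - ?m - q) ?m h (e ?m)) (e q)
         = g0 \<otimes>\<^bsub>G n\<^esub> os (n - ?m) ?m (f0 \<otimes>\<^bsub>G (n - ?m)\<^esub> os (n - ?m - q) q h (e q)) (e ?m) \<otimes>\<^bsub>G n\<^esub> tw ?m n q"
        using pos_emb[of j q n g0 f0 h] h j j0 jj c2 tc by (simp add: pos_def m_assoc)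
      moreover have "pos j g n q f = g \<otimes>\<^bsub>G n\<^esub> os (n - ?m) ?m f (e ?m) \<otimes>\<^bsub>G n\<^esub> tw ?m n q"
        using j fm tc by (simp add: pos_def m_assoc)
      ultimately show ?thesis using j j0 fm c2 tc by (simp add: group.right_cancel)
    qed
    show ?thesis
    proof (cases rule: I.ev1_cases[OF X])
      case (1 h)
      have v: "?L = (if cos ?m (n - q) h = unit j (n - q) then r else \<zero>\<^bsub>R\<^esub>)"
        using 1(3) ga_bas[OF r j(1), of "n - q" h] 1(1) j jj by (simp add: bas_def)
      have eq: "pos j g n q f = pos j g0 n q f0 \<otimes>\<^bsub>G n\<^esub> os (n - q) q h (e q)"
        using inv_mult(2)[OF X(2,1), unfolded 1(2)] jj by simp
      \<comment> \<open>\<open>h\<close> sends the unit to the morphism that it represents; this is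
        the unit again exactly when \<open>h\<close> comes from G_(n-m-q).\<close>
      have "cos ?m (n - q) h = unit j (n - q) \<longleftrightarrow> ?E"
      proof
        assume "cos ?m (n - q) h = unit j (n - q)"
        then obtain h0 where h0: "h0 \<in> carrier (G (n - q - ?m))" "h = e (n - q) \<otimes>\<^bsub>G (n - q)\<^esub> os (n - q - ?m) ?m h0 (e ?m)"
          using j 1(1) by (elim cos_eqD[rotated 2]) auto
        have "os (n - q - ?m) ?m h0 (e ?m) \<in> carrier (G (n - q))" using h0(1) j by (intro os_closed) auto
        then have "h = os (n - ?m - q) ?m h0 (e ?m)" "h0 \<in> carrier (G (n - ?m - q))" using h0 by (simp_all add: add.commute)
        then show ?E using conv eq by blast
      next
        assume ?E
        then obtain h0 where h0: "h0 \<in> carrier (G (n - ?m - q))"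
          "pos j g n q f = pos j g0 n q f0 \<otimes>\<^bsub>G n\<^esub> os (n - q) q (os (n - ?m - q) ?m h0 (e ?m)) (e q)"
          using conv by blast
        have k: "os (n - ?m - q) ?m h0 (e ?m) \<in> carrier (G (n - q))" using h0 j by simp
        have "os (n - q) q h (e q) = os (n - q) q (os (n - ?m - q) ?m h0 (e ?m)) (e q)"
          using eq h0(2) X(2) jj emb[OF k] emb[OF 1(1)] monoid.Units_l_cancel[OF mon] group.Units_eq[OF grp] by metis
        then have "h = os (n - ?m - q) ?m h0 (e ?m)" using os_inj 1(1) k grp_simps(4) by blast
        then show "cos ?m (n - q) h = unit j (n - q)"
          using cos_absorb[of ?m "n - q" "e (n - q)" h0, unfolded d] h0(1) j k by simp
      qed
      then show ?thesis using v jj by simp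
    next
      case 2
      have "\<not> ?E"
      proof
        assume ?E
        then obtain h0 where h0: "h0 \<in> carrier (G (n - ?m - q))"
          "pos j g n q f = pos j g0 n q f0 \<otimes>\<^bsub>G n\<^esub> os (n - q) q (os (n - ?m - q) ?m h0 (e ?m)) (e q)"
          using conv by blast
        have k: "os (n - ?m - q) ?m h0 (e ?m) \<in> carrier (G (n - q))" using h0 j by simp
        have "inv\<^bsub>G n\<^esub> (pos j0 g0 n q f0) \<otimes>\<^bsub>G n\<^esub> pos j g n q f = os (n - q) q (os (n - ?m - q) ?m h0 (e ?m)) (e q)"
          unfolding h0(2) using X(2) jj emb[OF k] by simp
        then show False using 2(1) k by blast
      qed
      then show ?thesis using 2(2) by (simp add: F_zero)
    qed
  qed
qed

end

section \<open>Splitting chains of a free module into blocks\<close>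

context free_ug
begin

text \<open>A block (j, g, l) stands for the copy of the constant complex that sits in the summand
  \<open>j\<close> at the coset of \<open>g\<close> modulo G_(n - rk j), with \<open>l\<close> a
  chain of that copy.\<close>

definition good :: "nat \<Rightarrow> nat \<Rightarrow> 'j \<times> 'g \<times> ('g \<times> 'r) list \<Rightarrow> bool" where
  "good n q = (\<lambda>(j, g, l). j \<in> J \<and> rk j + q \<le> n \<and> g \<in> carrier (G n) \<and> l \<in> CM.Ch (n - rk j) q)"

definition cat :: "nat \<Rightarrow> nat \<Rightarrow> ('j \<times> 'g \<times> ('g \<times> 'r) list) list \<Rightarrow> ('g \<times> ('j \<times> 'g set \<Rightarrow> 'r)) list" where
  "cat n q ks = concat (map (\<lambda>(j, g, l). Phi j g n q l) ks)"

lemma cat_simps [simp]: "cat n q [] = []" "cat n q ((j, g, l) # ks) = Phi j g n q l @ cat n q ks"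
    "cat n q (ks @ ks') = cat n q ks @ cat n q ks'"
  by (simp_all add: cat_def)

lemma cat_Ch: "\<forall>k\<in>set ks. good n q k \<Longrightarrow> cat n q ks \<in> FM.Ch n q"
  by (induction ks) (auto simp: good_def intro!: Phi_Ch)

abbreviation fev :: "nat \<Rightarrow> nat \<Rightarrow> 'g \<Rightarrow> ('g \<times> ('j \<times> 'g set \<Rightarrow> 'r)) list \<Rightarrow> 'j \<times> 'g set \<Rightarrow> 'r" where
  "fev n q \<equiv> ind_mod.ev (G n) (G (n - q)) (F (n - q)) (\<lambda>h. os (n - q) q h (e q)) (FM.ga (n - q))"

text \<open>With equal outer positions, \<open>g\<close> cancels in \<open>ev1_coeff\<close>, and
  injectivity of \<oplus> leaves precisely the coset condition of the constant complex.\<close>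

lemma fev_same:
  assumes k: "good n q (j, g, l)" and f0: "f0 \<in> carrier (G (n - rk j))"
  shows "fev n q (pos j g n q f0) (Phi j g n q l) (j, unit j (n - q))
    = ind_mod.ev (G (n - rk j)) (G (n - rk j - q)) (ring_mod R) (\<lambda>h. os (n - rk j - q) q h (e q)) (CM.ga (n - rk j - q)) f0 l"
proof -
  have j: "j \<in> J" "rk j + q \<le> n" "g \<in> carrier (G n)" "l \<in> CM.Ch (n - rk j) q" using k by (auto simp: good_def)
  interpret I: ind_mod "G n" "G (n - q)" "F (n - q)" "\<lambda>h. os (n - q) q h (e q)" "FM.ga (n - q)"
    by (rule FM.level_ind_mod) (use j in simp)
  interpret C: ind_mod "G (n - rk j)" "G (n - rk j - q)" "ring_mod R" "\<lambda>h. os (n - rk j - q) q h (e q)" "CM.ga (n - rk j - q)"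
    by (rule CM.level_ind_mod) (use j in simp)
  let ?m = "rk j"
  show ?thesis using j(4)
  proof (induction l)
    case Nil
    show ?case unfolding Phi_simps I.ev_Nil C.ev_Nil F_zero by (simp only: const_simps(2))
  next
    case (Cons a l)
    obtain f r where a: "a = (f, r)" by (cases a)
    have f: "f \<in> carrier (G (n - ?m))" "r \<in> carrier R" using Cons.prems a by auto
    have "(\<exists>h\<in>carrier (G (n - ?m - q)). g \<otimes>\<^bsub>G n\<^esub> os (n - ?m) ?m f (e ?m)
        = g \<otimes>\<^bsub>G n\<^esub> os (n - ?m) ?m (f0 \<otimes>\<^bsub>G (n - ?m)\<^esub> os (n - ?m - q) q h (e q)) (e ?m))
      \<longleftrightarrow> inv\<^bsub>G (n - ?m)\<^esub> f0 \<otimes>\<^bsub>G (n - ?m)\<^esub> f \<in> (\<lambda>h. os (n - ?m - q) q h (e q)) ` carrier (G (n - ?m - q))"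
    proof -
      have eqn: "g \<otimes>\<^bsub>G n\<^esub> os (n - ?m) ?m f (e ?m) = g \<otimes>\<^bsub>G n\<^esub> os (n - ?m) ?m (f0 \<otimes>\<^bsub>G (n - ?m)\<^esub> k) (e ?m)
          \<longleftrightarrow> inv\<^bsub>G (n - ?m)\<^esub> f0 \<otimes>\<^bsub>G (n - ?m)\<^esub> f = k" if k: "k \<in> carrier (G (n - ?m))" for k
      proof -
        have c: "os (n - ?m) ?m f (e ?m) \<in> carrier (G n)" "os (n - ?m) ?m (f0 \<otimes>\<^bsub>G (n - ?m)\<^esub> k) (e ?m) \<in> carrier (G n)"
          using f f0 k j by auto
        have "g \<otimes>\<^bsub>G n\<^esub> os (n - ?m) ?m f (e ?m) = g \<otimes>\<^bsub>G n\<^esub> os (n - ?m) ?m (f0 \<otimes>\<^bsub>G (n - ?m)\<^esub> k) (e ?m)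
            \<longleftrightarrow> os (n - ?m) ?m f (e ?m) = os (n - ?m) ?m (f0 \<otimes>\<^bsub>G (n - ?m)\<^esub> k) (e ?m)"
          using monoid.Units_l_cancel[OF mon, of g n] group.Units_eq[OF grp] j(3) c by simp
        also have "\<dots> \<longleftrightarrow> f = f0 \<otimes>\<^bsub>G (n - ?m)\<^esub> k"
          using os_inj[of f "n - ?m" "e ?m" ?m "f0 \<otimes>\<^bsub>G (n - ?m)\<^esub> k" "e ?m"] f f0 k by auto
        also have "\<dots> \<longleftrightarrow> inv\<^bsub>G (n - ?m)\<^esub> f0 \<otimes>\<^bsub>G (n - ?m)\<^esub> f = k"
          using f f0 k by (auto simp: m_assoc)
        finally show ?thesis .
      qed
      show ?thesis unfolding image_iff by (intro bex_cong HOL.refl eqn C.emb_closed)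
    qed
    then have "I.ev1 (pos j g n q f0) (pos j g n q f) (bas r j (unit j (n - q))) (j, unit j (n - q)) = C.ev1 f0 f r"
      unfolding C.ev1_def unfolding const_simps ev1_coeff[OF j(1-3) f j(1-3) f0] by simp
    moreover have "I.ev (pos j g n q f0) (Phi j g n q l) (j, unit j (n - q)) = C.ev f0 l"
      by (rule Cons.IH) (use Cons.prems a in auto)
    ultimately show ?case unfolding a Phi_simps I.ev_Cons C.ev_Cons F_add by (simp only: const_simps(3))
  qed
qed

text \<open>Within one summand, a nonzero coefficient would write the inverse of \<open>g0\<close>
  times \<open>g\<close> as an element of G_(n - rk j) extended by the identity, so both blocks
  would share a coset.\<close>

lemma fev_diff:
  assumes k: "good n q (j, g, l)" and j0: "j0 \<in> J" "rk j0 + q \<le> n" "g0 \<in> carrier (G n)" "f0 \<in> carrier (G (n - rk j0))"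
    and ne: "\<not> (j = j0 \<and> inv\<^bsub>G n\<^esub> g0 \<otimes>\<^bsub>G n\<^esub> g \<in> stabsub G os (n - rk j0) (rk j0))"
  shows "fev n q (pos j0 g0 n q f0) (Phi j g n q l) (j0, unit j0 (n - q)) = \<zero>\<^bsub>R\<^esub>"
proof -
  have j: "j \<in> J" "rk j + q \<le> n" "g \<in> carrier (G n)" "l \<in> CM.Ch (n - rk j) q" using k by (auto simp: good_def)
  interpret I: ind_mod "G n" "G (n - q)" "F (n - q)" "\<lambda>h. os (n - q) q h (e q)" "FM.ga (n - q)"
    by (rule FM.level_ind_mod) (use j in simp)
  show ?thesis using j(4)
  proof (induction l)
    case Nil
    show ?case by (simp add: F_zero)
  next
    case (Cons a l)
    obtain f r where a: "a = (f, r)" by (cases a)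
    have f: "f \<in> carrier (G (n - rk j))" "r \<in> carrier R" using Cons.prems a by auto
    have False if jj: "j = j0" and ex: "\<exists>h\<in>carrier (G (n - rk j - q)). g \<otimes>\<^bsub>G n\<^esub> os (n - rk j) (rk j) f (e (rk j))
        = g0 \<otimes>\<^bsub>G n\<^esub> os (n - rk j) (rk j) (f0 \<otimes>\<^bsub>G (n - rk j)\<^esub> os (n - rk j - q) q h (e q)) (e (rk j))"
    proof -
      let ?m = "rk j"
      obtain h where h: "h \<in> carrier (G (n - ?m - q))" and eq: "g \<otimes>\<^bsub>G n\<^esub> os (n - ?m) ?m f (e ?m)
        = g0 \<otimes>\<^bsub>G n\<^esub> os (n - ?m) ?m (f0 \<otimes>\<^bsub>G (n - ?m)\<^esub> os (n - ?m - q) q h (e q)) (e ?m)" using ex by blast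
      define k where "k = f0 \<otimes>\<^bsub>G (n - ?m)\<^esub> os (n - ?m - q) q h (e q)"
      have k: "k \<in> carrier (G (n - ?m))" using h j j0 jj by (simp add: k_def)
      have c: "os (n - ?m) ?m f (e ?m) \<in> carrier (G n)" "os (n - ?m) ?m k (e ?m) \<in> carrier (G n)"
        "os (n - ?m) ?m (inv\<^bsub>G (n - ?m)\<^esub> f) (e ?m) \<in> carrier (G n)" using f k j by auto
      have one: "os (n - ?m) ?m f (e ?m) \<otimes>\<^bsub>G n\<^esub> os (n - ?m) ?m (inv\<^bsub>G (n - ?m)\<^esub> f) (e ?m) = e n"
        using f j by (simp add: os_mult)
      have "inv\<^bsub>G n\<^esub> g0 \<otimes>\<^bsub>G n\<^esub> g
         = inv\<^bsub>G n\<^esub> g0 \<otimes>\<^bsub>G n\<^esub> (g \<otimes>\<^bsub>G n\<^esub> os (n - ?m) ?m f (e ?m)) \<otimes>\<^bsub>G n\<^esub> os (n - ?m) ?m (inv\<^bsub>G (n - ?m)\<^esub> f) (e ?m)"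
        using c j j0 one by (simp add: m_assoc)
      also have "\<dots> = os (n - ?m) ?m k (e ?m) \<otimes>\<^bsub>G n\<^esub> os (n - ?m) ?m (inv\<^bsub>G (n - ?m)\<^esub> f) (e ?m)"
        unfolding eq k_def[symmetric] using c j0 by simp
      also have "\<dots> = os (n - ?m) ?m (k \<otimes>\<^bsub>G (n - ?m)\<^esub> inv\<^bsub>G (n - ?m)\<^esub> f) (e ?m)"
        using f k j by (simp add: os_mult)
      finally show False using ne jj f k by (auto simp: stabsub_def)
    qed
    then have "I.ev1 (pos j0 g0 n q f0) (pos j g n q f) (bas r j (unit j (n - q))) (j0, unit j0 (n - q)) = \<zero>\<^bsub>R\<^esub>"
      using ev1_coeff[OF j(1-3) f j0] by auto
    then show ?case using Cons a by (simp add: F_add)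
  qed
qed

text \<open>By additivity a single basis element suffices. A representative of its morphism is moved
  to the position by \<open>act\<close>, which leaves the unit morphism.\<close>

lemma decompose:
  assumes q: "q \<le> n" and z: "z \<in> FM.Ch n q"
  shows "\<exists>ks. (\<forall>k\<in>set ks. good n q k) \<and> FM.tq n q z (cat n q ks)"
proof -
  interpret I: ind_mod "G n" "G (n - q)" "F (n - q)" "\<lambda>h. os (n - q) q h (e q)" "FM.ga (n - q)"
    by (rule FM.level_ind_mod[OF q])
  have single: "\<exists>ks. (\<forall>k\<in>set ks. good n q k) \<and> I.teq [(g, c)] (cat n q ks)"
    if g: "g \<in> carrier (G n)" and "c \<in> carrier (F (n - q))" for g c
    using that(2)
  proof (induction rule: F_induct)
    case zero
    show ?case using I.zero[OF g] by (intro exI[of _ "[]"]) simp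
  next
    case (bas r j \<phi>)
    obtain f where f: "rk j \<le> n - q" "f \<in> carrier (G (n - q))" "\<phi> = cos (rk j) (n - q) f"
      using bas(3) by (rule UHomE)
    have jq: "rk j + q \<le> n" using f(1) q by simp
    define x where "x = g \<otimes>\<^bsub>G n\<^esub> os (n - q) q f (e q)"
    have x: "x \<in> carrier (G n)" using g f q by (simp add: x_def)
    \<comment> \<open>Chosen so that \<open>pos\<close> with the identity as inner element is
      \<open>x\<close>.\<close>
    define g2 where "g2 = x \<otimes>\<^bsub>G n\<^esub> inv\<^bsub>G n\<^esub> (tw (rk j) n q)"
    have g2: "g2 \<in> carrier (G n)" using x jq by (simp add: g2_def)
    have "pos j g2 n q (e (n - rk j)) = x" using x jq by (simp add: pos_def g2_def m_assoc)
    then have P: "cat n q [(j, g2, [(e (n - rk j), r)])] = [(x, bas r j (unit j (n - q)))]" by simp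
    have B: "bas r j (unit j (n - q)) \<in> carrier (F (n - q))" using bas f by simp
    have "I.teq [(g, bas r j \<phi>)] (cat n q [(j, g2, [(e (n - rk j), r)])])"
      unfolding P x_def f(3) using I.sym[OF I.act[OF g f(2) B]] ga_bas[OF bas(1,2) f(1,2)] by simp
    moreover have "good n q (j, g2, [(e (n - rk j), r)])" using bas jq g2 by (simp add: good_def)
    ultimately show ?case by (intro exI[of _ "[(j, g2, [(e (n - rk j), r)])]"]) simp
  next
    case (add c d)
    then obtain ks ks' where k: "\<forall>k\<in>set ks. good n q k" "I.teq [(g, c)] (cat n q ks)"
      "\<forall>k\<in>set ks'. good n q k" "I.teq [(g, d)] (cat n q ks')" by blast
    have "I.teq [(g, c \<oplus>\<^bsub>F (n - q)\<^esub> d)] ([(g, c)] @ [(g, d)])" using I.add[OF g add(1,2)] by simp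
    also have "I.teq \<dots> (cat n q ks @ cat n q ks')" by (rule I.append[OF k(2,4)])
    finally show ?case using k by (intro exI[of _ "ks @ ks'"]) auto
  qed
  show ?thesis using z
  proof (induction z)
    case Nil
    show ?case using I.refl by (intro exI[of _ "[]"]) simp
  next
    case (Cons a z)
    obtain g c where a: "a = (g, c)" by (cases a)
    obtain ks where ks: "\<forall>k\<in>set ks. good n q k" "I.teq [(g, c)] (cat n q ks)"
      using single[of g c] Cons.prems[unfolded a FM.Ch_Cons] by blast
    obtain ks' where ks': "\<forall>k\<in>set ks'. good n q k" "I.teq z (cat n q ks')" using Cons a by auto
    show ?case using I.append[OF ks(2) ks'(2)] ks ks' a by (intro exI[of _ "ks @ ks'"]) auto
  qed
qed

text \<open>A change of representative within the coset multiplies the inner chain from the left by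
  an element of G_(n - rk j).\<close>

lemma Phi_translate:
  assumes k: "good n q (j, g', l)" and g: "g \<in> carrier (G n)"
    and st: "inv\<^bsub>G n\<^esub> g \<otimes>\<^bsub>G n\<^esub> g' \<in> stabsub G os (n - rk j) (rk j)"
  shows "\<exists>l'. good n q (j, g, l') \<and> Phi j g' n q l = Phi j g n q l'"
proof -
  let ?m = "rk j"
  have j: "j \<in> J" "?m + q \<le> n" "g' \<in> carrier (G n)" "l \<in> CM.Ch (n - ?m) q" using k by (auto simp: good_def)
  obtain h where h: "h \<in> carrier (G (n - ?m))" "inv\<^bsub>G n\<^esub> g \<otimes>\<^bsub>G n\<^esub> g' = os (n - ?m) ?m h (e ?m)"
    using st by (auto simp: stabsub_def)
  have hc: "os (n - ?m) ?m h (e ?m) \<in> carrier (G n)" using h j by simp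
  have g': "g' = g \<otimes>\<^bsub>G n\<^esub> os (n - ?m) ?m h (e ?m)"
    using h(2)[symmetric] g j by simp
  have p: "pos j g' n q f = pos j g n q (h \<otimes>\<^bsub>G (n - ?m)\<^esub> f)" if f: "f \<in> carrier (G (n - ?m))" for f
  proof -
    have fc: "os (n - ?m) ?m f (e ?m) \<in> carrier (G n)" using f j by simp
    have "os (n - ?m) ?m (h \<otimes>\<^bsub>G (n - ?m)\<^esub> f) (e ?m) = os (n - ?m) ?m h (e ?m) \<otimes>\<^bsub>G n\<^esub> os (n - ?m) ?m f (e ?m)"
      using h f j by (simp add: os_mult)
    then show ?thesis using g' g hc fc j by (simp add: pos_def m_assoc)
  qed
  define l' where "l' = map (\<lambda>(f, r). (h \<otimes>\<^bsub>G (n - ?m)\<^esub> f, r)) l"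
  have "Phi j g' n q l = Phi j g n q l' \<and> l' \<in> CM.Ch (n - ?m) q"
    unfolding l'_def using j(4) p h by (induction l) (auto simp: Phi_def)
  then show ?thesis using j g by (auto simp: good_def)
qed

lemma bd_cat:
  assumes q: "q \<le> n" and "\<forall>k\<in>set ks. good n (Suc q) k"
  shows "FM.tq n q (FM.bd n q (cat n (Suc q) ks)) (cat n q (map (\<lambda>(j, g, l). (j, g, CM.bd (n - rk j) q l)) ks))"
  using assms(2)
proof (induction ks)
  case Nil
  show ?case using FM.tq_refl[OF q] by simp
next
  case (Cons a ks)
  obtain j g l where a: "a = (j, g, l)" by (cases a)
  have "FM.tq n q (FM.bd n q (Phi j g n (Suc q) l)) (Phi j g n q (CM.bd (n - rk j) q l))"
    using Cons.prems a by (intro Phi_bd) (auto simp: good_def)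
  from FM.tq_append[OF q this Cons.IH] show ?case using Cons.prems a by (simp add: FM.bd_append)
qed

lemma cat_partition: "mset (cat n q ks) = mset (cat n q (filter S ks)) + mset (cat n q (filter (\<lambda>k. \<not> S k) ks))"
  by (induction ks) auto

lemma merge:
  assumes g: "g \<in> carrier (G n)"
  shows "\<forall>k\<in>set ks. good n q k \<and> (\<lambda>(j', g', l'). j' = j \<and> inv\<^bsub>G n\<^esub> g \<otimes>\<^bsub>G n\<^esub> g' \<in> stabsub G os (n - rk j) (rk j)) k
    \<Longrightarrow> ks \<noteq> [] \<Longrightarrow> \<exists>l0. good n q (j, g, l0) \<and> cat n q ks = Phi j g n q l0"
proof (induction ks)
  case (Cons a ks)
  obtain j' g' l' where a: "a = (j', g', l')" by (cases a)
  have j': "j' = j" and gd: "good n q (j, g', l')" and st: "inv\<^bsub>G n\<^esub> g \<otimes>\<^bsub>G n\<^esub> g' \<in> stabsub G os (n - rk j) (rk j)"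
    using Cons.prems a by auto
  obtain l1 where l1: "good n q (j, g, l1)" "Phi j g' n q l' = Phi j g n q l1" using Phi_translate[OF gd g st] by blast
  show ?case
  proof (cases "ks = []")
    case True
    then show ?thesis using l1 a j' by auto
  next
    case False
    then obtain l2 where l2: "good n q (j, g, l2)" "cat n q ks = Phi j g n q l2" using Cons by auto
    then have "good n q (j, g, l1 @ l2)" using l1 by (auto simp: good_def)
    moreover have "cat n q (a # ks) = Phi j g n q (l1 @ l2)" using l1 l2 a j' by simp
    ultimately show ?thesis by blast
  qed
qed simp

text \<open>Exactness of the constant complex applies to one class of blocks at a time (same
  summand, same coset). All blocks in the class of the head are merged and removed, and the
  induction runs on the number of blocks.\<close>

lemma cat_boundary:
  assumes q: "q \<le> n" and ex: "\<And>j. \<lbrakk>j \<in> J; rk j \<le> n\<rbrakk> \<Longrightarrow> CM.exact_at (n - rk j) q"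
  shows "\<lbrakk>\<forall>k\<in>set ks. good n q k; \<forall>p. q = Suc p \<longrightarrow> FM.tq n p (FM.bd n p (cat n q ks)) []\<rbrakk>
    \<Longrightarrow> \<exists>z\<in>FM.Ch n (Suc q). FM.tq n q (FM.bd n q z) (cat n q ks)"
proof (induction "length ks" arbitrary: ks rule: less_induct)
  case less
  show ?case
  proof (cases ks)
    case Nil
    then show ?thesis using FM.tq_refl[OF q] by (intro bexI[of _ "[]"]) auto
  next
    case (Cons a ks1)
    obtain j g l where a: "a = (j, g, l)" by (cases a)
    define S where "S = (\<lambda>(j', g', l' :: ('g \<times> 'r) list). j' = j \<and> inv\<^bsub>G n\<^esub> g \<otimes>\<^bsub>G n\<^esub> g' \<in> stabsub G os (n - rk j) (rk j))"
    have j: "j \<in> J" "rk j + q \<le> n" "g \<in> carrier (G n)" using less.prems(1) Cons a by (auto simp: good_def)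
    have "e n \<in> stabsub G os (n - rk j) (rk j)"
      using subgroup.one_closed[OF stabsub_subgroup] j by simp
    then have Sa: "S a" using a j by (simp add: S_def)
    define D where "D = filter (\<lambda>k. \<not> S k) ks"
    have "filter S ks \<noteq> []" using Sa Cons by simp
    moreover have "\<forall>k\<in>set (filter S ks). good n q k \<and> (\<lambda>(j', g', l'). j' = j \<and> inv\<^bsub>G n\<^esub> g \<otimes>\<^bsub>G n\<^esub> g' \<in> stabsub G os (n - rk j) (rk j)) k"
      using less.prems(1) by (auto simp: S_def)
    ultimately obtain l0 where l0: "good n q (j, g, l0)" "cat n q (filter S ks) = Phi j g n q l0"
      using merge[OF j(3)] by blast
    have l0C: "l0 \<in> CM.Ch (n - rk j) q" using l0 by (simp add: good_def)
    have Dg: "\<forall>k\<in>set D. good n q k" using less.prems(1) by (simp add: D_def)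
    have lenD: "length D < length ks" using Cons Sa by (simp add: D_def le_imp_less_Suc)
    have PC: "Phi j g n q l0 \<in> FM.Ch n q" using Phi_Ch j l0C by simp
    have DC: "cat n q D \<in> FM.Ch n q" using cat_Ch Dg by blast
    have split: "FM.tq n q (Phi j g n q l0 @ cat n q D) (cat n q ks)"
      by (rule FM.tq_mset[OF q]) (use PC DC cat_partition[of n q ks S] l0(2) in \<open>auto simp: D_def\<close>)
    \<comment> \<open>Only the whole sum is known to be a cycle. The differential keeps the summand
      and the coset of each block, so reading coefficients at the unit morphism separates the merged
      block from the rest, and both are cycles.\<close>
    have cyc: "CM.tq (n - rk j) p (CM.bd (n - rk j) p l0) [] \<and> FM.tq n p (FM.bd n p (cat n q D)) []"
      if p: "q = Suc p" for p
    proof -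
      have pn: "p \<le> n" and pm: "p \<le> n - rk j" using p q j by auto
      note tr = FM.tq_trans[OF pn]
      interpret I: ind_mod "G n" "G (n - p)" "F (n - p)" "\<lambda>h. os (n - p) p h (e p)" "FM.ga (n - p)"
        by (rule FM.level_ind_mod[OF pn])
      interpret C: ind_mod "G (n - rk j)" "G (n - rk j - p)" "ring_mod R" "\<lambda>h. os (n - rk j - p) p h (e p)" "CM.ga (n - rk j - p)"
        by (rule CM.level_ind_mod[OF pm])
      let ?D' = "map (\<lambda>(j, g, l). (j, g, CM.bd (n - rk j) p l)) D"
      let ?l = "CM.bd (n - rk j) p l0"
      have lC: "?l \<in> CM.Ch (n - rk j) p" using CM.bd_Ch l0C p by simp
      have gl: "good n p (j, g, ?l)" using j lC p by (simp add: good_def)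
      have D': "\<forall>k\<in>set ?D'. good n p k" using Dg p CM.bd_Ch by (fastforce simp: good_def)
      have "FM.tq n p (FM.bd n p (Phi j g n q l0 @ cat n q D)) (FM.bd n p (cat n q ks))"
        using FM.bd_tq[of n p "Phi j g n q l0 @ cat n q D" "cat n q ks"] split p q by simp
      then have sum0: "FM.tq n p (FM.bd n p (Phi j g n q l0) @ FM.bd n p (cat n q D)) []"
        using less.prems(2) p tr unfolding FM.bd_append by blast
      have P1: "FM.tq n p (FM.bd n p (Phi j g n q l0)) (Phi j g n p ?l)"
        using Phi_bd[of j p n g l0] j l0C p by simp
      have D1: "FM.tq n p (FM.bd n p (cat n q D)) (cat n p ?D')"
        using bd_cat[OF pn, of D] Dg p by simp
      have sum1: "FM.tq n p (Phi j g n p ?l @ cat n p ?D') []"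
        using FM.tq_sym[OF pn FM.tq_append[OF pn P1 D1]] sum0 tr by blast
      have "CM.tq (n - rk j) p ?l []"
      proof (rule C.ev_zero_imp_teq)
        show "?l \<in> C.chains" using lC CM.chains_eq[OF pm] by simp
        fix f0 assume f0: "f0 \<in> carrier (G (n - rk j))"
        have px: "pos j g n p f0 \<in> carrier (G n)" using j p f0 by simp
        have Phc: "Phi j g n p ?l \<in> I.chains" using Phi_Ch[of j n g ?l p] j lC FM.chains_eq[OF pn] by simp
        have Dch: "cat n p ks' \<in> I.chains" if "\<forall>k\<in>set ks'. good n p k" for ks'
          using cat_Ch[OF that] FM.chains_eq[OF pn] by simp
        have nS: "\<forall>(j', g', l')\<in>set ?D'. \<not> (j' = j \<and> inv\<^bsub>G n\<^esub> g \<otimes>\<^bsub>G n\<^esub> g' \<in> stabsub G os (n - rk j) (rk j))"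
          by (auto simp: D_def S_def)
        have z: "I.ev (pos j g n p f0) (cat n p ks') (j, unit j (n - p)) = \<zero>\<^bsub>R\<^esub>"
          if "\<forall>k\<in>set ks'. good n p k"
            "\<forall>(j', g', l')\<in>set ks'. \<not> (j' = j \<and> inv\<^bsub>G n\<^esub> g \<otimes>\<^bsub>G n\<^esub> g' \<in> stabsub G os (n - rk j) (rk j))" for ks'
          using that
        proof (induction ks')
          case Nil
          show ?case by (simp add: F_zero)
        next
          case (Cons k ks')
          obtain j' g' l' where k: "k = (j', g', l')" by (cases k)
          have gk: "good n p (j', g', l')" using Cons.prems k by simp
          then have c1: "Phi j' g' n p l' \<in> I.chains"
            using Phi_Ch[of j' n g' l' p] FM.chains_eq[OF pn] by (simp add: good_def)
          have "I.ev (pos j g n p f0) (Phi j' g' n p l') (j, unit j (n - p)) = \<zero>\<^bsub>R\<^esub>"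
            by (rule fev_diff[OF gk]) (use j p f0 Cons.prems k in auto)
          moreover have "cat n p ks' \<in> I.chains" using Dch Cons.prems by simp
          ultimately show ?case using Cons k c1 px by (simp add: I.ev_append F_add)
        qed
        have "C.ev f0 ?l = I.ev (pos j g n p f0) (Phi j g n p ?l) (j, unit j (n - p))"
          using fev_same[OF gl f0] by simp
        moreover have "I.ev (pos j g n p f0) (Phi j g n p ?l) (j, unit j (n - p)) \<in> carrier R"
          using I.ev_closed[OF Phc px] unfolding F_carrier by blast
        moreover have "I.ev (pos j g n p f0) (Phi j g n p ?l @ cat n p ?D') = \<zero>\<^bsub>F (n - p)\<^esub>"
          using I.teq_sound[OF sum1 px] by simp
        then have "I.ev (pos j g n p f0) (Phi j g n p ?l) (j, unit j (n - p))
            \<oplus>\<^bsub>R\<^esub> I.ev (pos j g n p f0) (cat n p ?D') (j, unit j (n - p)) = \<zero>\<^bsub>R\<^esub>"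
          unfolding I.ev_append[OF Phc Dch[OF D'] px] F_add F_zero by meson
        ultimately show "C.ev f0 ?l = \<zero>\<^bsub>ring_mod R\<^esub>" using z[OF D' nS] by simp
      qed
      moreover from this have P0: "FM.tq n p (Phi j g n p ?l) []"
        using Phi_tq[of j p n g ?l "[]"] j p by simp
      moreover have "FM.tq n p (FM.bd n p (cat n q D)) []"
      proof (rule FM.tq_append_cancel[OF pn])
        have A: "FM.tq n p (FM.bd n p (Phi j g n q l0)) []" using P1 P0 tr by blast
        show "FM.tq n p (FM.bd n p (Phi j g n q l0)) []" by (rule A)
        have "FM.tq n p (FM.bd n p (cat n q D) @ FM.bd n p (Phi j g n q l0)) (FM.bd n p (Phi j g n q l0) @ FM.bd n p (cat n q D))"
          by (rule FM.tq_mset[OF pn]) (use PC DC p FM.bd_Ch in auto)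
        then show "FM.tq n p (FM.bd n p (cat n q D) @ FM.bd n p (Phi j g n q l0)) []" using sum0 tr by blast
      qed
      ultimately show ?thesis by blast
    qed
    obtain z where z: "z \<in> FM.Ch n (Suc q)" "FM.tq n q (FM.bd n q z) (cat n q D)"
      using less.hyps[OF lenD Dg] cyc by blast
    have "q \<le> n - rk j" using j by simp
    then obtain l1 where l1: "l1 \<in> CM.Ch (n - rk j) (Suc q)" "CM.tq (n - rk j) q (CM.bd (n - rk j) q l1) l0"
      using ex[of j] j l0C cyc by (auto simp: CM.exact_at_def)
    have "FM.tq n q (FM.bd n q (Phi j g n (Suc q) l1)) (Phi j g n q (CM.bd (n - rk j) q l1))"
      by (rule Phi_bd) (use j l1 in auto)
    then have "FM.tq n q (FM.bd n q (Phi j g n (Suc q) l1)) (Phi j g n q l0)"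
      using Phi_tq[OF j l1(2)] FM.tq_trans[OF q] by blast
    from FM.tq_append[OF q this z(2)]
    have "FM.tq n q (FM.bd n q (Phi j g n (Suc q) l1 @ z)) (cat n q ks)"
      unfolding FM.bd_append using split FM.tq_trans[OF q] by blast
    moreover have "Phi j g n (Suc q) l1 @ z \<in> FM.Ch n (Suc q)" using Phi_Ch[of j n g l1 "Suc q"] j l1 z by simp
    ultimately show ?thesis by blast
  qed
qed

theorem free_exact_at:
  assumes "\<And>j. \<lbrakk>j \<in> J; rk j \<le> n\<rbrakk> \<Longrightarrow> CM.exact_at (n - rk j) q"
  shows "FM.exact_at n q"
  unfolding FM.exact_at_def
proof (intro impI ballI)
  assume q: "q \<le> n"
  fix z assume z: "z \<in> FM.Ch n q" "\<forall>p. q = Suc p \<longrightarrow> FM.tq n p (FM.bd n p z) []"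
  obtain ks where ks: "\<forall>k\<in>set ks. good n q k" "FM.tq n q z (cat n q ks)" using decompose[OF q z(1)] by blast
  have "\<forall>p. q = Suc p \<longrightarrow> FM.tq n p (FM.bd n p (cat n q ks)) []"
  proof (intro allI impI)
    fix p assume p: "q = Suc p"
    have "FM.tq n p (FM.bd n p (cat n q ks)) (FM.bd n p z)"
      using FM.bd_tq[of n p "cat n q ks" z] FM.tq_sym[OF q ks(2)] p q by simp
    moreover have "FM.tq n p (FM.bd n p z) []" using z(2) p by blast
    moreover have "p \<le> n" using p q by simp
    ultimately show "FM.tq n p (FM.bd n p (cat n q ks)) []" using FM.tq_trans by blast
  qed
  then obtain w where "w \<in> FM.Ch n (Suc q)" "FM.tq n q (FM.bd n q w) (cat n q ks)"
    using cat_boundary[OF q assms ks(1)] by blast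
  then show "\<exists>l'\<in>FM.Ch n (Suc q). FM.tq n q (FM.bd n q l') z"
    using FM.tq_sym[OF q ks(2)] FM.tq_trans[OF q] by blast
qed

end

section \<open>Free covers and kernels\<close>

text \<open>The free cover has to be built inside the given type \<open>'p\<close>; codes for pairs,
  and from them codes for finite lists, make room for its elements.\<close>

lemma infinite_pairing:
  assumes "infinite (UNIV :: 'p set)"
  shows "\<exists>f :: 'p \<times> 'p \<Rightarrow> 'p. inj f"
proof -
  have "\<exists>f :: 'p \<times> 'p \<Rightarrow> 'p. bij_betw f (UNIV \<times> UNIV) UNIV"
    using card_of_Times_same_infinite[OF assms] card_of_ordIso by blast
  then show ?thesis by (auto simp: bij_betw_def)
qed

text \<open>The first components \<open>u\<close> and \<open>w\<close>, taken distinct, mark the end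
  of the list and a further entry.\<close>

primrec list_code :: "('p \<times> 'p \<Rightarrow> 'p) \<Rightarrow> 'p \<Rightarrow> 'p \<Rightarrow> 'p list \<Rightarrow> 'p" where
  "list_code pr u w [] = pr (u, u)"
| "list_code pr u w (x # xs) = pr (w, pr (x, list_code pr u w xs))"

lemma inj_list_code:
  assumes "inj pr" "u \<noteq> w"
  shows "inj (list_code pr u w)"
proof (rule injI)
  fix xs ys
  show "list_code pr u w xs = list_code pr u w ys \<Longrightarrow> xs = ys"
  proof (induction xs arbitrary: ys)
    case Nil
    then show ?case using assms by (cases ys) (auto dest: injD)
  next
    case (Cons x xs)
    show ?case
    proof (cases ys)
      case Nil
      then show ?thesis using Cons.prems assms by (auto dest: injD)
    next
      case (Cons y zs)
      then have "pr (x, list_code pr u w xs) = pr (y, list_code pr u w zs)"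
        using Cons.prems assms(1) by (auto dest: injD)
      then show ?thesis using Cons.IH Cons assms(1) by (auto dest!: injD)
    qed
  qed
qed

definition transport :: "('r, 'y) module \<Rightarrow> ('y \<Rightarrow> 'p) \<Rightarrow> ('p \<Rightarrow> 'y) \<Rightarrow> ('r, 'p) module" where
  "transport N en de = \<lparr>carrier = en ` carrier N, monoid.mult = undefined, one = undefined, ring.zero = en \<zero>\<^bsub>N\<^esub>,
     add = (\<lambda>x y. en (de x \<oplus>\<^bsub>N\<^esub> de y)), smult = (\<lambda>r x. en (r \<odot>\<^bsub>N\<^esub> de x))\<rparr>"

lemma transport_simps [simp]: "carrier (transport N en de) = en ` carrier N" "\<zero>\<^bsub>transport N en de\<^esub> = en \<zero>\<^bsub>N\<^esub>"
    "x \<oplus>\<^bsub>transport N en de\<^esub> y = en (de x \<oplus>\<^bsub>N\<^esub> de y)" "r \<odot>\<^bsub>transport N en de\<^esub> x = en (r \<odot>\<^bsub>N\<^esub> de x)"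
  by (simp_all add: transport_def)

lemma transport_module:
  assumes "module R N" and de: "\<And>x. x \<in> carrier N \<Longrightarrow> de (en x) = x"
  shows "module R (transport N en de)"
proof -
  interpret module R N by (rule assms(1))
  show ?thesis
  proof (rule moduleI)
    show "abelian_group (transport N en de)"
    proof (rule abelian_groupI)
      fix x assume "x \<in> carrier (transport N en de)"
      then obtain y where y: "y \<in> carrier N" "x = en y" by auto
      then have "en (\<ominus>\<^bsub>N\<^esub> y) \<in> carrier (transport N en de)" "en (\<ominus>\<^bsub>N\<^esub> y) \<oplus>\<^bsub>transport N en de\<^esub> x = \<zero>\<^bsub>transport N en de\<^esub>"
        using de M.l_neg by auto
      then show "\<exists>y\<in>carrier (transport N en de). y \<oplus>\<^bsub>transport N en de\<^esub> x = \<zero>\<^bsub>transport N en de\<^esub>" by blast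
    qed (auto simp: de M.a_ac)
  qed (auto simp: de smult_l_distr smult_r_distr smult_assoc1 is_cring)
qed

context ugm
begin

context
  fixes en :: "nat \<Rightarrow> 'x \<Rightarrow> 'p" and de :: "nat \<Rightarrow> 'p \<Rightarrow> 'x"
  assumes de: "\<And>n x. x \<in> carrier (M n) \<Longrightarrow> de n (en n x) = x"
begin

lemma add_closed': "\<lbrakk>x \<in> carrier (M n); y \<in> carrier (M n)\<rbrakk> \<Longrightarrow> x \<oplus>\<^bsub>M n\<^esub> y \<in> carrier (M n)"
  using abelian_groupE(1)[OF abg] .

lemma transport_ug_module:
  "ug_module G os R (\<lambda>n. transport (M n) (en n) (de n)) (\<lambda>s t \<phi> x. en t (act s t \<phi> (de s x)))"
  unfolding ug_module_def
  by (auto simp: linear_map_def de act_closed act_add act_smult act_uid act_ucomp add_closed'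
      intro!: transport_module[OF mod])

lemma transport_hom:
  "ug_hom G os R M act (\<lambda>n. transport (M n) (en n) (de n)) (\<lambda>s t \<phi> x. en t (act s t \<phi> (de s x))) en"
  by (auto simp: ug_hom_def linear_map_def de)

lemma transport_hom_back:
  "ug_hom G os R (\<lambda>n. transport (M n) (en n) (de n)) (\<lambda>s t \<phi> x. en t (act s t \<phi> (de s x))) M act de"
  by (auto simp: ug_hom_def linear_map_def de act_closed add_closed')

end

end

lemma ug_hom_comp:
  assumes "ug_hom G os R M act M' act' \<eta>" "ug_hom G os R M' act' M'' act'' \<eta>'"
  shows "ug_hom G os R M act M'' act'' (\<lambda>n x. \<eta>' n (\<eta> n x))"
  using assms by (auto simp: ug_hom_def linear_map_def)

context free_ug
begin

text \<open>A morphism is a set of group elements, and \<open>'p\<close> need not have room for all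
  such sets; its representative is a single group element and determines it.\<close>

lemma crep_inj:
  assumes "\<phi> \<in> UHom G os s t" "\<psi> \<in> UHom G os s t" "crep \<phi> = crep \<psi>"
  shows "\<phi> = \<psi>"
proof -
  have "cos s t (crep \<chi>) = \<chi>" if \<chi>: "\<chi> \<in> UHom G os s t" for \<chi>
  proof -
    obtain f where f: "s \<le> t" "f \<in> carrier (G t)" "\<chi> = cos s t f" using \<chi> by (rule UHomE)
    obtain h where "h \<in> carrier (G (t - s))" "crep \<chi> = f \<otimes>\<^bsub>G t\<^esub> os (t - s) s h (e s)"
      using crep_cos[OF f(1,2)] f(3) by metis
    then show ?thesis using cos_absorb f by simp
  qed
  then show ?thesis using assms by metis
qed

text \<open>A finitely supported function is coded by the list of its triples (summand,
  representative of the morphism, coefficient) over the support. The order of the list is an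
  arbitrary choice, so only the sets of entries are compared.\<close>

lemma free_embedding:
  fixes fr :: "'r \<Rightarrow> 'p" and fg :: "'g \<Rightarrow> 'p" and fj :: "'j \<Rightarrow> 'p"
  assumes inj: "inj fr" "inj fg" "inj fj" and inf: "infinite (UNIV :: 'p set)"
  shows "\<exists>en :: ('j \<times> 'g set \<Rightarrow> 'r) \<Rightarrow> 'p. \<forall>n. inj_on en (carrier (F n))"
proof -
  obtain pr :: "'p \<times> 'p \<Rightarrow> 'p" where pr: "inj pr" using infinite_pairing[OF inf] by blast
  have "\<exists>w :: 'p. w \<noteq> u" for u
    using inf by (metis UNIV_eq_I finite.emptyI finite.insertI insertI1)
  then obtain u w :: 'p where uw: "u \<noteq> w" by metis
  define ls where "ls c = (SOME xs. set xs = supp c)" for c :: "'j \<times> 'g set \<Rightarrow> 'r"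
  define t where "t c = (\<lambda>x. pr (fj (fst x), pr (fg (crep (snd x)), fr (c x))))" for c :: "'j \<times> 'g set \<Rightarrow> 'r"
  define en where "en c = list_code pr u w (map (t c) (ls c))" for c
  have ls: "set (ls c) = supp c" if "c \<in> carrier (F n)" for c n
  proof -
    have "finite (supp c)" using that F_carrier by blast
    then show ?thesis unfolding ls_def by (rule someI_ex[OF finite_list])
  qed
  have key: "c x = d x" if c: "c \<in> carrier (F n)" and d: "d \<in> carrier (F n)" and eq: "t c ` supp c = t d ` supp d"
    and x: "x \<in> supp c" for c d n x
  proof -
    obtain y where y: "y \<in> supp d" "t c x = t d y" using eq x by blast
    have 1: "fst x = fst y" "crep (snd x) = crep (snd y)" "c x = d y"
      using y(2) injD[OF pr] inj by (auto simp: t_def dest!: injD[OF pr] injD)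
    have "snd x \<in> UHom G os (rk (fst x)) n" "snd y \<in> UHom G os (rk (fst y)) n"
      using x y(1) c d by (auto simp: F_carrier idx_def)
    then have "snd x = snd y" using 1 crep_inj by metis
    then have "x = y" using 1 by (simp add: prod_eq_iff)
    then show ?thesis using 1 by simp
  qed
  have "inj_on en (carrier (F n))" for n
  proof (rule inj_onI)
    fix c d assume c: "c \<in> carrier (F n)" and d: "d \<in> carrier (F n)" and eq: "en c = en d"
    have "map (t c) (ls c) = map (t d) (ls d)"
      using eq inj_list_code[OF pr uw] unfolding en_def by (rule injD[rotated])
    then have im: "t c ` supp c = t d ` supp d" using ls[OF c] ls[OF d] by (metis set_map)
    show "c = d"
    proof
      fix x
      show "c x = d x"
      proof (cases "x \<in> supp c")
        case True
        then show ?thesis by (rule key[OF c d im])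
      next
        case False
        show ?thesis
        proof (cases "x \<in> supp d")
          case True
          then show ?thesis by (rule key[OF d c im[symmetric], symmetric])
        next
          case False
          then show ?thesis using \<open>x \<notin> supp c\<close> by (simp add: supp_def)
        qed
      qed
    qed
  qed
  then show ?thesis by blast
qed

end

context ugm
begin

text \<open>There is one generator for each element of M_k with k \<le> d. Up to rank d every
  element is hit by its own generator; beyond, exactness at q = 0 writes it as a sum of translates
  of stabilised elements of rank n - 1, and strong induction applies.\<close>

lemma free_cover:
  fixes fr :: "'r \<Rightarrow> 'p" and fg :: "'g \<Rightarrow> 'p" and fx :: "'x \<Rightarrow> 'p"
  assumes inj: "inj fr" "inj fg" "inj fx" and inf: "infinite (UNIV :: 'p set)"
    and gen: "\<And>n. int n > d \<Longrightarrow> exact_at n 0"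
  shows "\<exists>(P :: nat \<Rightarrow> ('r, 'p) module) Pact \<epsilon>. ug_module G os R P Pact \<and> free_gen_le G os R P Pact d \<and>
    ug_hom G os R P Pact M act \<epsilon> \<and> (\<forall>n. \<epsilon> n ` carrier (P n) = carrier (M n))"
proof -
  obtain pr :: "'p \<times> 'p \<Rightarrow> 'p" where pr: "inj pr" using infinite_pairing[OF inf] by blast
  obtain fn :: "nat \<Rightarrow> 'p" where fn: "inj fn" using inf infinite_countable_subset by blast
  \<comment> \<open>\<open>free_gen_le\<close> takes its index set in the element type of the
    module, here \<open>'p\<close>, so the pairs of a rank and an element are coded in
    \<open>'p\<close>.\<close>
  define code where "code = (\<lambda>(k, x). pr (fn k, fx x))"
  have code: "inj code"
    by (rule injI) (auto simp: code_def dest!: injD[OF pr] injD[OF fn] injD[OF inj(3)])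
  define J where "J = code ` {(k, x). int k \<le> d \<and> x \<in> carrier (M k)}"
  define rk where "rk = (\<lambda>j. fst (inv_into UNIV code j))"
  define v where "v = (\<lambda>j. snd (inv_into UNIV code j))"
  interpret U: free_ug_map G os b R J rk M act v
    by (intro free_ug_map.intro free_ug.intro free_ug_map_axioms.intro braided_stab_axioms ring ugm_axioms)
      (auto simp: J_def v_def rk_def inv_f_f[OF code])
  obtain en where en: "\<And>n. inj_on (en :: ('p \<times> 'g set \<Rightarrow> 'r) \<Rightarrow> 'p) (carrier (U.F n))"
    using U.free_embedding[OF inj(1,2) inj_on_id inf] by blast
  define de where "de n = inv_into (carrier (U.F n)) en" for n
  have de: "de n (en c) = c" if "c \<in> carrier (U.F n)" for n c
    using that inv_into_f_f[OF en] by (simp add: de_def)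
  let ?P = "\<lambda>n. transport (U.F n) en (de n)"
  let ?A = "\<lambda>s t \<phi> x. en (U.fa s t \<phi> (de s x))"
  have "free_gen_le G os R ?P ?A d"
    unfolding free_gen_le_def
  proof (intro exI conjI allI ballI)
    show "int (rk j) \<le> d" if "j \<in> J" for j using that by (auto simp: J_def rk_def inv_f_f[OF code])
    show "ug_hom G os R U.F U.fa ?P ?A (\<lambda>n. en)" by (rule U.FM.transport_hom[OF de])
    show "bij_betw en (carrier (U.F n)) (carrier (?P n))" for n using en by (simp add: bij_betw_def)
  qed
  moreover have "ug_module G os R ?P ?A" by (rule U.FM.transport_ug_module[OF de])
  moreover have "ug_hom G os R ?P ?A M act (\<lambda>n x. U.ext n (de n x))"
    by (rule ug_hom_comp[OF U.FM.transport_hom_back[OF de] U.ext_ug_hom])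
  moreover have surj: "U.ext n ` carrier (U.F n) = carrier (M n)" for n
  proof (induction n rule: less_induct)
    case (less n)
    interpret E: ugm_hom G os b R U.F U.fa M act U.ext
      by unfold_locales (rule U.ext_ug_hom)
    have "x \<in> U.ext n ` carrier (U.F n)" if x: "x \<in> carrier (M n)" for x
    proof (cases "int n \<le> d")
      case True
      define j where "j = code (n, x)"
      have j: "j \<in> J" "rk j = n" "v j = x" using True x by (auto simp: J_def j_def rk_def v_def inv_f_f[OF code])
      have one: "\<one>\<^bsub>R\<^esub> \<in> carrier R" using cring.cring_simprules(6)[OF ring] .
      have u: "uid G os n \<in> UHom G os (rk j) n" using j uid_UHom by simp
      have "U.ext n (U.bas \<one>\<^bsub>R\<^esub> j (uid G os n)) = \<one>\<^bsub>R\<^esub> \<odot>\<^bsub>M n\<^esub> act (rk j) n (uid G os n) (v j)"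
        by (rule U.ext_bas[OF one j(1) u])
      also have "\<dots> = x" using j x by (simp add: act_uid module.smult_one[OF mod])
      finally show ?thesis using U.bas_closed[OF one j(1) u] by (metis imageI)
    next
      case False
      then have "exact_at n 0" using gen by simp
      have xC: "[(e n, x)] \<in> Ch n 0" using x by simp
      then obtain l where l: "l \<in> Ch n (Suc 0)" "tq n 0 (bd n 0 l) [(e n, x)]"
        using \<open>exact_at n 0\<close> by (fastforce simp: exact_at_def)
      have "val n (bd n 0 l) = val n [(e n, x)]" using tq_0_iff[OF bd_Ch[OF l(1)] xC] l(2) by blast
      also have "\<dots> = x" using x act_uid[of x n]
        by (simp add: val_def ga_cos uid_cos abelian_monoid.r_zero[OF abelian_group.axioms(1)[OF abg]])
      finally have "x = val n (bd n 0 l)" by simp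
      moreover have "val n (bd n 0 l) \<in> U.ext n ` carrier (U.F n)" using l(1)
      proof (induction l)
        case Nil
        show ?case using U.ext_zero U.F_zero_closed by (auto simp: val_def intro!: image_eqI)
      next
        case (Cons c l)
        obtain g y where c: "c = (g, y)" by (cases c)
        have n: "n = Suc (n - 1)" and g: "g \<in> carrier (G n)" and y: "y \<in> carrier (M (n - 1))" "l \<in> Ch n (Suc 0)"
          using Cons.prems c by auto
        have "n - 1 < n" using Cons.prems c by auto
        from less.IH[OF this] y(1) have "y \<in> U.ext (n - 1) ` carrier (U.F (n - 1))" by (simp only:)
        then obtain w where w: "w \<in> carrier (U.F (n - 1))" "U.ext (n - 1) w = y" by blast
        define g' where "g' = g \<otimes>\<^bsub>G n\<^esub> cs_face G os b 0 n 0"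
        have g': "g' \<in> carrier (G n)" using g n by (simp add: g'_def)
        define z where "z = U.FM.ga n g' (U.FM.sig (n - 1) w)"
        have sw: "U.FM.sig (n - 1) w \<in> carrier (U.F n)" using U.FM.sig_closed[OF w(1)] n by simp
        have z: "z \<in> carrier (U.F n)" using sw g' by (simp add: z_def)
        have ez: "U.ext n z = ga n g' (sig (n - 1) y)"
          using E.hom_ga[OF g' sw] E.hom_sig[OF w(1)] n w(2) by (simp add: z_def)
        obtain z' where z': "z' \<in> carrier (U.F n)" "val n (bd n 0 l) = U.ext n z'"
          using Cons.IH[OF y(2)] by blast
        have "bd n 0 (c # l) = (g', sig (n - 1) y) # bd n 0 l"
          by (simp add: bd_def multi_map_def c g'_def sg_def)
        then have "val n (bd n 0 (c # l)) = U.ext n (z \<oplus>\<^bsub>U.F n\<^esub> z')"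
          using ez z'(2) U.ext_add[OF z z'(1)] by (simp add: val_def)
        then show ?case using U.F_add_closed[OF z z'(1)] by blast
      qed
      ultimately show ?thesis by simp
    qed
    then show ?case using U.ext_closed by blast
  qed
  moreover have "(\<lambda>x. U.ext n (de n x)) ` carrier (?P n) = carrier (M n)" for n
    using surj[of n] de by (auto simp: image_image)
  ultimately show ?thesis by blast
qed

end

section \<open>Kernels of module homomorphisms\<close>

context ugm_hom
begin

text \<open>Shrinking the carrier keeps the element type, so the kernel of a cover built in
  \<open>'p\<close> is again a module in \<open>'p\<close>, and the inclusion is the
  identity.\<close>

definition ker_mod :: "nat \<Rightarrow> ('r, 'x) module" where
  "ker_mod n = (M n)\<lparr>carrier := {x \<in> carrier (M n). \<eta> n x = \<zero>\<^bsub>M' n\<^esub>}\<rparr>"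

lemma ker_mod_simps [simp]: "carrier (ker_mod n) = {x \<in> carrier (M n). \<eta> n x = \<zero>\<^bsub>M' n\<^esub>}"
    "\<zero>\<^bsub>ker_mod n\<^esub> = \<zero>\<^bsub>M n\<^esub>" "x \<oplus>\<^bsub>ker_mod n\<^esub> y = x \<oplus>\<^bsub>M n\<^esub> y" "r \<odot>\<^bsub>ker_mod n\<^esub> x = r \<odot>\<^bsub>M n\<^esub> x"
  by (simp_all add: ker_mod_def)

lemma ker_module: "module R (ker_mod n)"
proof -
  interpret X: module R "M n" by (rule A.mod)
  interpret Y: module R "M' n" by (rule B.mod)
  show ?thesis
  proof (rule moduleI)
    show "abelian_group (ker_mod n)"
    proof (rule abelian_groupI)
      fix x assume "x \<in> carrier (ker_mod n)"
      then have "\<ominus>\<^bsub>M n\<^esub> x \<in> carrier (ker_mod n)" "\<ominus>\<^bsub>M n\<^esub> x \<oplus>\<^bsub>ker_mod n\<^esub> x = \<zero>\<^bsub>ker_mod n\<^esub>"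
        using hom_neg[of x n] Y.M.minus_equality[of "\<zero>\<^bsub>M' n\<^esub>" "\<zero>\<^bsub>M' n\<^esub>"] X.M.l_neg by auto
      then show "\<exists>y\<in>carrier (ker_mod n). y \<oplus>\<^bsub>ker_mod n\<^esub> x = \<zero>\<^bsub>ker_mod n\<^esub>" by blast
    qed (auto simp: hom_add hom_zero X.M.a_ac)
  qed (auto simp: hom_smult X.smult_l_distr X.smult_r_distr X.smult_assoc1 X.is_cring)
qed

lemma act'_zero: "\<phi> \<in> UHom G os s t \<Longrightarrow> act' s t \<phi> \<zero>\<^bsub>M' s\<^esub> = \<zero>\<^bsub>M' t\<^esub>"
proof -
  assume \<phi>: "\<phi> \<in> UHom G os s t"
  interpret X: module R "M' s" by (rule B.mod)
  interpret Y: module R "M' t" by (rule B.mod)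
  show ?thesis using B.act_add[OF \<phi>, of "\<zero>\<^bsub>M' s\<^esub>" "\<zero>\<^bsub>M' s\<^esub>"] B.act_closed[OF \<phi>, of "\<zero>\<^bsub>M' s\<^esub>"] by simp
qed

lemma ker_ug_module: "ug_module G os R ker_mod act"
  unfolding ug_module_def
  by (auto simp: ker_module linear_map_def A.act_closed A.act_add A.act_smult A.act_uid A.act_ucomp hom_act act'_zero)

lemma ker_incl: "ug_hom G os R ker_mod act M act (\<lambda>n x. x)"
  by (auto simp: ug_hom_def linear_map_def)

lemma ker_ses:
  assumes "\<And>n. \<eta> n ` carrier (M n) = carrier (M' n)"
  shows "ugm_ses G os b R ker_mod act M act M' act' (\<lambda>n x. x) \<eta>"
  by (intro ugm_ses.intro ugm_ses_axioms.intro ugm_hom.intro ugm.intro ugm_axioms.intro ugm_hom_axioms.intro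
      A.braided_stab_axioms ker_ug_module ker_incl A.ugm B.ugm hom) (auto simp: assms)

end

section \<open>Resolutions\<close>

locale braided_ring = braided_stab G os b for G :: "nat \<Rightarrow> 'g monoid" and os b +
  fixes R :: "'r ring"
  assumes cring: "cring R"
begin

text \<open>With q = i + 1 the bound d_(i+1) is simply \<open>d q\<close>, and passing to a kernel
  becomes a shift of \<open>d\<close>.\<close>

definition vanish :: "nat \<Rightarrow> (nat \<Rightarrow> int) \<Rightarrow> (nat \<Rightarrow> ('r, 'x) module) \<Rightarrow> (nat \<Rightarrow> nat \<Rightarrow> 'g set \<Rightarrow> 'x \<Rightarrow> 'x) \<Rightarrow> bool" where
  "vanish N d M act \<longleftrightarrow> (\<forall>q n. q \<le> N \<and> d q < int n \<longrightarrow> ugm.exact_at G os b M act n q)"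

lemma ugmI: "ug_module G os R M act \<Longrightarrow> ugm G os b R M act"
  by (intro ugm.intro ugm_axioms.intro braided_stab_axioms)

lemma cs_vanishing_iff:
  assumes "ug_module G os R M act"
  shows "(\<forall>i n. -1 \<le> i \<and> i < int N \<and> d (nat (i + 1)) < int n \<longrightarrow> cs_homology_vanishes G os b R M act i n)
    \<longleftrightarrow> vanish N d M act"
proof -
  interpret ugm G os b R M act by (rule ugmI[OF assms])
  show ?thesis unfolding vanish_def cs_homology_vanishes_iff[symmetric]
  proof (intro iffI allI impI)
    fix q n assume a: "\<forall>i n. -1 \<le> i \<and> i < int N \<and> d (nat (i + 1)) < int n \<longrightarrow> cs_homology_vanishes G os b R M act i n"
      and q: "q \<le> N \<and> d q < int n"
    show "cs_homology_vanishes G os b R M act (int q - 1) n" using a[rule_format, of "int q - 1" n] q by simp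
  next
    fix i n assume a: "\<forall>q n. q \<le> N \<and> d q < int n \<longrightarrow> cs_homology_vanishes G os b R M act (int q - 1) n"
      and i: "- 1 \<le> i \<and> i < int N \<and> d (nat (i + 1)) < int n"
    have "int (nat (i + 1)) - 1 = i" "nat (i + 1) \<le> N" using i by auto
    then show "cs_homology_vanishes G os b R M act i n" using a[rule_format, of "nat (i + 1)" n] i by simp
  qed
qed

text \<open>A generator of rank m \<le> d0 contributes the constant complex in rank n - m. For q = 0
  it suffices that n - m > 0; for q > 0, H3 needs n - m > k(q - 1) + a.\<close>

lemma free_vanish:
  fixes P :: "nat \<Rightarrow> ('r, 'x) module"
  assumes P: "ug_module G os R P Pact" "free_gen_le G os R P Pact d0"
    and const: "vanish N (\<lambda>q. int k * (int q - 1) + int a) (\<lambda>n. ring_mod R) const_act"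
    and q: "q \<le> N" "d0 < int n" "0 < q \<Longrightarrow> int k * (int q - 1) + int a + d0 < int n"
  shows "ugm.exact_at G os b P Pact n q"
proof -
  obtain J :: "'x set" and rk \<eta> where J: "\<forall>j\<in>J. int (rk j) \<le> d0"
    "ug_hom G os R (free_mod G os R J rk) (free_act G os R rk) P Pact \<eta>"
    "\<forall>n. bij_betw (\<eta> n) (carrier (free_mod G os R J rk n)) (carrier (P n))"
    using P(2) unfolding free_gen_le_def by blast
  interpret U: free_ug G os b R J rk by (intro free_ug.intro braided_stab_axioms cring)
  interpret E: ugm_hom G os b R U.F U.fa P Pact \<eta>
    by (intro ugm_hom.intro ugm_hom_axioms.intro ugmI U.free_ug_module P J)
  have "U.FM.exact_at n q"
  proof (rule U.free_exact_at)
    fix j assume j: "j \<in> J" "rk j \<le> n"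
    have rkj: "int (rk j) \<le> d0" using J j by blast
    show "U.CM.exact_at (n - rk j) q"
    proof (cases q)
      case 0
      have "0 < n - rk j" using rkj q(2) by simp
      then show ?thesis using U.const_exact_at_0 0 by simp
    next
      case (Suc p)
      have "int k * (int q - 1) + int a < int (n - rk j)" using q(3) Suc rkj j(2) by (simp add: of_nat_diff)
      then show ?thesis using const q(1) unfolding vanish_def by blast
    qed
  qed
  then show ?thesis using E.exact_at_iso J(3) by blast
qed

lemma slope:
  assumes "\<forall>i<N. d (Suc i) - d i \<ge> int (max k a)" "q \<le> N"
  shows "d 0 + int q * int (max k a) \<le> d q"
  using assms(2)
proof (induction q)
  case (Suc q)
  then show ?case using assms(1)[rule_format, of q] by (simp add: algebra_simps)
qed simp

lemma free_vanish_slope: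
  assumes P: "ug_module G os R P Pact" "free_gen_le G os R P Pact (d 0)"
    and const: "vanish N (\<lambda>q. int k * (int q - 1) + int a) (\<lambda>n. ring_mod R) const_act"
    and d: "\<forall>i<N. d (Suc i) - d i \<ge> int (max k a)"
  shows "vanish N d P Pact"
  unfolding vanish_def
proof (intro allI impI)
  fix q n assume q: "q \<le> N \<and> d q < int n"
  have s: "d 0 + int q * int (max k a) \<le> d q" using slope[OF d] q by blast
  have z: "0 \<le> int q * int (max k a)" by simp
  show "ugm.exact_at G os b P Pact n q"
  proof (rule free_vanish[OF P const])
    show "d 0 < int n" using s z q by linarith
    assume "0 < q"
    then obtain p where p: "q = Suc p" by (cases q) auto
    \<comment> \<open>Of the q copies of max(k,a), one pays for a and the other q - 1 pay for k
      each.\<close>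
    have "int k * int p \<le> int (max k a) * int p" by (intro mult_right_mono) auto
    then have "int k * (int q - 1) + int a \<le> int q * int (max k a)" by (simp add: p algebra_simps)
    then show "int k * (int q - 1) + int a + d 0 < int n" using s q by linarith
  qed (use q in simp)
qed

text \<open>\<open>P\<close> is exact at q beyond d_q, hence also beyond d_(q+1). In this range
  exactness of \<open>V\<close> at q + 1 and of the kernel at q imply each other; exactness of
  \<open>V\<close> at 0 is inherited from \<open>P\<close> through the surjection.\<close>

lemma vanish_step:
  assumes M: "ug_module G os R V Vact" and P: "ug_module G os R P Pact" "free_gen_le G os R P Pact (d 0)"
    and \<epsilon>: "ug_hom G os R P Pact V Vact \<epsilon>" "\<And>n. \<epsilon> n ` carrier (P n) = carrier (V n)"
    and const: "vanish (Suc N) (\<lambda>q. int k * (int q - 1) + int a) (\<lambda>n. ring_mod R) const_act"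
    and d: "\<forall>i<Suc N. d (Suc i) - d i \<ge> int (max k a)"
  shows "vanish (Suc N) d V Vact \<longleftrightarrow> vanish N (\<lambda>i. d (Suc i)) (ugm_hom.ker_mod P V \<epsilon>) Pact"
proof -
  interpret E: ugm_hom G os b R P Pact V Vact \<epsilon>
    by (intro ugm_hom.intro ugm_hom_axioms.intro ugmI P M \<epsilon>)
  interpret S: ugm_ses G os b R E.ker_mod Pact P Pact V Vact "\<lambda>n x. x" \<epsilon>
    by (rule E.ker_ses[OF \<epsilon>(2)])
  have fr: "E.A.exact_at n q" if "q \<le> Suc N" "d q < int n" for n q
    using free_vanish_slope[OF P const d] that unfolding vanish_def by blast
  have mono: "d q \<le> d (Suc q)" if "q \<le> N" for q
    using d[rule_format, of q] that by linarith
  show ?thesis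
  proof
    assume V: "vanish (Suc N) d V Vact"
    show "vanish N (\<lambda>i. d (Suc i)) E.ker_mod Pact"
      unfolding vanish_def
    proof (intro allI impI)
      fix q n assume q: "q \<le> N \<and> d (Suc q) < int n"
      have "E.A.exact_at n q" using fr mono[of q] q by simp
      moreover have "E.B.exact_at n (Suc q)" using V q unfolding vanish_def by simp
      ultimately show "ugm.exact_at G os b E.ker_mod Pact n q" by (rule S.exact_at_sub)
    qed
  next
    assume K: "vanish N (\<lambda>i. d (Suc i)) E.ker_mod Pact"
    show "vanish (Suc N) d V Vact"
      unfolding vanish_def
    proof (intro allI impI)
      fix q n assume q: "q \<le> Suc N \<and> d q < int n"
      show "E.B.exact_at n q"
      proof (cases q)
        case 0
        then show ?thesis using E.exact_at_0_surj[OF \<epsilon>(2)] fr q by blast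
      next
        case (Suc p)
        have "ugm.exact_at G os b E.ker_mod Pact n p" using K q Suc unfolding vanish_def by simp
        then show ?thesis using S.exact_at_quotient fr q Suc by blast
      qed
    qed
  qed
qed

text \<open>Exactness at P_0 says that the image of \<open>\<delta> 0\<close> is the kernel of
  \<open>\<epsilon>\<close>, so with its target restricted it becomes the augmentation of the
  tail.\<close>

lemma resolution_tail:
  assumes V: "ug_module G os R V Vact" and res: "free_resolution G os R (Suc N) d V Vact P Pact \<delta> \<epsilon>"
  shows "free_resolution G os R N (\<lambda>i. d (Suc i)) (ugm_hom.ker_mod (P 0) V \<epsilon>) (Pact 0)
    (\<lambda>i. P (Suc i)) (\<lambda>i. Pact (Suc i)) (\<lambda>i. \<delta> (Suc i)) (\<delta> 0)"
proof -
  have P: "ug_module G os R (P i) (Pact i)" "free_gen_le G os R (P i) (Pact i) (d i)" if "i \<le> Suc N" for i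
    using res that by (simp_all add: free_resolution_def)
  have \<delta>: "ug_hom G os R (P (Suc i)) (Pact (Suc i)) (P i) (Pact i) (\<delta> i)" if "i < Suc N" for i
    using res that by (simp add: free_resolution_def)
  have \<epsilon>: "ug_hom G os R (P 0) (Pact 0) V Vact \<epsilon>" using res by (simp add: free_resolution_def)
  have ex0: "\<delta> 0 n ` carrier (P 1 n) = {x \<in> carrier (P 0 n). \<epsilon> n x = \<zero>\<^bsub>V n\<^esub>}" for n using res by (simp add: free_resolution_def)
  have ex: "\<delta> i n ` carrier (P (Suc i) n) = {x \<in> carrier (P i n). \<delta> (i - 1) n x = \<zero>\<^bsub>P (i - 1) n\<^esub>}"
    if "1 \<le> i" "i < Suc N" for i n using res that by (simp add: free_resolution_def)
  interpret E: ugm_hom G os b R "P 0" "Pact 0" V Vact \<epsilon>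
    by (intro ugm_hom.intro ugm_hom_axioms.intro ugmI P V \<epsilon>) simp
  have im: "\<delta> 0 n x \<in> carrier (E.ker_mod n)" if "x \<in> carrier (P (Suc 0) n)" for n x
    using ex0[of n] that by auto
  have "ug_hom G os R (P (Suc 0)) (Pact (Suc 0)) E.ker_mod (Pact 0) (\<delta> 0)"
    using \<delta>[of 0] im unfolding ug_hom_def linear_map_def by simp
  moreover have "\<delta> (Suc i) n ` carrier (P (Suc (Suc i)) n)
      = {x \<in> carrier (P (Suc i) n). \<delta> (Suc (i - 1)) n x = \<zero>\<^bsub>P (Suc (i - 1)) n\<^esub>}" if "1 \<le> i \<and> i < N" for i n
    using ex[of "Suc i" n] that by simp
  moreover have "\<delta> (Suc 0) n ` carrier (P (Suc 1) n) = {x \<in> carrier (P (Suc 0) n). \<delta> 0 n x = \<zero>\<^bsub>E.ker_mod n\<^esub>}"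
    if "1 \<le> N" for n
    using ex[of 1 n] that by simp
  moreover have "\<delta> 0 n ` carrier (P (Suc 0) n) = carrier (E.ker_mod n)" for n
    using ex0 by simp
  ultimately show ?thesis unfolding free_resolution_def using P \<delta> by auto
qed

text \<open>Splicing: the augmentation onto the kernel, followed by the inclusion, becomes the first
  differential.\<close>

lemma resolution_Cons:
  assumes V: "ug_module G os R V Vact" and P: "ug_module G os R P0 Pact0" "free_gen_le G os R P0 Pact0 (d 0)"
    and \<epsilon>: "ug_hom G os R P0 Pact0 V Vact \<epsilon>" "\<And>n. \<epsilon> n ` carrier (P0 n) = carrier (V n)"
    and res: "free_resolution G os R N (\<lambda>i. d (Suc i)) (ugm_hom.ker_mod P0 V \<epsilon>) Pact0 P Pact \<delta> \<epsilon>'"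
  shows "free_resolution G os R (Suc N) d V Vact (case_nat P0 P) (case_nat Pact0 Pact) (case_nat \<epsilon>' \<delta>) \<epsilon>"
proof -
  interpret E: ugm_hom G os b R P0 Pact0 V Vact \<epsilon>
    by (intro ugm_hom.intro ugm_hom_axioms.intro ugmI P V \<epsilon>)
  have r1: "ug_module G os R (P i) (Pact i)" "free_gen_le G os R (P i) (Pact i) (d (Suc i))" if "i \<le> N" for i
    using res that by (simp_all add: free_resolution_def)
  have r2: "ug_hom G os R (P (Suc i)) (Pact (Suc i)) (P i) (Pact i) (\<delta> i)" if "i < N" for i
    using res that by (simp add: free_resolution_def)
  have r3: "ug_hom G os R (P 0) (Pact 0) E.ker_mod Pact0 \<epsilon>'" using res by (simp add: free_resolution_def)
  have r4: "\<epsilon>' n ` carrier (P 0 n) = carrier (E.ker_mod n)" for n using res by (simp add: free_resolution_def)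
  have r5: "\<delta> 0 n ` carrier (P 1 n) = {x \<in> carrier (P 0 n). \<epsilon>' n x = \<zero>\<^bsub>E.ker_mod n\<^esub>}" if "1 \<le> N" for n
    using res that by (simp add: free_resolution_def)
  have r6: "\<delta> i n ` carrier (P (Suc i) n) = {x \<in> carrier (P i n). \<delta> (i - 1) n x = \<zero>\<^bsub>P (i - 1) n\<^esub>}"
    if "1 \<le> i" "i < N" for i n using res that by (simp add: free_resolution_def)
  have h0: "ug_hom G os R (P 0) (Pact 0) P0 Pact0 \<epsilon>'"
    using ug_hom_comp[OF r3 E.ker_incl] by simp
  show ?thesis unfolding free_resolution_def
  proof (intro conjI allI impI)
    fix i assume "i \<le> Suc N"
    then show "ug_module G os R (case_nat P0 P i) (case_nat Pact0 Pact i)"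
      and "free_gen_le G os R (case_nat P0 P i) (case_nat Pact0 Pact i) (d i)"
      using P r1 by (cases i; simp)+
  next
    fix i assume "i < Suc N"
    then show "ug_hom G os R (case_nat P0 P (Suc i)) (case_nat Pact0 Pact (Suc i)) (case_nat P0 P i) (case_nat Pact0 Pact i) (case_nat \<epsilon>' \<delta> i)"
      using h0 r2 by (cases i) simp_all
  next
    show "ug_hom G os R (case_nat P0 P 0) (case_nat Pact0 Pact 0) V Vact \<epsilon>" using \<epsilon> by simp
    show "\<epsilon> n ` carrier (case_nat P0 P 0 n) = carrier (V n)" for n using \<epsilon> by simp
    show "case_nat \<epsilon>' \<delta> 0 n ` carrier (case_nat P0 P 1 n) = {x \<in> carrier (case_nat P0 P 0 n). \<epsilon> n x = \<zero>\<^bsub>V n\<^esub>}" for n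
      using r4[of n] by simp
  next
    fix i n assume i: "1 \<le> i \<and> i < Suc N"
    then obtain i' where i': "i = Suc i'" by (cases i) auto
    show "case_nat \<epsilon>' \<delta> i n ` carrier (case_nat P0 P (Suc i) n)
      = {x \<in> carrier (case_nat P0 P i n). case_nat \<epsilon>' \<delta> (i - 1) n x = \<zero>\<^bsub>case_nat P0 P (i - 1) n\<^esub>}"
    proof (cases i')
      case 0
      then show ?thesis using r5[of n] i i' by simp
    next
      case (Suc i'')
      then show ?thesis using r6[of i' n] i i' by simp
    qed
  qed
qed

text \<open>\<open>V\<close> has elements in \<open>'v\<close>, but all kernels that follow live in
  \<open>'p\<close>. As an induction cannot change the type, one step is isolated for arbitrary
  \<open>'v\<close>, with the statement for kernels as the premise \<open>IH\<close>.\<close>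

lemma resolution_iff_vanish_step:
  fixes V :: "nat \<Rightarrow> ('r, 'v) module" and fr :: "'r \<Rightarrow> 'p" and fg :: "'g \<Rightarrow> 'p" and fv :: "'v \<Rightarrow> 'p"
  assumes inj: "inj fr" "inj fg" "inj fv" and inf: "infinite (UNIV :: 'p set)"
    and V: "ug_module G os R V Vact"
    and const: "vanish N (\<lambda>q. int k * (int q - 1) + int a) (\<lambda>n. ring_mod R) const_act"
    and d: "\<forall>i<N. d (Suc i) - d i \<ge> int (max k a)"
    and IH: "\<And>N' (K :: nat \<Rightarrow> ('r, 'p) module) Kact. \<lbrakk>N = Suc N'; ug_module G os R K Kact\<rbrakk> \<Longrightarrow>
      (\<exists>(P :: nat \<Rightarrow> nat \<Rightarrow> ('r, 'p) module) Pact \<delta> \<epsilon>. free_resolution G os R N' (\<lambda>i. d (Suc i)) K Kact P Pact \<delta> \<epsilon>)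
      \<longleftrightarrow> vanish N' (\<lambda>i. d (Suc i)) K Kact"
  shows "(\<exists>(P :: nat \<Rightarrow> nat \<Rightarrow> ('r, 'p) module) Pact \<delta> \<epsilon>. free_resolution G os R N d V Vact P Pact \<delta> \<epsilon>) \<longleftrightarrow> vanish N d V Vact"
proof
  assume "\<exists>(P :: nat \<Rightarrow> nat \<Rightarrow> ('r, 'p) module) Pact \<delta> \<epsilon>. free_resolution G os R N d V Vact P Pact \<delta> \<epsilon>"
  then obtain P :: "nat \<Rightarrow> nat \<Rightarrow> ('r, 'p) module" and Pact \<delta> \<epsilon> where res: "free_resolution G os R N d V Vact P Pact \<delta> \<epsilon>"
    by blast
  have P0: "ug_module G os R (P 0) (Pact 0)" "free_gen_le G os R (P 0) (Pact 0) (d 0)"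
    and \<epsilon>: "ug_hom G os R (P 0) (Pact 0) V Vact \<epsilon>" "\<And>n. \<epsilon> n ` carrier (P 0 n) = carrier (V n)"
    using res by (simp_all add: free_resolution_def)
  interpret E: ugm_hom G os b R "P 0" "Pact 0" V Vact \<epsilon>
    by (intro ugm_hom.intro ugm_hom_axioms.intro ugmI P0 V \<epsilon>)
  show "vanish N d V Vact"
  proof (cases N)
    case 0
    have "vanish N d (P 0) (Pact 0)" by (rule free_vanish_slope[where d = d, OF P0 const d])
    then show ?thesis using 0 E.exact_at_0_surj[OF \<epsilon>(2)] by (simp add: vanish_def)
  next
    case (Suc N')
    have "vanish N' (\<lambda>i. d (Suc i)) E.ker_mod (Pact 0)"
      using IH[OF Suc E.ker_ug_module] resolution_tail[OF V res[unfolded Suc]] by blast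
    then show ?thesis unfolding Suc
      using vanish_step[where d = d, OF V P0 \<epsilon> const[unfolded Suc] d[unfolded Suc]] by blast
  qed
next
  assume van: "vanish N d V Vact"
  interpret V: ugm G os b R V Vact by (rule ugmI[OF V])
  have "V.exact_at n 0" if "d 0 < int n" for n using van that unfolding vanish_def by blast
  then obtain P0 :: "nat \<Rightarrow> ('r, 'p) module" and Pact0 \<epsilon> where P0: "ug_module G os R P0 Pact0" "free_gen_le G os R P0 Pact0 (d 0)"
    and \<epsilon>: "ug_hom G os R P0 Pact0 V Vact \<epsilon>" "\<And>n. \<epsilon> n ` carrier (P0 n) = carrier (V n)"
    using V.free_cover[OF inj inf, of "d 0"] by blast
  interpret E: ugm_hom G os b R P0 Pact0 V Vact \<epsilon>
    by (intro ugm_hom.intro ugm_hom_axioms.intro ugmI P0 V \<epsilon>)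
  show "\<exists>(P :: nat \<Rightarrow> nat \<Rightarrow> ('r, 'p) module) Pact \<delta> \<epsilon>. free_resolution G os R N d V Vact P Pact \<delta> \<epsilon>"
  proof (cases N)
    case 0
    \<comment> \<open>With N = 0 the sequence stops at P_0; the entries beyond it are
      fillers.\<close>
    have "free_resolution G os R N d V Vact (\<lambda>_. P0) (\<lambda>_. Pact0) (\<lambda>_ _ x. x) \<epsilon>"
      unfolding free_resolution_def using 0 P0 \<epsilon> by auto
    then show ?thesis by blast
  next
    case (Suc N')
    have "vanish N' (\<lambda>i. d (Suc i)) E.ker_mod Pact0"
      using vanish_step[where d = d, OF V P0 \<epsilon> const[unfolded Suc] d[unfolded Suc]] van Suc by blast
    then obtain P :: "nat \<Rightarrow> nat \<Rightarrow> ('r, 'p) module" and Pact \<delta> \<epsilon>'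
      where "free_resolution G os R N' (\<lambda>i. d (Suc i)) E.ker_mod Pact0 P Pact \<delta> \<epsilon>'"
      using IH[OF Suc E.ker_ug_module] by blast
    then show ?thesis unfolding Suc using resolution_Cons[where d = d, OF V P0 \<epsilon>] by blast
  qed
qed

lemma vanish_mono: "vanish (Suc N) d M act \<Longrightarrow> vanish N d M act"
  by (simp add: vanish_def)

text \<open>The induction proper, with all modules in \<open>'p\<close>; elements of
  \<open>V\<close> are then coded by the identity.\<close>

lemma resolution_iff_vanish_same:
  fixes V :: "nat \<Rightarrow> ('r, 'p) module" and fr :: "'r \<Rightarrow> 'p" and fg :: "'g \<Rightarrow> 'p"
  assumes inj: "inj fr" "inj fg" and inf: "infinite (UNIV :: 'p set)"
  shows "\<lbrakk>ug_module G os R V Vact;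
      vanish N (\<lambda>q. int k * (int q - 1) + int a) (\<lambda>n. ring_mod R) const_act;
      \<forall>i<N. d (Suc i) - d i \<ge> int (max k a)\<rbrakk>
    \<Longrightarrow> (\<exists>(P :: nat \<Rightarrow> nat \<Rightarrow> ('r, 'p) module) Pact \<delta> \<epsilon>. free_resolution G os R N d V Vact P Pact \<delta> \<epsilon>) \<longleftrightarrow> vanish N d V Vact"
proof (induction N arbitrary: d V Vact)
  case 0
  show ?case by (rule resolution_iff_vanish_step[OF inj inj_on_id inf 0]) simp
next
  case (Suc N)
  show ?case
  proof (rule resolution_iff_vanish_step[OF inj inj_on_id inf Suc.prems])
    fix N' and K :: "nat \<Rightarrow> ('r, 'p) module" and Kact
    assume N: "Suc N = Suc N'" and K: "ug_module G os R K Kact"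
    have N': "N' = N" using N by simp
    show "(\<exists>(P :: nat \<Rightarrow> nat \<Rightarrow> ('r, 'p) module) Pact \<delta> \<epsilon>. free_resolution G os R N' (\<lambda>i. d (Suc i)) K Kact P Pact \<delta> \<epsilon>)
      \<longleftrightarrow> vanish N' (\<lambda>i. d (Suc i)) K Kact"
      unfolding N' by (rule Suc.IH[OF K vanish_mono[OF Suc.prems(2)]]) (use Suc.prems(3) in auto)
  qed
qed

end

text \<open>The existence of the P_i is stated inside one type \<open>'p\<close>. By
  \<open>big\<close> this type is infinite and receives injections from the coefficients, the group
  elements and the elements of \<open>V\<close>, which is what coding the free covers takes.\<close>

theorem theorem5p7:
  fixes G :: "nat \<Rightarrow> 'g monoid" and os :: "nat \<Rightarrow> nat \<Rightarrow> 'g \<Rightarrow> 'g \<Rightarrow> 'g"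
    and b :: "nat \<Rightarrow> nat \<Rightarrow> 'g"
    and R :: "'r ring"
    and N k a :: nat
    and V :: "nat \<Rightarrow> ('r, 'v) module" and Vact :: "nat \<Rightarrow> nat \<Rightarrow> 'g set \<Rightarrow> 'v \<Rightarrow> 'v"
    and d :: "nat \<Rightarrow> int"
  assumes "stability_groupoid G os"
    and "braiding G os b"
    and "cring R"
    and H3: "\<forall>i n. -1 \<le> i \<and> i < int N \<and> int n > int k * i + int a \<longrightarrow>
               cs_homology_vanishes G os b R (\<lambda>n. ring_mod R) const_act i n"
    and "ug_module G os R V Vact"
    and "\<forall>i<N. d (Suc i) - d i \<ge> int (max k a)"
    and big: "\<exists>f :: 'r + 'g + 'v + nat \<Rightarrow> 'p. inj f"
  shows "(\<exists>(P :: nat \<Rightarrow> nat \<Rightarrow> ('r, 'p) module) Pact \<delta> \<epsilon>.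
            free_resolution G os R N d V Vact P Pact \<delta> \<epsilon>)
         \<longleftrightarrow> (\<forall>i n. -1 \<le> i \<and> i < int N \<and> int n > d (nat (i + 1)) \<longrightarrow>
                 cs_homology_vanishes G os b R V Vact i n)"
proof -
  interpret braided_ring G os b R
    by (intro braided_ring.intro braided_stab.intro braided_ring_axioms.intro assms)
  obtain f :: "'r + 'g + 'v + nat \<Rightarrow> 'p" where f: "inj f" using big by blast
  have inj: "inj (\<lambda>x. f (Inl x))" "inj (\<lambda>x. f (Inr (Inl x)))" "inj (\<lambda>x. f (Inr (Inr (Inl x))))"
    "inj (\<lambda>x. f (Inr (Inr (Inr x))))"
    by (auto intro!: injI dest!: injD[OF f])
  have inf: "infinite (UNIV :: 'p set)"
    using inj(4) finite_imageD[of "\<lambda>x. f (Inr (Inr (Inr x)))" UNIV] finite_subset[OF subset_UNIV] infinite_UNIV_nat by blast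
  have const: "vanish N (\<lambda>q. int k * (int q - 1) + int a) (\<lambda>n. ring_mod R) const_act"
    unfolding cs_vanishing_iff[OF const_ug_module[OF assms(3)], symmetric] using H3 by simp
  have "(\<exists>(P :: nat \<Rightarrow> nat \<Rightarrow> ('r, 'p) module) Pact \<delta> \<epsilon>. free_resolution G os R N d V Vact P Pact \<delta> \<epsilon>)
      \<longleftrightarrow> vanish N d V Vact"
  proof (rule resolution_iff_vanish_step[OF inj(1-3) inf assms(5) const assms(6)])
    fix N' and K :: "nat \<Rightarrow> ('r, 'p) module" and Kact
    assume N: "N = Suc N'" and K: "ug_module G os R K Kact"
    show "(\<exists>(P :: nat \<Rightarrow> nat \<Rightarrow> ('r, 'p) module) Pact \<delta> \<epsilon>. free_resolution G os R N' (\<lambda>i. d (Suc i)) K Kact P Pact \<delta> \<epsilon>)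
      \<longleftrightarrow> vanish N' (\<lambda>i. d (Suc i)) K Kact"
      by (rule resolution_iff_vanish_same[OF inj(1,2) inf K vanish_mono[OF const[unfolded N]]])
        (use assms(6) N in auto)
  qed
  then show ?thesis unfolding cs_vanishing_iff[OF assms(5)] .
qed

end
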